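(* Let $\mathcal{M}=TQ\times\mathbb{R}$ and consider the system $$\nabla_{\dot{\bar q}}\dot{\bar q}=-R(\bar q)\dot{\bar q}-\kappa\,(\alpha\alpha')(\psi(\bar q)-\bar\eta)\,\operatorname{grad}\psi(\bar q),\qquad \dot{\bar\eta}=-h\bar\eta+h\psi(\bar q) \qquad (\mathrm{A})$$ with data as in the context. Suppose that $-R$ is strictly dissipative, i.e. $-\langle\!\langle R(q)v,v\rangle\!\rangle_q<0$ for every $q\in Q$ and every $v\in T_qQ$ with $v\neq0$. Suppose that $y_\ast,y_0\in\mathbb{R}$ with $y_\ast<y_0$ are such that 1. $y_\ast$ is the global minimum value of $\psi$; 2. the sublevel set $\{q\in Q:\psi(q)\leq y_0\}$ is compact; 3. $\operatorname{grad}\psi(q)\neq0$ for every $q\in Q$ with $y_\ast<\psi(q)\leq y_0$. Then the set $$S(y_\ast)=\{((q,v),\eta)\in TQ\times\mathbb{R}\ :\ \psi(q)=y_\ast=\eta,\ v=0\}$$ is $S(y_0)$-uniformly asymptotically stable for $(\mathrm{A})$, where for $y\in\mathbb{R}$ the set $S(y)$ is the scaled sublevel set of the function $V$ defined in the context.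
   Context: Setting. $Q$ is a properly embedded (hence closed) smooth submanifold of some Euclidean space $\mathbb{R}^N$; $T_qQ$ is regarded as a subspace of $\mathbb{R}^N$ and $TQ=\{(q,v):q\in Q,\,v\in T_qQ\}\subset\mathbb{R}^N\times\mathbb{R}^N$. Thus $\mathcal{M}=TQ\times\mathbb{R}$ is a submanifold of $\mathbb{R}^{2N+1}$. $\langle\!\langle\cdot,\cdot\rangle\!\rangle$ is a smooth Riemannian metric on $Q$ with induced norm $\|\cdot\|_q$ on $T_qQ$, $\nabla$ is its Levi-Civita connection, and $\operatorname{grad}\psi$ is the gradient with respect to it. $R$ is a smooth bundle map over $Q$, i.e. it assigns smoothly to each $q\in Q$ a linear map $R(q)\colon T_qQ\to T_qQ$; $\psi\colon Q\to\mathbb{R}$ is smooth. $\nabla_{\dot q}\dot q$ denotes the geometric acceleration (covariant derivative of $\dot q$ along $q$). $\alpha\colon\mathbb{R}\to\mathbb{R}$ is smooth and such that the product $\alpha\alpha'$ of $\alpha$ with its derivative is positive and strictly increasing. $\kappa>0$ and $h>0$ are constants. System $(\mathrm{A})$ is regarded as a first-order differential equation on $\mathcal{M}$ for the state $\bar x=((\bar q,\bar v),\bar\eta)$ with $\bar v=\dot{\bar q}$. The function $V$ and the sets $S(y)$. Let $\beta(z):=\int_0^z\big((\alpha\alpha')(\tilde z)-(\alpha\alpha')(0)\big)\,d\tilde z$ and, for $x=((q,v),\eta)\in\mathcal{M}$, $$V(x):=\tfrac12\|v\|_q^2+\kappa\,(\alpha\alpha')(0)\,(\psi(q)-y_\ast)+\kappa\,\beta(\psi(q)-\eta).$$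 For $y\in\mathbb{R}$ let $S(y):=\{x\in\mathcal{M}: V(x)\leq\kappa(\alpha\alpha')(0)(y-y_\ast)\}$. Stability notion. For a nonempty compact $K\subset\mathcal{M}$, $|x|_K$ is the Euclidean distance of $x$ to $K$. For a neighborhood $S$ of $K$ in $\mathcal{M}$, $K$ is $S$-uniformly asymptotically stable for $(\mathrm{A})$ if both of the following hold. (i) For every $\varepsilon>0$ there exists $\delta>0$ such that, for every $t_0\in\mathbb{R}$ and every $\bar x_0\in\mathcal{M}$ with $|\bar x_0|_K\le\delta$, the maximal solution $\bar x$ of $(\mathrm{A})$ with $\bar x(t_0)=\bar x_0$ satisfies $|\bar x(t)|_K\leq\varepsilon$ for every $t\ge t_0$ (in particular it exists for all $t\geq t_0$). (ii) For all $r,\varepsilon>0$ there exist $\Delta,\rho>0$ such that, for every $t_0\in\mathbb{R}$ and every $\bar x_0\in S$ with $|\bar x_0|_K\le r$, the maximal solution $\bar x$ of $(\mathrm{A})$ with $\bar x(t_0)=\bar x_0$ satisfies $|\bar x(t)|_K\le\rho$ for every $t\ge t_0$ and $|\bar x(t)|_K\le\varepsilon$ for every $t\ge t_0+\Delta$. *)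

theory Defs
  imports "HOL-Analysis.Analysis"
begin

text \<open>
  A submanifold \<open>Q\<close> of a Euclidean space is represented by its carrier set in a type \<open>'a\<close> of class
  \<open>euclidean_space\<close>. Tensor fields and vector fields on \<open>Q\<close> are total HOL functions; only their
  values at points of \<open>Q\<close> and on tangent vectors are constrained or used.
\<close>

section \<open>Smooth maps\<close>

text \<open>
  On an open set in finite dimension a map is of class \<open>C\<^sup>n\<^sup>+\<^sup>1\<close> iff it is differentiable and all its
  directional derivatives are of class \<open>C\<^sup>n\<close>.
\<close>

primrec Cn_on :: "nat \<Rightarrow> 'a::euclidean_space set \<Rightarrow> ('a \<Rightarrow> 'b::euclidean_space) \<Rightarrow> bool" where
  "Cn_on 0 U f \<longleftrightarrow> continuous_on U f"
| "Cn_on (Suc n) U f \<longleftrightarrow> (\<forall>x\<in>U. f differentiable (at x)) \<and>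
     (\<forall>v. Cn_on n U (\<lambda>x. frechet_derivative f (at x) v))"

definition smooth_on :: "'a::euclidean_space set \<Rightarrow> ('a \<Rightarrow> 'b::euclidean_space) \<Rightarrow> bool" where
  "smooth_on U f \<longleftrightarrow> open U \<and> (\<forall>n. Cn_on n U f)"

text \<open>
  Smoothness on an arbitrary subset of a Euclidean space: existence of local smooth extensions. For
  embedded submanifolds this is the usual notion.
\<close>

definition smooth_map :: "'a::euclidean_space set \<Rightarrow> ('a \<Rightarrow> 'b::euclidean_space) \<Rightarrow> bool" where
  "smooth_map A f \<longleftrightarrow>
     (\<forall>x\<in>A. \<exists>U F. x \<in> U \<and> smooth_on U F \<and> (\<forall>y\<in>U \<inter> A. F y = f y))"

section \<open>Submanifolds and tangent spaces\<close>

definition embedded_submanifold :: "'a::euclidean_space set \<Rightarrow> bool" where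
  "embedded_submanifold Q \<longleftrightarrow>
     (\<exists>k. \<forall>q\<in>Q. \<exists>U W \<phi> \<xi> L. q \<in> U \<and>
        smooth_on U (\<phi> :: 'a \<Rightarrow> 'a) \<and> smooth_on W (\<xi> :: 'a \<Rightarrow> 'a) \<and> \<phi> ` U = W \<and>
        (\<forall>x\<in>U. \<xi> (\<phi> x) = x) \<and>
        subspace L \<and> dim L = k \<and> \<phi> ` (U \<inter> Q) = W \<inter> L)"

definition properly_embedded_submanifold :: "'a::euclidean_space set \<Rightarrow> bool" where
  "properly_embedded_submanifold Q \<longleftrightarrow> embedded_submanifold Q \<and> closed Q"

definition tangent_space :: "'a::euclidean_space set \<Rightarrow> 'a \<Rightarrow> 'a set" where
  "tangent_space Q q = {v. \<exists>e>0. \<exists>\<gamma>. smooth_on {-e<..<e} \<gamma> \<and> (\<forall>t\<in>{-e<..<e}. \<gamma> t \<in> Q) \<and>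
     \<gamma> (0::real) = q \<and> (\<gamma> has_vector_derivative v) (at 0)}"

definition tangent_bundle :: "'a::euclidean_space set \<Rightarrow> ('a \<times> 'a) set" where
  "tangent_bundle Q = {(q, v). q \<in> Q \<and> v \<in> tangent_space Q q}"

definition vector_field :: "'a::euclidean_space set \<Rightarrow> ('a \<Rightarrow> 'a) \<Rightarrow> bool" where
  "vector_field Q X \<longleftrightarrow> smooth_map Q X \<and> (\<forall>q\<in>Q. X q \<in> tangent_space Q q)"

text \<open>
  The differential of a function on \<open>Q\<close>. The Frechet derivative within \<open>Q\<close> need not be unique as a
  linear map on the ambient space, but for differentiable \<open>f\<close> its value on tangent vectors is.
\<close>

definition differential ::
    "'a::euclidean_space set \<Rightarrow> ('a \<Rightarrow> real) \<Rightarrow> 'a \<Rightarrow> 'a \<Rightarrow> real" where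
  "differential Q f q v = frechet_derivative f (at q within Q) v"

section \<open>Riemannian metrics\<close>

definition linear_map_on :: "'a::real_vector set \<Rightarrow> ('a \<Rightarrow> 'b::real_vector) \<Rightarrow> bool" where
  "linear_map_on L f \<longleftrightarrow> (\<forall>u\<in>L. \<forall>w\<in>L. f (u + w) = f u + f w) \<and> (\<forall>c. \<forall>u\<in>L. f (c *\<^sub>R u) = c *\<^sub>R f u)"

definition riemannian_metric ::
    "'a::euclidean_space set \<Rightarrow> ('a \<Rightarrow> 'a \<Rightarrow> 'a \<Rightarrow> real) \<Rightarrow> bool" where
  "riemannian_metric Q g \<longleftrightarrow>
     smooth_map {(q, u, w). q \<in> Q \<and> u \<in> tangent_space Q q \<and> w \<in> tangent_space Q q}
       (\<lambda>(q, u, w). g q u w) \<and>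
     (\<forall>q\<in>Q. \<forall>u\<in>tangent_space Q q. linear_map_on (tangent_space Q q) (g q u)) \<and>
     (\<forall>q\<in>Q. \<forall>u\<in>tangent_space Q q. \<forall>w\<in>tangent_space Q q. g q u w = g q w u) \<and>
     (\<forall>q\<in>Q. \<forall>u\<in>tangent_space Q q. u \<noteq> 0 \<longrightarrow> 0 < g q u u)"

definition metric_norm :: "('a \<Rightarrow> 'a \<Rightarrow> 'a \<Rightarrow> real) \<Rightarrow> 'a \<Rightarrow> 'a \<Rightarrow> real" where
  "metric_norm g q v = sqrt (g q v v)"

definition gradient ::
    "'a::euclidean_space set \<Rightarrow> ('a \<Rightarrow> 'a \<Rightarrow> 'a \<Rightarrow> real) \<Rightarrow> ('a \<Rightarrow> real) \<Rightarrow> 'a \<Rightarrow> 'a" where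
  "gradient Q g \<psi> q = (THE w. w \<in> tangent_space Q q \<and>
     (\<forall>v\<in>tangent_space Q q. g q w v = differential Q \<psi> q v))"

definition bundle_endomorphism :: "'a::euclidean_space set \<Rightarrow> ('a \<Rightarrow> 'a \<Rightarrow> 'a) \<Rightarrow> bool" where
  "bundle_endomorphism Q R \<longleftrightarrow>
     smooth_map (tangent_bundle Q) (\<lambda>(q, v). R q v) \<and>
     (\<forall>q\<in>Q. linear_map_on (tangent_space Q q) (R q) \<and> R q ` tangent_space Q q \<subseteq> tangent_space Q q)"

section \<open>The Levi-Civita connection and covariant derivatives along curves\<close>

definition affine_connection ::
    "'a::euclidean_space set \<Rightarrow> (('a \<Rightarrow> 'a) \<Rightarrow> ('a \<Rightarrow> 'a) \<Rightarrow> 'a \<Rightarrow> 'a) \<Rightarrow> bool" where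
  "affine_connection Q nabla \<longleftrightarrow>
     (\<forall>X Y. vector_field Q X \<longrightarrow> vector_field Q Y \<longrightarrow> vector_field Q (nabla X Y)) \<and>
     (\<forall>X X' Y. vector_field Q X \<longrightarrow> vector_field Q X' \<longrightarrow> vector_field Q Y \<longrightarrow>
        (\<forall>q\<in>Q. nabla (\<lambda>p. X p + X' p) Y q = nabla X Y q + nabla X' Y q)) \<and>
     (\<forall>f X Y. smooth_map Q f \<longrightarrow> vector_field Q X \<longrightarrow> vector_field Q Y \<longrightarrow>
        (\<forall>q\<in>Q. nabla (\<lambda>p. f p *\<^sub>R X p) Y q = f q *\<^sub>R nabla X Y q)) \<and>
     (\<forall>X Y Y'. vector_field Q X \<longrightarrow> vector_field Q Y \<longrightarrow> vector_field Q Y' \<longrightarrow>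
        (\<forall>q\<in>Q. nabla X (\<lambda>p. Y p + Y' p) q = nabla X Y q + nabla X Y' q)) \<and>
     (\<forall>f X Y. smooth_map Q f \<longrightarrow> vector_field Q X \<longrightarrow> vector_field Q Y \<longrightarrow>
        (\<forall>q\<in>Q. nabla X (\<lambda>p. f p *\<^sub>R Y p) q =
           f q *\<^sub>R nabla X Y q + differential Q f q (X q) *\<^sub>R Y q))"

text \<open>
  The last two conjuncts are vanishing torsion, \<open>(\<nabla>\<^bsub>X\<^esub>Y - \<nabla>\<^bsub>Y\<^esub>X) f = X (Y f) - Y (X f)\<close>, and
  compatibility with the metric, \<open>X (g Y Z) = g (\<nabla>\<^bsub>X\<^esub>Y) Z + g Y (\<nabla>\<^bsub>X\<^esub>Z)\<close>.
\<close>

definition levi_civita_connection ::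
    "'a::euclidean_space set \<Rightarrow> ('a \<Rightarrow> 'a \<Rightarrow> 'a \<Rightarrow> real) \<Rightarrow>
     (('a \<Rightarrow> 'a) \<Rightarrow> ('a \<Rightarrow> 'a) \<Rightarrow> 'a \<Rightarrow> 'a) \<Rightarrow> bool" where
  "levi_civita_connection Q g nabla \<longleftrightarrow>
     affine_connection Q nabla \<and>
     (\<forall>X Y f. vector_field Q X \<longrightarrow> vector_field Q Y \<longrightarrow> smooth_map Q f \<longrightarrow>
        (\<forall>q\<in>Q. differential Q f q (nabla X Y q - nabla Y X q) =
           differential Q (\<lambda>p. differential Q f p (Y p)) q (X q) -
           differential Q (\<lambda>p. differential Q f p (X p)) q (Y q))) \<and>
     (\<forall>X Y Z. vector_field Q X \<longrightarrow> vector_field Q Y \<longrightarrow> vector_field Q Z \<longrightarrow>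
        (\<forall>q\<in>Q. differential Q (\<lambda>p. g p (Y p) (Z p)) q (X q) =
           g q (nabla X Y q) (Z q) + g q (Y q) (nabla X Z q)))"

text \<open>
  \<open>has_covariant_derivative Q nabla \<gamma> w a t\<close> says that the vector field \<open>w\<close> along the curve \<open>\<gamma>\<close> has the
  covariant derivative \<open>a\<close> at time \<open>t\<close>. If \<open>w = (\<Sum>i<m. c\<^sub>i (E\<^sub>i \<circ> \<gamma>))\<close> near \<open>t\<close> for vector fields
  \<open>E\<^sub>i\<close> on \<open>Q\<close> (e.g. fields that form a frame near \<open>\<gamma> t\<close>), then linearity and the product rule force
  \<open>a = (\<Sum>i<m. c\<^sub>i' E\<^sub>i + c\<^sub>i \<nabla>\<^bsub>\<gamma>'\<^esub> E\<^sub>i)\<close>; the result does not depend on the representation.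
  Since a connection is applied to vector fields, \<open>\<gamma>'(t)\<close> is extended to a field \<open>X\<close>; only its value
  at \<open>\<gamma> t\<close> matters.
\<close>

definition has_covariant_derivative ::
    "'a::euclidean_space set \<Rightarrow> (('a \<Rightarrow> 'a) \<Rightarrow> ('a \<Rightarrow> 'a) \<Rightarrow> 'a \<Rightarrow> 'a) \<Rightarrow>
     (real \<Rightarrow> 'a) \<Rightarrow> (real \<Rightarrow> 'a) \<Rightarrow> 'a \<Rightarrow> real \<Rightarrow> bool" where
  "has_covariant_derivative Q nabla \<gamma> w a t \<longleftrightarrow>
     (\<exists>X (m::nat) E c c'. vector_field Q X \<and> (\<gamma> has_vector_derivative X (\<gamma> t)) (at t) \<and>
        (\<forall>i<m. vector_field Q (E i) \<and> (c i has_real_derivative c' i) (at t)) \<and>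
        (\<forall>\<^sub>F s in nhds t. w s = (\<Sum>i<m. c i s *\<^sub>R E i (\<gamma> s))) \<and>
        a = (\<Sum>i<m. c' i *\<^sub>R E i (\<gamma> t) + c i t *\<^sub>R nabla X (E i) (\<gamma> t)))"

section \<open>Solutions and uniform asymptotic stability\<close>

text \<open>
  A first-order system on a set \<open>M\<close> is given by its solution predicate: \<open>sol I x\<close> says that \<open>x\<close>
  restricted to the open interval \<open>I\<close> is a solution.
\<close>

definition maximal_solution ::
    "(real set \<Rightarrow> (real \<Rightarrow> 'x) \<Rightarrow> bool) \<Rightarrow> real set \<Rightarrow> (real \<Rightarrow> 'x) \<Rightarrow> bool" where
  "maximal_solution sol I x \<longleftrightarrow> sol I x \<and>
     (\<forall>J y. sol J y \<longrightarrow> I \<subseteq> J \<longrightarrow> (\<forall>t\<in>I. y t = x t) \<longrightarrow> J = I)"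

text \<open>
  ``The maximal solution with value \<open>x0\<close> at time \<open>t0\<close> is defined on \<open>[t0, \<infinity>)\<close> and satisfies \<open>P\<close>
  there.'' Existence of a maximal solution is part of the claim.
\<close>

definition maximal_solution_satisfies ::
    "(real set \<Rightarrow> (real \<Rightarrow> 'x) \<Rightarrow> bool) \<Rightarrow> real \<Rightarrow> 'x \<Rightarrow> (real \<Rightarrow> 'x \<Rightarrow> bool) \<Rightarrow> bool" where
  "maximal_solution_satisfies sol t0 x0 P \<longleftrightarrow>
     (\<exists>I x. maximal_solution sol I x \<and> t0 \<in> I \<and> x t0 = x0) \<and>
     (\<forall>I x. maximal_solution sol I x \<longrightarrow> t0 \<in> I \<longrightarrow> x t0 = x0 \<longrightarrow>
        {t0..} \<subseteq> I \<and> (\<forall>t\<ge>t0. P t (x t)))"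

definition neighborhood_in :: "'x::topological_space set \<Rightarrow> 'x set \<Rightarrow> 'x set \<Rightarrow> bool" where
  "neighborhood_in M S K \<longleftrightarrow> S \<subseteq> M \<and> (\<exists>U. open U \<and> K \<subseteq> U \<and> U \<inter> M \<subseteq> S)"

definition uniformly_asymptotically_stable ::
    "'x::metric_space set \<Rightarrow> (real set \<Rightarrow> (real \<Rightarrow> 'x) \<Rightarrow> bool) \<Rightarrow> 'x set \<Rightarrow> 'x set \<Rightarrow> bool" where
  "uniformly_asymptotically_stable M sol S K \<longleftrightarrow>
     K \<noteq> {} \<and> compact K \<and> K \<subseteq> M \<and> neighborhood_in M S K \<and>
     (\<forall>\<epsilon>>0. \<exists>\<delta>>0. \<forall>t0. \<forall>x0\<in>M. infdist x0 K \<le> \<delta> \<longrightarrow>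
        maximal_solution_satisfies sol t0 x0 (\<lambda>t x. infdist x K \<le> \<epsilon>)) \<and>
     (\<forall>r>0. \<forall>\<epsilon>>0. \<exists>\<Delta>>0. \<exists>\<rho>>0. \<forall>t0. \<forall>x0\<in>S. infdist x0 K \<le> r \<longrightarrow>
        maximal_solution_satisfies sol t0 x0
          (\<lambda>t x. infdist x K \<le> \<rho> \<and> (t \<ge> t0 + \<Delta> \<longrightarrow> infdist x K \<le> \<epsilon>)))"

section \<open>The system, the function \<open>V\<close> and its scaled sublevel sets\<close>

definition state_space :: "'a::euclidean_space set \<Rightarrow> (('a \<times> 'a) \<times> real) set" where
  "state_space Q = tangent_bundle Q \<times> UNIV"

definition mul_deriv :: "(real \<Rightarrow> real) \<Rightarrow> real \<Rightarrow> real" where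
  "mul_deriv \<alpha> z = \<alpha> z * deriv \<alpha> z"

definition solution_A ::
    "'a::euclidean_space set \<Rightarrow> ('a \<Rightarrow> 'a \<Rightarrow> 'a \<Rightarrow> real) \<Rightarrow>
     (('a \<Rightarrow> 'a) \<Rightarrow> ('a \<Rightarrow> 'a) \<Rightarrow> 'a \<Rightarrow> 'a) \<Rightarrow> ('a \<Rightarrow> 'a \<Rightarrow> 'a) \<Rightarrow> ('a \<Rightarrow> real) \<Rightarrow>
     (real \<Rightarrow> real) \<Rightarrow> real \<Rightarrow> real \<Rightarrow> real set \<Rightarrow> (real \<Rightarrow> ('a \<times> 'a) \<times> real) \<Rightarrow> bool" where
  "solution_A Q g nabla R \<psi> \<alpha> \<kappa> h I x \<longleftrightarrow>
     open I \<and> is_interval I \<and>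
     (let q = (\<lambda>t. fst (fst (x t))); v = (\<lambda>t. snd (fst (x t))); \<eta> = (\<lambda>t. snd (x t)) in
      \<forall>t\<in>I. x t \<in> state_space Q \<and>
        (q has_vector_derivative v t) (at t) \<and>
        has_covariant_derivative Q nabla q v
          (- R (q t) (v t) - (\<kappa> * mul_deriv \<alpha> (\<psi> (q t) - \<eta> t)) *\<^sub>R gradient Q g \<psi> (q t)) t \<and>
        (\<eta> has_real_derivative - h * \<eta> t + h * \<psi> (q t)) (at t))"

text \<open>The interval integral is oriented, so it has the right sign for negative \<open>z\<close>.\<close>

definition \<beta>_fun :: "(real \<Rightarrow> real) \<Rightarrow> real \<Rightarrow> real" where
  "\<beta>_fun \<alpha> z = (LBINT s=ereal 0..ereal z. mul_deriv \<alpha> s - mul_deriv \<alpha> 0)"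

definition V_fun ::
    "('a \<Rightarrow> 'a \<Rightarrow> 'a \<Rightarrow> real) \<Rightarrow> ('a \<Rightarrow> real) \<Rightarrow> (real \<Rightarrow> real) \<Rightarrow> real \<Rightarrow> real \<Rightarrow>
     ('a \<times> 'a) \<times> real \<Rightarrow> real" where
  "V_fun g \<psi> \<alpha> \<kappa> ystar = (\<lambda>((q, v), \<eta>).
     1/2 * (metric_norm g q v)\<^sup>2 + \<kappa> * mul_deriv \<alpha> 0 * (\<psi> q - ystar) + \<kappa> * \<beta>_fun \<alpha> (\<psi> q - \<eta>))"

definition S_set ::
    "'a::euclidean_space set \<Rightarrow> ('a \<Rightarrow> 'a \<Rightarrow> 'a \<Rightarrow> real) \<Rightarrow> ('a \<Rightarrow> real) \<Rightarrow> (real \<Rightarrow> real) \<Rightarrow>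
     real \<Rightarrow> real \<Rightarrow> real \<Rightarrow> (('a \<times> 'a) \<times> real) set" where
  "S_set Q g \<psi> \<alpha> \<kappa> ystar y =
     {x \<in> state_space Q. V_fun g \<psi> \<alpha> \<kappa> ystar x \<le> \<kappa> * mul_deriv \<alpha> 0 * (y - ystar)}"

end

theory Submission
  imports Defs "HOL-Complex_Analysis.Great_Picard"
begin

text \<open>
  Compatibility of the connection with the metric gives
  \<open>V' = - g(R v, v) - \<kappa> h ((\<alpha>\<alpha>')(z) - (\<alpha>\<alpha>')(0)) z \<le> 0\<close> with \<open>z = \<psi>(q) - \<eta>\<close> along solutions,
  so the compact set \<open>S(y\<^sub>0)\<close> is forward invariant. Where \<open>V'\<close> vanishes outside \<open>S(y\<^sub>*)\<close> we have
  \<open>v = 0\<close> and \<open>grad \<psi> \<noteq> 0\<close>, hence a nonzero acceleration; by compactness every solution in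
  \<open>S(y\<^sub>0)\<close> therefore loses a fixed amount of \<open>V\<close> in a fixed time as long as \<open>V\<close> is bounded away
  from \<open>0\<close>.

  The covariant derivative of \<open>v\<close> along \<open>q\<close> differs from the derivative \<open>v'\<close> in the ambient space by a term that is
  continuous in \<open>(q, v)\<close>, as one sees in local frames. So the system is an autonomous equation
  \<open>x' = F x\<close> with a continuous \<open>F\<close> on the closed set \<open>TQ \<times> \<real>\<close>. Continuity suffices: stability is a
  statement about all maximal solutions, so existence (Peano) is needed but uniqueness is not.
\<close>

section \<open>Calculus of smooth maps\<close>

text \<open>The connection is an abstract operator on globally defined fields, so its dependence on
  values away from a point has to be controlled. In the direction argument, linearity over smooth
  functions does this once a field is multiplied by a bump function and expanded in global fields;
  therefore frames are cut off instead of living on a chart domain only. In the other argument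
  compatibility with the metric takes over: the product rule fixes the inner product of a covariant
  derivative with every tangent vector, and the metric is definite.

  The state space is in general not open, so Peano's theorem is applied to an equation for chart
  coordinates, frame coefficients of the velocity and \<eta>. The resulting curves define the
  ambient field \<open>F\<close>, and a solution with compact range can be continued through its
  limit.

  The derivative of \<open>V\<close> also vanishes at rest points that are not equilibria, hence the
  loss of \<open>V\<close> is measured over short time intervals. The linear growth of
  \<open>\<beta>_fun\<close> bounds \<eta>, the one variable in \<open>S(y\<^sub>0)\<close> that
  neither \<psi>(q) nor the kinetic energy controls.\<close>

lemma Cn_on_cong:
  assumes "open U" "\<And>x. x \<in> U \<Longrightarrow> f x = g x" "Cn_on n U f"
  shows "Cn_on n U g"
  using assms(2,3)
proof (induction n arbitrary: f g)
  case 0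
  then show ?case by (simp cong: continuous_on_cong)
next
  case (Suc n)
  have fd: "(g has_derivative frechet_derivative f (at x)) (at x)" if "x \<in> U" for x
  proof (rule has_derivative_transform_within_open[OF _ assms(1) that])
    have "f differentiable (at x)" using Suc.prems(2) that by simp
    then show "(f has_derivative frechet_derivative f (at x)) (at x)"
      by (simp only: frechet_derivative_works)
  qed (rule Suc.prems(1))
  then have eq: "frechet_derivative g (at x) = frechet_derivative f (at x)" if "x \<in> U" for x
    using that frechet_derivative_at by metis
  have "Cn_on n U (\<lambda>x. frechet_derivative g (at x) v)" for v
  proof (rule Suc.IH[of "\<lambda>x. frechet_derivative f (at x) v"])
    show "Cn_on n U (\<lambda>x. frechet_derivative f (at x) v)" using Suc.prems(2) by simp
  qed (simp add: eq)
  then show ?case using fd by (auto simp: differentiable_def)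
qed

text \<open>Differentiability classes are verified from an explicitly known derivative
  \<open>f'\<close>; on an open set it must coincide with \<open>frechet_derivative\<close>.\<close>

lemma Cn_on_SucI:
  assumes "open U" "\<And>x. x \<in> U \<Longrightarrow> (f has_derivative f' x) (at x)"
    "\<And>v. Cn_on n U (\<lambda>x. f' x v)"
  shows "Cn_on (Suc n) U f"
proof -
  have "frechet_derivative f (at x) = f' x" if "x \<in> U" for x
    using assms(2)[OF that] frechet_derivative_at by metis
  then have "Cn_on n U (\<lambda>x. frechet_derivative f (at x) v)" for v
    by (intro Cn_on_cong[OF assms(1) _ assms(3)]) simp
  then show ?thesis using assms(2) by (auto simp: differentiable_def)
qed

lemma Cn_on_has_derivative:
  "Cn_on (Suc n) U f \<Longrightarrow> x \<in> U \<Longrightarrow> (f has_derivative frechet_derivative f (at x)) (at x)"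
  by (simp add: frechet_derivative_works)

lemma Cn_on_lower: "Cn_on (Suc n) U f \<Longrightarrow> Cn_on n U f"
proof (induction n arbitrary: f)
  case 0
  then show ?case
    by (auto intro!: continuous_at_imp_continuous_on differentiable_imp_continuous_within)
qed auto

lemma Cn_on_continuous: "Cn_on n U f \<Longrightarrow> continuous_on U f"
  by (induction n) (use Cn_on_lower in auto)

lemma Cn_on_subset: "Cn_on n U f \<Longrightarrow> V \<subseteq> U \<Longrightarrow> Cn_on n V f"
  by (induction n arbitrary: f) (auto intro: continuous_on_subset)

lemma Cn_on_locally:
  assumes "\<And>x. x \<in> U \<Longrightarrow> \<exists>V. open V \<and> x \<in> V \<and> Cn_on n V f"
  shows "Cn_on n U f"
  using assms
proof (induction n arbitrary: f)
  case 0
  show ?case unfolding Cn_on.simps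
  proof (rule continuous_at_imp_continuous_on, rule ballI)
    fix x assume "x \<in> U"
    with 0 obtain V where "open V" "x \<in> V" "continuous_on V f" by auto
    then show "isCont f x" by (simp add: continuous_on_eq_continuous_at)
  qed
next
  case (Suc n)
  show ?case unfolding Cn_on.simps
  proof (intro conjI allI ballI)
    show "f differentiable at x" if "x \<in> U" for x using Suc.prems[OF that] by auto
    show "Cn_on n U (\<lambda>x. frechet_derivative f (at x) v)" for v
      by (rule Suc.IH) (use Suc.prems in fastforce)
  qed
qed

lemma Cn_on_const [simp]: "Cn_on n U (\<lambda>x. c)"
  by (induction n arbitrary: c) auto

lemma Cn_on_bounded_linear_compose:
  assumes "bounded_linear h" "open U" "Cn_on n U f"
  shows "Cn_on n U (\<lambda>x. h (f x))"
  using assms(3)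
proof (induction n arbitrary: f)
  case 0
  then show ?case using assms(1) by (simp add: bounded_linear.continuous_on)
next
  case (Suc n)
  then show ?case
    by (intro Cn_on_SucI[OF assms(2), where f' = "\<lambda>x v. h (frechet_derivative f (at x) v)"])
      (auto intro!: bounded_linear.has_derivative[OF assms(1)] simp: frechet_derivative_works)
qed

lemma Cn_on_ident [simp]: "open U \<Longrightarrow> Cn_on n U (\<lambda>x. x)"
  by (induction n) (auto simp: continuous_on_id)

lemma Cn_on_bounded_linear: "bounded_linear h \<Longrightarrow> open U \<Longrightarrow> Cn_on n U h"
  using Cn_on_bounded_linear_compose[of h U n "\<lambda>x. x"] by simp

lemma Cn_on_add:
  assumes "open U" "Cn_on n U f" "Cn_on n U g"
  shows "Cn_on n U (\<lambda>x. f x + g x)"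
  using assms(2,3)
proof (induction n arbitrary: f g)
  case (Suc n)
  then show ?case
    by (intro Cn_on_SucI[OF assms(1), where f' = "\<lambda>x v. frechet_derivative f (at x) v + frechet_derivative g (at x) v"])
      (auto intro!: has_derivative_add simp: frechet_derivative_works)
qed (auto intro: continuous_on_add)

lemma Cn_on_sum:
  assumes "open U" "\<And>i. i \<in> I \<Longrightarrow> Cn_on n U (f i)"
  shows "Cn_on n U (\<lambda>x. \<Sum>i\<in>I. f i x)"
  using assms(2)
  by (induction I rule: infinite_finite_induct) (auto intro: Cn_on_add[OF assms(1)])

lemma Cn_on_bounded_bilinear:
  assumes h: "bounded_bilinear h" and "open U" "Cn_on n U f" "Cn_on n U g"
  shows "Cn_on n U (\<lambda>x. h (f x) (g x))"
  using assms(3,4)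
proof (induction n arbitrary: f g)
  case 0
  then show ?case by (simp add: bounded_bilinear.continuous_on[OF h])
next
  case (Suc n)
  show ?case
  proof (rule Cn_on_SucI[OF assms(2), where
      f' = "\<lambda>x v. h (f x) (frechet_derivative g (at x) v) + h (frechet_derivative f (at x) v) (g x)"])
    show "((\<lambda>x. h (f x) (g x)) has_derivative
      (\<lambda>v. h (f x) (frechet_derivative g (at x) v) + h (frechet_derivative f (at x) v) (g x))) (at x)"
      if "x \<in> U" for x
      using Suc.prems that by (intro bounded_bilinear.FDERIV[OF h]) (auto simp: frechet_derivative_works)
    show "Cn_on n U (\<lambda>x. h (f x) (frechet_derivative g (at x) v) + h (frechet_derivative f (at x) v) (g x))" for v
      using Suc.prems by (intro Cn_on_add[OF assms(2)] Suc.IH) (auto intro: Cn_on_lower)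
  qed
qed

text \<open>\<open>Cn_on\<close> controls directional derivatives in fixed directions only.
  Expansion in the basis reduces a direction that varies with the point to finitely many fixed ones
  with scalar coefficients.\<close>

lemma frechet_derivative_basis_sum:
  assumes "f differentiable (at x)"
  shows "frechet_derivative f (at x) v = (\<Sum>b\<in>Basis. (v \<bullet> b) *\<^sub>R frechet_derivative f (at x) b)"
proof -
  have "linear (frechet_derivative f (at x))" using assms linear_frechet_derivative by blast
  then have "(\<Sum>b\<in>Basis. (v \<bullet> b) *\<^sub>R frechet_derivative f (at x) b)
      = frechet_derivative f (at x) (\<Sum>b\<in>Basis. (v \<bullet> b) *\<^sub>R b)"
    by (simp add: linear_sum linear_scale)
  then show ?thesis by (simp add: euclidean_representation)
qed

text \<open>The chain rule yields the derivative of \<open>f\<close> in a direction that moves with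
  \<open>x\<close>. After expansion in the basis only partial derivatives of \<open>f\<close>
  composed with the same \<open>g\<close> remain, so the induction generalizes \<open>f\<close> and
  keeps \<open>g\<close>.\<close>

lemma Cn_on_compose:
  assumes "open U" "open V" "\<And>x. x \<in> U \<Longrightarrow> g x \<in> V" "Cn_on n V f" "Cn_on n U g"
  shows "Cn_on n U (\<lambda>x. f (g x))"
  using assms(4,5)
proof (induction n arbitrary: f)
  case 0
  then show ?case using assms(3) by (auto intro: continuous_on_compose2)
next
  case (Suc n)
  show ?case
  proof (rule Cn_on_SucI[OF assms(1), where
      f' = "\<lambda>x v. \<Sum>b\<in>Basis. (frechet_derivative g (at x) v \<bullet> b) *\<^sub>R frechet_derivative f (at (g x)) b"])
    fix x assume x: "x \<in> U"
    have "((\<lambda>x. f (g x)) has_derivative (\<lambda>v. frechet_derivative f (at (g x)) (frechet_derivative g (at x) v))) (at x)"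
      by (rule has_derivative_compose) (use Suc.prems x assms(3) in \<open>auto simp: frechet_derivative_works\<close>)
    moreover have "f differentiable (at (g x))" using Suc.prems x assms(3) by auto
    ultimately show "((\<lambda>x. f (g x)) has_derivative
      (\<lambda>v. \<Sum>b\<in>Basis. (frechet_derivative g (at x) v \<bullet> b) *\<^sub>R frechet_derivative f (at (g x)) b)) (at x)"
      by (simp only: frechet_derivative_basis_sum[symmetric])
  next
    fix v
    have "Cn_on n U (\<lambda>x. frechet_derivative f (at (g x)) b)" for b
      using Suc.prems by (intro Suc.IH) (auto intro: Cn_on_lower)
    moreover have "Cn_on n U (\<lambda>x. frechet_derivative g (at x) v \<bullet> b)" for b
      by (rule Cn_on_bounded_linear_compose[OF bounded_linear_inner_left assms(1)]) (use Suc.prems in auto)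
    ultimately show "Cn_on n U (\<lambda>x. \<Sum>b\<in>Basis. (frechet_derivative g (at x) v \<bullet> b) *\<^sub>R frechet_derivative f (at (g x)) b)"
      by (intro Cn_on_sum[OF assms(1)] Cn_on_bounded_bilinear[OF bounded_bilinear_scaleR assms(1)])
  qed
qed

text \<open>The derivative is again a product of copies of \<open>inverse\<close>, so the induction
  closes by the product rule.\<close>

lemma Cn_on_inverse: "Cn_on n (- {0}) (inverse :: real \<Rightarrow> real)"
proof (induction n)
  case 0
  then show ?case by (auto intro!: continuous_intros)
next
  case (Suc n)
  have op: "open (- {0::real})" by auto
  show ?case
    by (rule Cn_on_SucI[OF op, where f' = "\<lambda>x v. - (inverse x * v * inverse x)"])
      (auto intro!: has_derivative_inverse' Cn_on_bounded_bilinear[OF bounded_bilinear_mult op] Suc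
        Cn_on_bounded_linear_compose[OF bounded_linear_minus[OF bounded_linear_ident] op])
qed

section \<open>Closure properties of smooth maps on open sets\<close>

lemma smooth_on_open: "smooth_on U f \<Longrightarrow> open U"
  by (simp add: smooth_on_def)

lemma smooth_on_Cn: "smooth_on U f \<Longrightarrow> Cn_on n U f"
  by (simp add: smooth_on_def)

lemma smooth_on_has_derivative:
  "smooth_on U f \<Longrightarrow> x \<in> U \<Longrightarrow> (f has_derivative frechet_derivative f (at x)) (at x)"
  using Cn_on_has_derivative smooth_on_Cn by blast

lemma smooth_on_differentiable: "smooth_on U f \<Longrightarrow> x \<in> U \<Longrightarrow> f differentiable (at x)"
  using smooth_on_has_derivative differentiable_def by blast

lemma smooth_on_continuous: "smooth_on U f \<Longrightarrow> continuous_on U f"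
  using Cn_on_continuous smooth_on_Cn by blast

lemma smooth_on_subset: "smooth_on U f \<Longrightarrow> open V \<Longrightarrow> V \<subseteq> U \<Longrightarrow> smooth_on V f"
  unfolding smooth_on_def using Cn_on_subset by blast

lemma smooth_on_cong: "smooth_on U f \<Longrightarrow> (\<And>x. x \<in> U \<Longrightarrow> f x = g x) \<Longrightarrow> smooth_on U g"
  unfolding smooth_on_def using Cn_on_cong by blast

lemma smooth_on_locally:
  assumes "\<And>x. x \<in> U \<Longrightarrow> \<exists>V. x \<in> V \<and> smooth_on V f" "open U"
  shows "smooth_on U f"
  unfolding smooth_on_def using assms Cn_on_locally smooth_on_def by metis

lemma smooth_on_const: "open U \<Longrightarrow> smooth_on U (\<lambda>x. c)"
  by (simp add: smooth_on_def)

lemma smooth_on_ident: "open U \<Longrightarrow> smooth_on U (\<lambda>x. x)"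
  by (simp add: smooth_on_def)

lemma smooth_on_bounded_linear: "bounded_linear h \<Longrightarrow> open U \<Longrightarrow> smooth_on U h"
  by (simp add: smooth_on_def Cn_on_bounded_linear)

lemma smooth_on_bounded_linear_compose:
  "bounded_linear h \<Longrightarrow> smooth_on U f \<Longrightarrow> smooth_on U (\<lambda>x. h (f x))"
  by (simp add: smooth_on_def Cn_on_bounded_linear_compose)

lemma smooth_on_add: "smooth_on U f \<Longrightarrow> smooth_on U g \<Longrightarrow> smooth_on U (\<lambda>x. f x + g x)"
  by (simp add: smooth_on_def Cn_on_add)

lemma smooth_on_sum:
  "open U \<Longrightarrow> (\<And>i. i \<in> I \<Longrightarrow> smooth_on U (f i)) \<Longrightarrow> smooth_on U (\<lambda>x. \<Sum>i\<in>I. f i x)"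
  by (simp add: smooth_on_def Cn_on_sum)

lemma smooth_on_bounded_bilinear:
  "bounded_bilinear h \<Longrightarrow> smooth_on U f \<Longrightarrow> smooth_on U g \<Longrightarrow> smooth_on U (\<lambda>x. h (f x) (g x))"
  by (simp add: smooth_on_def Cn_on_bounded_bilinear)

lemmas smooth_on_scaleR = smooth_on_bounded_bilinear[OF bounded_bilinear_scaleR]
lemmas smooth_on_mult = smooth_on_bounded_bilinear[OF bounded_bilinear_mult]

lemma smooth_on_compose:
  "smooth_on V f \<Longrightarrow> smooth_on U g \<Longrightarrow> (\<And>x. x \<in> U \<Longrightarrow> g x \<in> V) \<Longrightarrow> smooth_on U (\<lambda>x. f (g x))"
  unfolding smooth_on_def using Cn_on_compose by blast

lemma smooth_on_Pair:
  assumes "smooth_on U f" "smooth_on U g"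
  shows "smooth_on U (\<lambda>x. (f x, g x))"
proof -
  have "smooth_on U (\<lambda>x. (f x, 0) + (0, g x))"
    using assms
    by (intro smooth_on_add smooth_on_bounded_linear_compose[of "\<lambda>a. (a, 0)"]
        smooth_on_bounded_linear_compose[of "\<lambda>a. (0, a)"])
      (auto intro!: bounded_linear_Pair bounded_linear_ident bounded_linear_zero)
  then show ?thesis by simp
qed

text \<open>Joint smoothness in base point and direction. It makes the tangent maps of charts, and
  with them frames and their coefficient functions, smooth.\<close>

lemma smooth_on_frechet_derivative:
  assumes f: "smooth_on V f" and g: "smooth_on U g" "\<And>x. x \<in> U \<Longrightarrow> g x \<in> V" and w: "smooth_on U w"
  shows "smooth_on U (\<lambda>x. frechet_derivative f (at (g x)) (w x))"
proof -
  have "smooth_on V (\<lambda>x. frechet_derivative f (at x) b)" for b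
    using f unfolding smooth_on_def by (metis Cn_on.simps(2))
  then have "smooth_on U (\<lambda>x. \<Sum>b\<in>Basis. (w x \<bullet> b) *\<^sub>R frechet_derivative f (at (g x)) b)"
    using smooth_on_open[OF g(1)] g(2)
    by (intro smooth_on_sum smooth_on_scaleR smooth_on_compose[OF _ g(1)]
        smooth_on_bounded_linear_compose[OF bounded_linear_inner_left w]) auto
  then show ?thesis
    by (rule smooth_on_cong)
      (simp only: frechet_derivative_basis_sum[OF smooth_on_differentiable[OF f g(2)], symmetric])
qed

subsection \<open>Bump functions\<close>

text \<open>A family in \<open>k\<close> because differentiating \<open>exp(-1/t)\<close> produces
  negative powers of \<open>t\<close>; linear combinations of its members are closed under
  differentiation.\<close>

definition flat_fun :: "nat \<Rightarrow> real \<Rightarrow> real" where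
  "flat_fun k t = (if t > 0 then exp (- inverse t) * inverse t ^ k else 0)"

lemma flat_fun_has_derivative:
  "(flat_fun k has_real_derivative flat_fun (k + 2) t - real k * flat_fun (k + 1) t) (at t)"
proof -
  consider "t > 0" | "t < 0" | "t = 0" by linarith
  then show ?thesis
  proof cases
    case 1
    have "((\<lambda>t. exp (- inverse t) * inverse t ^ k) has_real_derivative
        flat_fun (k + 2) t - real k * flat_fun (k + 1) t) (at t)"
    proof -
      have d: "((\<lambda>t. exp (- inverse t) * inverse t ^ k) has_real_derivative
          exp (- inverse t) * (real k * ((- (inverse t * inverse t)) * inverse t ^ (k - Suc 0)))
          + exp (- inverse t) * (inverse t * inverse t) * inverse t ^ k) (at t)"
        using 1 by (auto intro!: derivative_eq_intros)
      have "real k * ((- (inverse t * inverse t)) * inverse t ^ (k - Suc 0)) = - real k * inverse t ^ (k + 1)"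
        by (cases k) (auto simp: algebra_simps)
      then have "exp (- inverse t) * (real k * ((- (inverse t * inverse t)) * inverse t ^ (k - Suc 0)))
          + exp (- inverse t) * (inverse t * inverse t) * inverse t ^ k
          = flat_fun (k + 2) t - real k * flat_fun (k + 1) t"
        using 1 by (simp only:) (simp add: flat_fun_def algebra_simps)
      with d show ?thesis by simp
    qed
    then show ?thesis
      by (rule has_field_derivative_transform_within_open[where S = "{0<..}"]) (use 1 in \<open>auto simp: flat_fun_def\<close>)
  next
    case 2
    have "((\<lambda>t. 0) has_real_derivative flat_fun (k + 2) t - real k * flat_fun (k + 1) t) (at t)"
      using 2 by (auto simp: flat_fun_def)
    then show ?thesis
      by (rule has_field_derivative_transform_within_open[where S = "{..<0}"]) (use 2 in \<open>auto simp: flat_fun_def\<close>)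
  next
    case 3
    \<comment> \<open>At 0 the difference quotient from the right is \<open>y^(k+1) / exp y\<close>
      with \<open>y = 1/t\<close>.\<close>
    have "((\<lambda>y. y ^ (k + 1) / exp y) \<longlongrightarrow> 0) (at_top :: real filter)" by (rule tendsto_power_div_exp_0)
    then have "((\<lambda>t. inverse t ^ (k + 1) / exp (inverse t)) \<longlongrightarrow> 0) (at_right (0::real))"
      by (rule filterlim_compose[OF _ filterlim_inverse_at_top_right])
    moreover have "\<forall>\<^sub>F t in at_right (0::real). inverse t ^ (k + 1) / exp (inverse t) = (flat_fun k t - flat_fun k 0) / (t - 0)"
      unfolding eventually_at_right_field
      by (rule exI[of _ 1]) (auto simp: flat_fun_def exp_minus field_simps)
    ultimately have r: "((\<lambda>t. (flat_fun k t - flat_fun k 0) / (t - 0)) \<longlongrightarrow> 0) (at_right 0)"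
      by (rule Lim_transform_eventually)
    have "((\<lambda>t. (flat_fun k t - flat_fun k 0) / (t - 0)) \<longlongrightarrow> 0) (at_left 0)"
      by (rule tendsto_eventually) (auto simp: eventually_at_left_field flat_fun_def intro: exI[of _ "-1"])
    with r have "((\<lambda>t. (flat_fun k t - flat_fun k 0) / (t - 0)) \<longlongrightarrow> 0) (at 0)"
      by (simp add: filterlim_split_at)
    then show ?thesis using 3 by (simp add: has_field_derivative_iff flat_fun_def)
  qed
qed

lemma smooth_on_flat_fun: "smooth_on UNIV (flat_fun k)"
proof -
  have "Cn_on n UNIV (flat_fun k)" for n
  proof (induction n arbitrary: k)
    case 0
    have "isCont (flat_fun k) t" for t using flat_fun_has_derivative DERIV_isCont by blast
    then show ?case by (simp add: continuous_at_imp_continuous_on)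
  next
    case (Suc n)
    show ?case
    proof (rule Cn_on_SucI[where f' = "\<lambda>t v. v *\<^sub>R (flat_fun (k + 2) t + (- real k) *\<^sub>R flat_fun (k + 1) t)"])
      show "(flat_fun k has_derivative (\<lambda>v. v *\<^sub>R (flat_fun (k + 2) t + (- real k) *\<^sub>R flat_fun (k + 1) t))) (at t)" for t
        using flat_fun_has_derivative[of k t] by (simp add: has_field_derivative_def mult.commute[of _ "_ - _"])
      show "Cn_on n UNIV (\<lambda>t. v *\<^sub>R (flat_fun (k + 2) t + (- real k) *\<^sub>R flat_fun (k + 1) t))" for v
        by (intro Cn_on_bounded_linear_compose[OF bounded_linear_scaleR_right] Cn_on_add Suc open_UNIV)
    qed simp
  qed
  then show ?thesis by (simp add: smooth_on_def)
qed

lemma smooth_step: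
  obtains \<sigma> :: "real \<Rightarrow> real" where "smooth_on UNIV \<sigma>"
    "\<And>t. t \<le> 0 \<Longrightarrow> \<sigma> t = 0" "\<And>t. t \<ge> 1 \<Longrightarrow> \<sigma> t = 1"
proof
  let ?f = "flat_fun 0"
  \<comment> \<open>The quotient \<open>f(t) / (f(t) + f(1 - t))\<close>: its denominator is
    positive because \<open>t\<close> or \<open>1 - t\<close> is.\<close>
  define \<sigma> where "\<sigma> t = ?f t * inverse (?f t + ?f (1 + (- t)))" for t
  have pos: "?f t + ?f (1 + (- t)) \<noteq> 0" for t
  proof -
    have "?f t \<ge> 0" "?f (1 + (-t)) \<ge> 0" "t > 0 \<Longrightarrow> ?f t > 0" "1 + (-t) > 0 \<Longrightarrow> ?f (1 + (-t)) > 0"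
      by (auto simp: flat_fun_def)
    then show ?thesis by (cases "t > 0") auto
  qed
  have inv: "smooth_on (- {0}) (inverse :: real \<Rightarrow> real)"
    unfolding smooth_on_def using Cn_on_inverse by auto
  have m: "smooth_on UNIV (\<lambda>t. ?f (1 + (- t)))"
    by (rule smooth_on_compose[OF smooth_on_flat_fun])
      (intro smooth_on_add smooth_on_const smooth_on_bounded_linear bounded_linear_minus
        bounded_linear_ident open_UNIV, simp)
  show "smooth_on UNIV \<sigma>"
    unfolding \<sigma>_def
    by (intro smooth_on_mult smooth_on_flat_fun smooth_on_compose[OF inv] smooth_on_add m) (use pos in auto)
  show "\<sigma> t = 0" if "t \<le> 0" for t using that by (simp add: \<sigma>_def flat_fun_def)
  show "\<sigma> t = 1" if "t \<ge> 1" for t using that by (simp add: \<sigma>_def flat_fun_def)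
qed

lemma smooth_bump:
  fixes p :: "'a::euclidean_space"
  assumes "r > 0"
  obtains \<zeta> :: "'a \<Rightarrow> real" where "smooth_on UNIV \<zeta>"
    "\<And>x. x \<in> cball p r \<Longrightarrow> \<zeta> x = 1" "\<And>x. x \<notin> cball p (2 * r) \<Longrightarrow> \<zeta> x = 0"
proof -
  obtain \<sigma> :: "real \<Rightarrow> real" where \<sigma>: "smooth_on UNIV \<sigma>"
    "\<And>t. t \<le> 0 \<Longrightarrow> \<sigma> t = 0" "\<And>t. t \<ge> 1 \<Longrightarrow> \<sigma> t = 1" by (rule smooth_step) blast
  \<comment> \<open>This is \<open>2 - (dist p x / r)^2\<close>, smooth as a polynomial in
    \<open>x\<close>, at least 1 on the inner ball and at most 0 off the outer one.\<close>
  define l where "l x = 2 + (- inverse (r\<^sup>2)) * ((x + (- p)) \<bullet> (x + (- p)))" for x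
  have sm: "smooth_on UNIV l"
    unfolding l_def
    by (intro smooth_on_add smooth_on_mult smooth_on_bounded_bilinear[OF bounded_bilinear_inner]
        smooth_on_const smooth_on_ident open_UNIV)
  have l: "l x = 2 - (dist p x / r)\<^sup>2" for x
    by (simp add: l_def dist_norm power2_norm_eq_inner[symmetric] norm_minus_commute field_simps power_divide)
  show ?thesis
  proof
    show "smooth_on UNIV (\<lambda>x. \<sigma> (l x))" by (rule smooth_on_compose[OF \<sigma>(1) sm]) simp
    show "\<sigma> (l x) = 1" if "x \<in> cball p r" for x
    proof (rule \<sigma>(3))
      have "dist p x / r \<le> 1" using that assms by simp
      then have "(dist p x / r)\<^sup>2 \<le> 1" using assms by (simp add: power_le_one)
      then show "l x \<ge> 1" by (simp add: l)
    qed
    show "\<sigma> (l x) = 0" if "x \<notin> cball p (2 * r)" for x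
    proof (rule \<sigma>(2))
      have "2 \<le> dist p x / r" using that assms by (simp add: field_simps)
      then have "2\<^sup>2 \<le> (dist p x / r)\<^sup>2" by (rule power_mono) simp
      then show "l x \<le> 0" by (simp add: l)
    qed
  qed
qed

text \<open>\<open>U\<close> and the complement of \<open>C\<close> are open and cover the space; on
  the latter the function is identically 0.\<close>

lemma smooth_on_cutoff:
  fixes f :: "'a::euclidean_space \<Rightarrow> 'b::euclidean_space"
  assumes f: "smooth_on U f" and \<zeta>: "smooth_on UNIV \<zeta>" and C: "closed C" "C \<subseteq> U" "\<And>x. x \<notin> C \<Longrightarrow> \<zeta> x = 0"
  shows "smooth_on UNIV (\<lambda>x. if x \<in> U then \<zeta> x *\<^sub>R f x else 0)"
proof (rule smooth_on_locally)
  fix x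
  show "\<exists>V. x \<in> V \<and> smooth_on V (\<lambda>x. if x \<in> U then \<zeta> x *\<^sub>R f x else 0)"
  proof (cases "x \<in> U")
    case True
    have "smooth_on U (\<lambda>x. \<zeta> x *\<^sub>R f x)"
      by (intro smooth_on_scaleR f smooth_on_subset[OF \<zeta>] smooth_on_open[OF f]) auto
    then have "smooth_on U (\<lambda>x. if x \<in> U then \<zeta> x *\<^sub>R f x else 0)" by (rule smooth_on_cong) simp
    then show ?thesis using True by blast
  next
    case False
    have "smooth_on (- C) (\<lambda>x. 0 :: 'b)" using C by (intro smooth_on_const) auto
    then have "smooth_on (- C) (\<lambda>x. if x \<in> U then \<zeta> x *\<^sub>R f x else 0)"
      by (rule smooth_on_cong) (use C in auto)
    then show ?thesis using False C by blast
  qed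
qed simp

subsection \<open>Smooth maps on subsets\<close>

lemma smooth_on_imp_smooth_map: "smooth_on U f \<Longrightarrow> A \<subseteq> U \<Longrightarrow> smooth_map A f"
  unfolding smooth_map_def by blast

lemma smooth_map_cong: "smooth_map A f \<Longrightarrow> (\<And>x. x \<in> A \<Longrightarrow> f x = g x) \<Longrightarrow> smooth_map A g"
  unfolding smooth_map_def by (simp add: Ball_def)

lemma smooth_mapE:
  assumes "smooth_map A f" "x \<in> A"
  obtains U F where "x \<in> U" "smooth_on U F" "\<And>y. y \<in> U \<Longrightarrow> y \<in> A \<Longrightarrow> F y = f y"
proof -
  from assms have "\<exists>U F. x \<in> U \<and> smooth_on U F \<and> (\<forall>y\<in>U \<inter> A. F y = f y)"
    unfolding smooth_map_def by (rule bspec)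
  then obtain U F where F: "x \<in> U" "smooth_on U F" and eq: "\<forall>y\<in>U \<inter> A. F y = f y"
    by (elim exE conjE)
  show ?thesis by (rule that[OF F]) (rule bspec[OF eq], rule IntI)
qed

lemma smooth_mapI:
  assumes "\<And>x. x \<in> A \<Longrightarrow> \<exists>U F. x \<in> U \<and> smooth_on U F \<and> (\<forall>y\<in>U \<inter> A. F y = f y)"
  shows "smooth_map A f"
  unfolding smooth_map_def using assms by (intro ballI)

lemma smooth_map_subset:
  assumes "smooth_map A f" "B \<subseteq> A"
  shows "smooth_map B f"
proof (rule smooth_mapI)
  fix x assume "x \<in> B"
  with assms(2) have "x \<in> A" by auto
  from smooth_mapE[OF assms(1) this]
  obtain U F where "x \<in> U" "smooth_on U F" "\<And>y. y \<in> U \<Longrightarrow> y \<in> A \<Longrightarrow> F y = f y"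
    by metis
  then show "\<exists>U F. x \<in> U \<and> smooth_on U F \<and> (\<forall>y\<in>U \<inter> B. F y = f y)"
    using assms(2) by (intro exI[of _ U] exI[of _ F]) auto
qed

lemma smooth_map_const: "smooth_map A (\<lambda>x. c)"
  by (rule smooth_on_imp_smooth_map[of UNIV]) (auto intro: smooth_on_const)

lemma smooth_map_ident: "smooth_map A (\<lambda>x. x)"
  by (rule smooth_on_imp_smooth_map[of UNIV]) (auto intro: smooth_on_ident)

lemma smooth_map_compose:
  assumes f: "smooth_map B f" and g: "smooth_map A g" and AB: "\<And>x. x \<in> A \<Longrightarrow> g x \<in> B"
  shows "smooth_map A (\<lambda>x. f (g x))"
proof (rule smooth_mapI)
  fix x assume x: "x \<in> A"
  obtain U G where G: "x \<in> U" "smooth_on U G" "\<And>y. y \<in> U \<inter> A \<Longrightarrow> G y = g y"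
    using smooth_mapE[OF g x] by (metis IntE)
  obtain V F where F: "g x \<in> V" "smooth_on V F" "\<And>y. y \<in> V \<inter> B \<Longrightarrow> F y = f y"
    using smooth_mapE[OF f AB[OF x]] by (metis IntE)
  define W where "W = U \<inter> G -` V"
  have W: "open W" unfolding W_def
    using continuous_open_preimage[OF smooth_on_continuous smooth_on_open smooth_on_open] G F by blast
  have "smooth_on W (\<lambda>x. F (G x))"
    by (rule smooth_on_compose[OF F(2) smooth_on_subset[OF G(2) W]]) (auto simp: W_def)
  then show "\<exists>U F. x \<in> U \<and> smooth_on U F \<and> (\<forall>y\<in>U \<inter> A. F y = f (g y))"
    using G F AB x by (intro exI[of _ W] exI[of _ "\<lambda>x. F (G x)"]) (auto simp: W_def)
qed

lemma smooth_map_Pair: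
  assumes f: "smooth_map A f" and g: "smooth_map A g"
  shows "smooth_map A (\<lambda>x. (f x, g x))"
proof (rule smooth_mapI)
  fix x assume x: "x \<in> A"
  obtain U G where G: "x \<in> U" "smooth_on U G" "\<And>y. y \<in> U \<inter> A \<Longrightarrow> G y = g y"
    using smooth_mapE[OF g x] by (metis IntE)
  obtain V F where F: "x \<in> V" "smooth_on V F" "\<And>y. y \<in> V \<inter> A \<Longrightarrow> F y = f y"
    using smooth_mapE[OF f x] by (metis IntE)
  have "open (U \<inter> V)" by (intro open_Int smooth_on_open[OF G(2)] smooth_on_open[OF F(2)])
  then have "smooth_on (U \<inter> V) (\<lambda>x. (F x, G x))"
    by (intro smooth_on_Pair smooth_on_subset[OF G(2)] smooth_on_subset[OF F(2)]) auto
  then show "\<exists>U H. x \<in> U \<and> smooth_on U H \<and> (\<forall>y\<in>U \<inter> A. H y = (f y, g y))"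
    using G F by (intro exI[of _ "U \<inter> V"] exI[of _ "\<lambda>x. (F x, G x)"]) auto
qed

lemma smooth_map_smooth_on_compose:
  "smooth_on UNIV f \<Longrightarrow> smooth_map A g \<Longrightarrow> smooth_map A (\<lambda>x. f (g x))"
  by (rule smooth_map_compose[of UNIV]) (auto intro: smooth_on_imp_smooth_map)

lemma smooth_map_bounded_bilinear:
  assumes h: "bounded_bilinear h" and f: "smooth_map A f" and g: "smooth_map A g"
  shows "smooth_map A (\<lambda>x. h (f x) (g x))"
proof -
  have "smooth_on UNIV (\<lambda>z. h (fst z) (snd z))"
    by (intro smooth_on_bounded_bilinear[OF h] smooth_on_bounded_linear) (auto intro: bounded_linear_fst bounded_linear_snd)
  from smooth_map_smooth_on_compose[OF this smooth_map_Pair[OF f g]] show ?thesis by simp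
qed

lemmas smooth_map_scaleR = smooth_map_bounded_bilinear[OF bounded_bilinear_scaleR]
lemmas smooth_map_mult = smooth_map_bounded_bilinear[OF bounded_bilinear_mult]

lemma smooth_map_add:
  assumes f: "smooth_map A f" and g: "smooth_map A g"
  shows "smooth_map A (\<lambda>x. f x + g x)"
proof -
  have "smooth_on UNIV (\<lambda>z::'b \<times> 'b. fst z + snd z)"
    by (intro smooth_on_add smooth_on_bounded_linear) (auto intro: bounded_linear_fst bounded_linear_snd)
  from smooth_map_smooth_on_compose[OF this smooth_map_Pair[OF f g]] show ?thesis by simp
qed

lemma smooth_map_sum:
  "(\<And>i. i \<in> I \<Longrightarrow> smooth_map A (f i)) \<Longrightarrow> smooth_map A (\<lambda>x. \<Sum>i\<in>I. f i x)"
  by (induction I rule: infinite_finite_induct) (auto intro: smooth_map_const smooth_map_add)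

lemma smooth_map_differentiable:
  assumes f: "smooth_map A f" and x: "x \<in> A"
  shows "f differentiable (at x within A)"
proof -
  obtain U F where F: "x \<in> U" "smooth_on U F" "\<And>y. y \<in> U \<inter> A \<Longrightarrow> F y = f y"
    using smooth_mapE[OF f x] by (metis IntE)
  obtain e where e: "e > 0" "ball x e \<subseteq> U" using smooth_on_open[OF F(2)] F(1) open_contains_ball by blast
  have "(F has_derivative frechet_derivative F (at x)) (at x within A)"
    using smooth_on_has_derivative[OF F(2,1)] has_derivative_at_withinI by blast
  then have "(f has_derivative frechet_derivative F (at x)) (at x within A)"
  proof (rule has_derivative_transform_within[OF _ e(1) x])
    fix y assume "y \<in> A" "dist y x < e"
    then have "y \<in> U \<inter> A" using e(2) by (auto simp: dist_commute)
    then show "F y = f y" by (rule F(3))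
  qed
  then show ?thesis by (auto simp: differentiable_def)
qed

lemma smooth_map_continuous_on: "smooth_map A f \<Longrightarrow> continuous_on A f"
  unfolding continuous_on_eq_continuous_within
  by (intro ballI differentiable_imp_continuous_within smooth_map_differentiable)

text \<open>As for open domains, but \<open>f\<close> is smooth only through local extensions
  \<open>F\<close> of its values on \<open>A \<inter> U\<close>. The factor \<open>\<zeta>\<close>
  is smooth on the whole space, so \<open>\<zeta> F\<close> extends the product.\<close>

lemma smooth_map_cutoff:
  fixes f :: "'a::euclidean_space \<Rightarrow> 'b::euclidean_space"
  assumes f: "smooth_map (A \<inter> U) f" and U: "open U"
    and \<zeta>: "smooth_on UNIV \<zeta>" and C: "closed C" "C \<subseteq> U" "\<And>x. x \<notin> C \<Longrightarrow> \<zeta> x = 0"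
  shows "smooth_map A (\<lambda>x. if x \<in> U then \<zeta> x *\<^sub>R f x else 0)"
proof (rule smooth_mapI)
  fix x assume x: "x \<in> A"
  show "\<exists>V F. x \<in> V \<and> smooth_on V F \<and> (\<forall>y\<in>V \<inter> A. F y = (if y \<in> U then \<zeta> y *\<^sub>R f y else 0))"
  proof (cases "x \<in> U")
    case True
    then have "x \<in> A \<inter> U" using x by simp
    from smooth_mapE[OF f this] obtain V F where F: "x \<in> V" "smooth_on V F" "\<And>y. y \<in> V \<inter> (A \<inter> U) \<Longrightarrow> F y = f y"
      by (metis IntE)
    have "open (V \<inter> U)" using smooth_on_open[OF F(2)] U by blast
    then have "smooth_on (V \<inter> U) (\<lambda>x. \<zeta> x *\<^sub>R F x)"
      by (intro smooth_on_scaleR smooth_on_subset[OF \<zeta>] smooth_on_subset[OF F(2)]) auto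
    then show ?thesis using True F by (intro exI[of _ "V \<inter> U"] exI[of _ "\<lambda>x. \<zeta> x *\<^sub>R F x"]) auto
  next
    case False
    have "smooth_on (- C) (\<lambda>x. 0 :: 'b)" using C by (intro smooth_on_const) auto
    then show ?thesis using False C by (intro exI[of _ "- C"] exI[of _ "\<lambda>x. 0"]) auto
  qed
qed

section \<open>Chain rules for curves in a subset\<close>

lemma has_vector_derivative_compose_within:
  assumes f: "(f has_derivative f') (at (\<gamma> t) within A)" and A: "\<forall>\<^sub>F s in nhds t. \<gamma> s \<in> A"
    and \<gamma>: "(\<gamma> has_vector_derivative v) (at t)"
  shows "((\<lambda>s. f (\<gamma> s)) has_vector_derivative f' v) (at (t::real))"
proof -
  obtain S where S: "open S" "t \<in> S" "\<And>s. s \<in> S \<Longrightarrow> \<gamma> s \<in> A"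
    using A unfolding eventually_nhds by blast
  have "((f \<circ> \<gamma>) has_vector_derivative f' v) (at t within S)"
    by (rule vector_derivative_diff_chain_within)
      (use S in \<open>auto intro: has_vector_derivative_at_within[OF \<gamma>] has_derivative_subset[OF f]\<close>)
  then show ?thesis using S at_within_open[of t S] by (simp add: o_def)
qed

text \<open>The Frechet derivative within \<open>A\<close> may be ambiguous as a linear map, but
  whichever one is chosen gives the right value on velocities of curves in \<open>A\<close>.\<close>

lemma smooth_map_along_curve:
  assumes "smooth_map A f" and A: "\<forall>\<^sub>F s in nhds t. \<gamma> s \<in> A"
    and "(\<gamma> has_vector_derivative v) (at t)"
  shows "((\<lambda>s. f (\<gamma> s)) has_vector_derivative frechet_derivative f (at (\<gamma> t) within A) v) (at (t::real))"
proof -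
  have "\<gamma> t \<in> A" using A eventually_nhds_x_imp_x by blast
  then have "(f has_derivative frechet_derivative f (at (\<gamma> t) within A)) (at (\<gamma> t) within A)"
    using smooth_map_differentiable[OF assms(1)] frechet_derivative_works by blast
  from has_vector_derivative_compose_within[OF this A assms(3)] show ?thesis .
qed

section \<open>Tangent spaces\<close>

text \<open>A vector orthogonal to \<open>L\<close> pairs to 0 with \<open>f\<close> near
  \<open>t\<close>, hence with \<open>d\<close>; and \<open>L\<close> is its own double orthogonal
  complement.\<close>

lemma has_vector_derivative_in_subspace:
  fixes f :: "real \<Rightarrow> 'a::euclidean_space"
  assumes f: "(f has_vector_derivative d) (at t)" and L: "subspace L" "\<forall>\<^sub>F s in nhds t. f s \<in> L"
  shows "d \<in> L"
proof -
  obtain S where S: "open S" "t \<in> S" "\<And>s. s \<in> S \<Longrightarrow> f s \<in> L"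
    using L(2) unfolding eventually_nhds by metis
  have "z \<bullet> d = 0" if z: "z \<in> orthogonal_comp L" for z
  proof -
    have "((\<lambda>s. z \<bullet> f s) has_vector_derivative z \<bullet> d) (at t)"
      by (rule bounded_linear.has_vector_derivative[OF bounded_linear_inner_right f])
    moreover have "((\<lambda>s. z \<bullet> f s) has_vector_derivative 0) (at t)"
    proof (rule has_vector_derivative_transform_within_open[OF _ S(1,2)])
      show "((\<lambda>s. 0) has_vector_derivative 0) (at t)" by (rule has_vector_derivative_const)
      show "0 = z \<bullet> f s" if "s \<in> S" for s
        using z S(3)[OF that] by (auto simp: orthogonal_comp_def orthogonal_def inner_commute)
    qed
    ultimately show ?thesis using vector_derivative_unique_at by metis
  qed
  then have "d \<in> orthogonal_comp (orthogonal_comp L)"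
    by (auto simp: orthogonal_comp_def orthogonal_def inner_commute)
  then show ?thesis using orthogonal_comp_self[OF L(1)] by simp
qed

lemma has_vector_derivative_compose_at:
  assumes f: "(f has_derivative f') (at p)" and p: "\<gamma> t = p" and \<gamma>: "(\<gamma> has_vector_derivative v) (at (t::real))"
  shows "((\<lambda>s. f (\<gamma> s)) has_vector_derivative f' v) (at t)"
  by (rule has_vector_derivative_compose_within[of f f' \<gamma> t UNIV, OF _ _ \<gamma>]) (simp_all add: p f)

lemma has_vector_derivative_eventually_in_open:
  fixes \<gamma> :: "real \<Rightarrow> 'a::real_normed_vector"
  assumes \<gamma>: "(\<gamma> has_vector_derivative v) (at t)" and U: "open U" "\<gamma> t \<in> U"
  shows "\<forall>\<^sub>F s in nhds t. \<gamma> s \<in> U"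
proof -
  have "isCont \<gamma> t" using has_vector_derivative_continuous[OF \<gamma>] .
  then have "(\<gamma> \<longlongrightarrow> \<gamma> t) (at t)" by (simp add: isCont_def)
  from topological_tendstoD[OF this U] show ?thesis
    unfolding eventually_nhds_conv_at using U(2) by simp
qed

lemma tangent_spaceE:
  assumes "v \<in> tangent_space Q q"
  obtains e \<gamma> where "e > 0" "\<And>t. t \<in> {-e<..<e} \<Longrightarrow> \<gamma> t \<in> Q" "\<gamma> (0::real) = q"
    "(\<gamma> has_vector_derivative v) (at 0)"
proof -
  from assms obtain e \<gamma> where "e > 0 \<and> smooth_on {-e<..<e} \<gamma> \<and> (\<forall>t\<in>{-e<..<e}. \<gamma> t \<in> Q) \<and>
     \<gamma> (0::real) = q \<and> (\<gamma> has_vector_derivative v) (at 0)"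
    unfolding tangent_space_def by auto
  then show ?thesis by (intro that[of e \<gamma>]) (elim conjE; assumption | blast)+
qed

text \<open>One of the charts granted by \<open>embedded_submanifold\<close>. Both
  \<open>\<phi>\<close> and \<open>\<xi>\<close> act on open sets of the ambient space, so their
  tangent maps are mutually inverse on the whole space and not only on tangent spaces.\<close>

locale slice_chart =
  fixes Q :: "'a::euclidean_space set" and U W :: "'a set" and \<phi> \<xi> :: "'a \<Rightarrow> 'a" and L :: "'a set"
  assumes smooth_phi: "smooth_on U \<phi>" and smooth_xi: "smooth_on W \<xi>"
    and image_phi: "\<phi> ` U = W" and xi_phi: "x \<in> U \<Longrightarrow> \<xi> (\<phi> x) = x"
    and subspace_L: "subspace L" and image_phi_Q: "\<phi> ` (U \<inter> Q) = W \<inter> L"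
begin

abbreviation "D\<phi> x \<equiv> frechet_derivative \<phi> (at x)"
abbreviation "D\<xi> y \<equiv> frechet_derivative \<xi> (at y)"

lemma open_U: "open U" and open_W: "open W"
  using smooth_on_open smooth_phi smooth_xi by blast+

lemma phi_in_W: "x \<in> U \<Longrightarrow> \<phi> x \<in> W" using image_phi by blast

lemma phi_xi: "y \<in> W \<Longrightarrow> \<phi> (\<xi> y) = y" using image_phi xi_phi by auto

lemma phi_in_L: "x \<in> U \<Longrightarrow> x \<in> Q \<Longrightarrow> \<phi> x \<in> L" using image_phi_Q by blast

lemma xi_in_Q:
  assumes "y \<in> W" "y \<in> L"
  shows "\<xi> y \<in> Q"
proof -
  have "y \<in> \<phi> ` (U \<inter> Q)" using assms image_phi_Q by simp
  then obtain x where "x \<in> U" "x \<in> Q" "y = \<phi> x" by blast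
  then show ?thesis by (simp add: xi_phi)
qed

lemma phi_deriv: "x \<in> U \<Longrightarrow> (\<phi> has_derivative D\<phi> x) (at x)"
  by (rule smooth_on_has_derivative[OF smooth_phi])

lemma xi_deriv: "y \<in> W \<Longrightarrow> (\<xi> has_derivative D\<xi> y) (at y)"
  by (rule smooth_on_has_derivative[OF smooth_xi])

lemma linear_Dphi: "x \<in> U \<Longrightarrow> linear (D\<phi> x)"
  using phi_deriv has_derivative_linear by blast

lemma linear_Dxi: "y \<in> W \<Longrightarrow> linear (D\<xi> y)"
  using xi_deriv has_derivative_linear by blast

lemma Dxi_Dphi:
  assumes x: "x \<in> U"
  shows "D\<xi> (\<phi> x) (D\<phi> x v) = v"
proof -
  have "((\<lambda>x. \<xi> (\<phi> x)) has_derivative (\<lambda>v. D\<xi> (\<phi> x) (D\<phi> x v))) (at x)"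
    by (rule has_derivative_compose[OF phi_deriv[OF x] xi_deriv[OF phi_in_W[OF x]]])
  moreover have "((\<lambda>x. \<xi> (\<phi> x)) has_derivative (\<lambda>v. v)) (at x)"
    by (rule has_derivative_transform_within_open[OF has_derivative_ident open_U x]) (simp add: xi_phi)
  ultimately show ?thesis using has_derivative_unique by metis
qed

lemma Dphi_Dxi:
  assumes x: "x \<in> U"
  shows "D\<phi> x (D\<xi> (\<phi> x) v) = v"
proof -
  have "((\<lambda>y. \<phi> (\<xi> y)) has_derivative (\<lambda>v. D\<phi> (\<xi> (\<phi> x)) (D\<xi> (\<phi> x) v))) (at (\<phi> x))"
    by (rule has_derivative_compose[OF xi_deriv[OF phi_in_W[OF x]] phi_deriv]) (simp add: xi_phi x)
  moreover have "((\<lambda>y. \<phi> (\<xi> y)) has_derivative (\<lambda>v. v)) (at (\<phi> x))"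
    by (rule has_derivative_transform_within_open[OF has_derivative_ident open_W phi_in_W[OF x]])
      (simp add: phi_xi)
  ultimately show ?thesis using has_derivative_unique xi_phi[OF x] by metis
qed

text \<open>In the chart a curve in \<open>Q\<close> becomes a curve in \<open>L\<close>, whose
  velocity lies in \<open>L\<close>. Conversely a velocity \<open>l\<close> in \<open>L\<close> is
  realized by the image under \<open>\<xi>\<close> of the segment through \<open>\<phi> q\<close> in
  direction \<open>l\<close>.\<close>

lemma tangent_space_eq:
  assumes q: "q \<in> U" "q \<in> Q"
  shows "tangent_space Q q = {v. D\<phi> q v \<in> L}"
proof (intro subset_antisym subsetI CollectI)
  fix v assume "v \<in> tangent_space Q q"
  then obtain e \<gamma> where e: "e > 0" and \<gamma>: "\<And>t. t \<in> {-e<..<e} \<Longrightarrow> \<gamma> t \<in> Q" "\<gamma> (0::real) = q"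
    "(\<gamma> has_vector_derivative v) (at 0)"
    using tangent_spaceE[OF \<open>v \<in> tangent_space Q q\<close>] by metis
  have "((\<lambda>t. \<phi> (\<gamma> t)) has_vector_derivative D\<phi> q v) (at 0)"
    by (rule has_vector_derivative_compose_at[OF phi_deriv[OF q(1)] \<gamma>(2,3)])
  moreover have "\<forall>\<^sub>F s in nhds 0. \<phi> (\<gamma> s) \<in> L"
  proof -
    have "\<forall>\<^sub>F s in nhds 0. \<gamma> s \<in> U"
      using has_vector_derivative_eventually_in_open[OF \<gamma>(3) open_U] q(1) \<gamma>(2) by simp
    moreover have "\<forall>\<^sub>F s in nhds 0. s \<in> {-e<..<e}" by (rule eventually_nhds_in_open) (use e in auto)
    ultimately show ?thesis by eventually_elim (use \<gamma>(1) phi_in_L in blast)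
  qed
  ultimately show "D\<phi> q v \<in> L" using has_vector_derivative_in_subspace subspace_L by blast
next
  fix v assume "v \<in> {v. D\<phi> q v \<in> L}"
  define l where "l = D\<phi> q v"
  have l: "l \<in> L" using \<open>v \<in> _\<close> by (simp add: l_def)
  define a where "a t = \<phi> q + t *\<^sub>R l" for t :: real
  have sa: "smooth_on UNIV a" unfolding a_def
    by (intro smooth_on_add smooth_on_const smooth_on_scaleR smooth_on_ident open_UNIV)
  have "open (a -` W)"
    by (rule open_vimage[OF open_W smooth_on_continuous[OF sa]])
  moreover have "0 \<in> a -` W" using phi_in_W[OF q(1)] by (simp add: a_def)
  ultimately obtain e where e: "e > 0" "ball 0 e \<subseteq> a -` W" using open_contains_ball by blast
  have aW: "a t \<in> W" if "t \<in> {-e<..<e}" for t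
    using e(2) that by (auto simp: ball_eq_greaterThanLessThan)
  have aL: "a t \<in> L" for t unfolding a_def
    by (intro subspace_add subspace_scale subspace_L phi_in_L q l)
  have "smooth_on {-e<..<e} (\<lambda>t. \<xi> (a t))"
    by (rule smooth_on_compose[OF smooth_xi smooth_on_subset[OF sa]]) (use aW in auto)
  moreover have "\<forall>t\<in>{-e<..<e}. \<xi> (a t) \<in> Q" using aW aL xi_in_Q by blast
  moreover have "\<xi> (a 0) = q" by (simp add: a_def xi_phi q)
  moreover have "((\<lambda>t. \<xi> (a t)) has_vector_derivative v) (at 0)"
  proof -
    have "(a has_vector_derivative l) (at 0)"
      unfolding a_def by (auto intro!: derivative_eq_intros)
    then have "((\<lambda>t. \<xi> (a t)) has_vector_derivative D\<xi> (\<phi> q) l) (at 0)"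
      by (rule has_vector_derivative_compose_at[OF xi_deriv[OF phi_in_W[OF q(1)]], rotated]) (simp add: a_def)
    then show ?thesis by (simp add: l_def Dxi_Dphi q)
  qed
  ultimately show "v \<in> tangent_space Q q" using e(1) unfolding tangent_space_def mem_Collect_eq
    by (intro exI[of _ e] exI[of _ "\<lambda>t. \<xi> (a t)"] conjI)
qed

lemma Dxi_tangent: "q \<in> U \<Longrightarrow> q \<in> Q \<Longrightarrow> l \<in> L \<Longrightarrow> D\<xi> (\<phi> q) l \<in> tangent_space Q q"
  by (simp add: tangent_space_eq Dphi_Dxi)

end

lemma obtain_slice_chart:
  assumes "embedded_submanifold Q" "q \<in> Q"
  obtains U W \<phi> \<xi> L where "slice_chart Q U W \<phi> \<xi> L" "q \<in> U"
proof -
  obtain k where "\<forall>q\<in>Q. \<exists>U W \<phi> \<xi> L. q \<in> U \<and>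
        smooth_on U (\<phi> :: 'a \<Rightarrow> 'a) \<and> smooth_on W (\<xi> :: 'a \<Rightarrow> 'a) \<and> \<phi> ` U = W \<and>
        (\<forall>x\<in>U. \<xi> (\<phi> x) = x) \<and>
        subspace L \<and> dim L = k \<and> \<phi> ` (U \<inter> Q) = W \<inter> L"
    using assms(1) unfolding embedded_submanifold_def ..
  from bspec[OF this assms(2)] obtain U W \<phi> \<xi> L where "q \<in> U \<and>
        smooth_on U (\<phi> :: 'a \<Rightarrow> 'a) \<and> smooth_on W (\<xi> :: 'a \<Rightarrow> 'a) \<and> \<phi> ` U = W \<and>
        (\<forall>x\<in>U. \<xi> (\<phi> x) = x) \<and>
        subspace L \<and> dim L = k \<and> \<phi> ` (U \<inter> Q) = W \<inter> L"
    by (elim exE)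
  then show ?thesis by (intro that[of U W \<phi> \<xi> L]) (auto intro!: slice_chart.intro)
qed

lemma subspace_tangent_space:
  assumes "embedded_submanifold Q" "q \<in> Q"
  shows "subspace (tangent_space Q q)"
proof -
  obtain U W \<phi> \<xi> L where c: "slice_chart Q U W \<phi> \<xi> L" "q \<in> U" using obtain_slice_chart[OF assms] .
  interpret slice_chart Q U W \<phi> \<xi> L by (rule c)
  have "tangent_space Q q = D\<phi> q -` L" using tangent_space_eq[OF c(2) assms(2)] by auto
  then show ?thesis using linear_subspace_vimage[OF linear_Dphi[OF c(2)] subspace_L] by simp
qed

text \<open>Near the limit point a single chart describes tangency by
  \<open>D\<phi> q v \<in> L\<close>, a closed condition since \<open>L\<close> is closed and the
  tangent map is jointly continuous.\<close>

lemma closed_tangent_bundle: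
  assumes Q: "embedded_submanifold Q" "closed Q"
  shows "closed (tangent_bundle Q)"
  unfolding closed_sequential_limits
proof (intro allI impI)
  fix x l assume "(\<forall>n. x n \<in> tangent_bundle Q) \<and> x \<longlonglongrightarrow> l"
  then have x: "\<And>n. x n \<in> tangent_bundle Q" and lim: "x \<longlonglongrightarrow> l" by auto
  define q v where "q n = fst (x n)" and "v n = snd (x n)" for n
  have qv: "q n \<in> Q" "v n \<in> tangent_space Q (q n)" for n
    using x[of n] by (auto simp: q_def v_def tangent_bundle_def)
  have lq: "q \<longlonglongrightarrow> fst l" unfolding q_def by (intro tendsto_intros lim)
  have lQ: "fst l \<in> Q" using Q(2) lq qv(1) closed_sequentially by blast
  obtain U W \<phi> \<xi> L where c: "slice_chart Q U W \<phi> \<xi> L" "fst l \<in> U" using obtain_slice_chart[OF Q(1) lQ] .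
  interpret slice_chart Q U W \<phi> \<xi> L by (rule c)
  have sm: "smooth_on (U \<times> UNIV) (\<lambda>z. D\<phi> (fst z) (snd z))"
    by (rule smooth_on_frechet_derivative[OF smooth_phi])
      (auto intro!: smooth_on_bounded_linear bounded_linear_fst bounded_linear_snd open_Times open_U)
  have "l \<in> U \<times> UNIV" using c(2) by (simp add: mem_Times_iff)
  then have "isCont (\<lambda>z. D\<phi> (fst z) (snd z)) l"
    by (rule continuous_on_eq_continuous_at[OF open_Times[OF open_U open_UNIV], THEN iffD1,
        OF smooth_on_continuous[OF sm], rule_format])
  from isCont_tendsto_compose[OF this lim]
  have "(\<lambda>n. D\<phi> (q n) (v n)) \<longlonglongrightarrow> D\<phi> (fst l) (snd l)"
    by (simp add: q_def v_def)
  moreover have "\<forall>\<^sub>F n in sequentially. D\<phi> (q n) (v n) \<in> L"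
    using topological_tendstoD[OF lq open_U c(2)]
  proof eventually_elim
    case (elim n)
    then show ?case using qv[of n] tangent_space_eq[of "q n"] by auto
  qed
  ultimately have "D\<phi> (fst l) (snd l) \<in> L"
    using Lim_in_closed_set[OF closed_subspace[OF subspace_L] _ sequentially_bot] by metis
  then have "snd l \<in> tangent_space Q (fst l)" using tangent_space_eq[OF c(2) lQ] by auto
  then show "l \<in> tangent_bundle Q" using lQ by (auto simp: tangent_bundle_def case_prod_beta)
qed

section \<open>Differentials of functions on the submanifold\<close>

lemma differential_along_curve:
  assumes "smooth_map Q f" "\<forall>\<^sub>F s in nhds t. \<gamma> s \<in> Q" "(\<gamma> has_vector_derivative v) (at t)"
  shows "((\<lambda>s. f (\<gamma> s)) has_real_derivative differential Q f (\<gamma> t) v) (at t)"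
  using smooth_map_along_curve[OF assms]
  by (simp add: differential_def has_real_derivative_iff_has_vector_derivative)

lemma linear_differential:
  assumes "smooth_map Q f" "q \<in> Q"
  shows "linear (differential Q f q)"
proof -
  have "(f has_derivative frechet_derivative f (at q within Q)) (at q within Q)"
    using smooth_map_differentiable[OF assms] frechet_derivative_works by blast
  then show ?thesis
    using has_derivative_linear unfolding differential_def[abs_def] by blast
qed

text \<open>Both sides are the derivative at 0 along a curve in \<open>Q\<close> with velocity
  \<open>v\<close>, where \<open>f\<close> and \<open>F\<close> coincide.\<close>

lemma differential_eq_extension:
  assumes f: "smooth_map Q f" and F: "smooth_on U F" "q \<in> U" "\<And>y. y \<in> U \<Longrightarrow> y \<in> Q \<Longrightarrow> F y = f y"
    and v: "v \<in> tangent_space Q q"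
  shows "differential Q f q v = frechet_derivative F (at q) v"
proof -
  obtain e \<gamma> where e: "e > 0" and \<gamma>: "\<And>t. t \<in> {-e<..<e} \<Longrightarrow> \<gamma> t \<in> Q" "\<gamma> (0::real) = q"
    "(\<gamma> has_vector_derivative v) (at 0)"
    using tangent_spaceE[OF v] by metis
  have e0: "\<forall>\<^sub>F s in nhds 0. s \<in> {-e<..<e}" by (rule eventually_nhds_in_open) (use e in auto)
  have eU: "\<forall>\<^sub>F s in nhds 0. \<gamma> s \<in> U"
    using has_vector_derivative_eventually_in_open[OF \<gamma>(3) smooth_on_open[OF F(1)]] F(2) \<gamma>(2) by simp
  have "\<forall>\<^sub>F s in nhds 0. \<gamma> s \<in> Q" using e0 by eventually_elim (rule \<gamma>(1))
  from differential_along_curve[OF f this \<gamma>(3)]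
  have "((\<lambda>s. f (\<gamma> s)) has_vector_derivative differential Q f q v) (at 0)"
    by (simp add: \<gamma>(2) has_real_derivative_iff_has_vector_derivative)
  moreover have "((\<lambda>s. F (\<gamma> s)) has_vector_derivative frechet_derivative F (at q) v) (at 0)"
    by (rule has_vector_derivative_compose_at[OF smooth_on_has_derivative[OF F(1,2)] \<gamma>(2,3)])
  moreover have ev: "\<forall>\<^sub>F s in nhds 0. f (\<gamma> s) = F (\<gamma> s)"
    using e0 eU by eventually_elim (rule F(3)[symmetric], auto intro: \<gamma>(1))
  moreover have "((\<lambda>s. f (\<gamma> s)) has_vector_derivative frechet_derivative F (at q) v) (at 0) \<longleftrightarrow>
      ((\<lambda>s. F (\<gamma> s)) has_vector_derivative frechet_derivative F (at q) v) (at 0)"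
    using eventually_nhds_x_imp_x[OF ev] ev by (intro has_vector_derivative_cong_ev) auto
  ultimately show ?thesis
    using vector_derivative_unique_at by metis
qed

text \<open>The local smooth extension is the derivative of an extension of \<open>f\<close> in the
  direction of an extension of \<open>X\<close>; on \<open>Q\<close> that direction is tangent, so
  the two agree there.\<close>

lemma smooth_map_differential:
  assumes f: "smooth_map Q f" and X: "vector_field Q X"
  shows "smooth_map Q (\<lambda>q. differential Q f q (X q))"
proof (rule smooth_mapI)
  fix q assume q: "q \<in> Q"
  have Xs: "smooth_map Q X" and Xt: "\<And>q. q \<in> Q \<Longrightarrow> X q \<in> tangent_space Q q"
    using X by (auto simp: vector_field_def)
  obtain U F where F: "q \<in> U" "smooth_on U F" "\<And>y. y \<in> U \<Longrightarrow> y \<in> Q \<Longrightarrow> F y = f y"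
    using smooth_mapE[OF f q] by metis
  obtain V G where G: "q \<in> V" "smooth_on V G" "\<And>y. y \<in> V \<Longrightarrow> y \<in> Q \<Longrightarrow> G y = X y"
    using smooth_mapE[OF Xs q] by metis
  have op: "open (U \<inter> V)" by (intro open_Int smooth_on_open[OF F(2)] smooth_on_open[OF G(2)])
  have "smooth_on (U \<inter> V) (\<lambda>x. frechet_derivative F (at x) (G x))"
    by (rule smooth_on_frechet_derivative[OF F(2)])
      (use op in \<open>auto intro: smooth_on_ident smooth_on_subset[OF G(2)]\<close>)
  moreover have "frechet_derivative F (at y) (G y) = differential Q f y (X y)" if "y \<in> U" "y \<in> V" "y \<in> Q" for y
    using differential_eq_extension[OF f F(2) that(1) F(3) Xt[OF that(3)]] G(3)[OF that(2,3)] by simp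
  ultimately show "\<exists>U H. q \<in> U \<and> smooth_on U H \<and> (\<forall>y\<in>U \<inter> Q. H y = differential Q f y (X y))"
    using F(1) G(1) by (intro exI[of _ "U \<inter> V"] exI[of _ "\<lambda>x. frechet_derivative F (at x) (G x)"]) auto
qed

section \<open>Local frames\<close>

text \<open>\<open>E\<close> is a frame on \<open>N \<inter> Q\<close> by globally defined vector fields with coefficient functions \<open>c\<close>, and
  \<open>\<xi>\<close> a parametrization of \<open>N \<inter> Q\<close> over an open subset of the span of the orthonormal vectors \<open>e i\<close>
  whose coordinate fields are the \<open>E i\<close>.
  \<open>frame_cutoff\<close> is the form in which tensoriality of the connection is used.\<close>

locale moving_frame =
  fixes Q :: "'a::euclidean_space set" and N :: "'a set" and k :: nat and E :: "nat \<Rightarrow> 'a \<Rightarrow> 'a"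
    and c :: "nat \<Rightarrow> 'a \<Rightarrow> 'a \<Rightarrow> real" and \<rho> :: "'a \<Rightarrow> real"
    and W :: "'a set" and \<xi> :: "'a \<Rightarrow> 'a" and e :: "nat \<Rightarrow> 'a"
  assumes submanifold: "embedded_submanifold Q" and open_N: "open N"
    and E_field: "i < k \<Longrightarrow> vector_field Q (E i)"
    and E_smooth: "i < k \<Longrightarrow> smooth_on UNIV (E i)"
    and c_smooth: "i < k \<Longrightarrow> smooth_on (N \<times> UNIV) (\<lambda>z. c i (fst z) (snd z))"
    and c_linear: "i < k \<Longrightarrow> q \<in> N \<Longrightarrow> linear (c i q)"
    and frame_expand: "q \<in> N \<Longrightarrow> q \<in> Q \<Longrightarrow> v \<in> tangent_space Q q \<Longrightarrow> (\<Sum>i<k. c i q v *\<^sub>R E i q) = v"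
    and rho_smooth: "smooth_map Q \<rho>"
    and rho_1: "q \<in> N \<Longrightarrow> q \<in> Q \<Longrightarrow> \<rho> q = 1"
    and frame_cutoff: "vector_field Q X \<Longrightarrow> \<exists>f. (\<forall>i<k. smooth_map Q (f i)) \<and>
        (\<forall>i<k. \<forall>q\<in>N \<inter> Q. f i q = c i q (X q)) \<and> (\<forall>q\<in>Q. \<rho> q *\<^sub>R X q = (\<Sum>i<k. f i q *\<^sub>R E i q))"
    and open_W: "open W" and xi_continuous: "continuous_on W \<xi>"
    and e_orthonormal: "i < k \<Longrightarrow> j < k \<Longrightarrow> e i \<bullet> e j = (if i = j then 1 else 0)"
    and xi_in: "y \<in> W \<Longrightarrow> (\<Sum>i<k. (y \<bullet> e i) *\<^sub>R e i) = y \<Longrightarrow> \<xi> y \<in> N \<inter> Q"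
    and xi_has_derivative: "y \<in> W \<Longrightarrow> (\<Sum>i<k. (y \<bullet> e i) *\<^sub>R e i) = y \<Longrightarrow>
        \<exists>D. (\<xi> has_derivative D) (at y) \<and> (\<forall>i<k. D (e i) = E i (\<xi> y))"

text \<open>Frames are numbered by \<open>i < k\<close>, as are the sums in
  \<open>has_covariant_derivative\<close>; orthonormality makes coordinates inner products.\<close>

lemma orthonormal_enumeration:
  fixes L :: "'a::euclidean_space set"
  assumes "subspace L"
  obtains k and e :: "nat \<Rightarrow> 'a" where "\<And>i. i < k \<Longrightarrow> e i \<in> L"
    "\<And>i j. i < k \<Longrightarrow> j < k \<Longrightarrow> e i \<bullet> e j = (if i = j then 1 else 0)"
    "\<And>x. x \<in> L \<Longrightarrow> (\<Sum>i<k. (x \<bullet> e i) *\<^sub>R e i) = x"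
proof -
  obtain B where B: "B \<subseteq> L" "pairwise orthogonal B" "\<And>x. x \<in> B \<Longrightarrow> norm x = 1"
    "independent B" "card B = dim L" "span B = L"
    using orthonormal_basis_subspace[OF assms] by metis
  have fin: "finite B" using B(4) by (simp add: independent_imp_finite)
  obtain e where e: "bij_betw e {..<card B} B"
    using ex_bij_betw_nat_finite[OF fin] by (auto simp: atLeast0LessThan)
  have eB: "e i \<in> B" if "i < card B" for i using e that by (auto simp: bij_betw_def)
  show ?thesis
  proof (rule that[of "card B" e])
    show "e i \<in> L" if "i < card B" for i using eB[OF that] B(1) by blast
    show "e i \<bullet> e j = (if i = j then 1 else 0)" if "i < card B" "j < card B" for i j
    proof (cases "i = j")
      case True
      then show ?thesis using B(3)[OF eB[OF that(1)]] by (simp add: norm_eq_1)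
    next
      case False
      then have "e i \<noteq> e j" using e that by (auto simp: bij_betw_def inj_on_def)
      then show ?thesis using False B(2) eB that by (auto simp: pairwise_def orthogonal_def)
    qed
    show "(\<Sum>i<card B. (x \<bullet> e i) *\<^sub>R e i) = x" if "x \<in> L" for x
    proof -
      have "(\<Sum>i<card B. (x \<bullet> e i) *\<^sub>R e i) = (\<Sum>b\<in>B. (x \<bullet> b) *\<^sub>R b)"
        by (rule sum.reindex_bij_betw[OF e])
      then show ?thesis using orthonormal_basis_expand[OF B(2,3) _ fin] B(6) that by simp
    qed
  qed
qed

context slice_chart
begin

text \<open>The coordinate fields \<open>D\<xi> (\<phi> x) (e i)\<close>, multiplied by a bump
  function that is 1 on \<open>N\<close>, become global fields and are still the coordinate fields
  on \<open>N\<close>.\<close>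

lemma frame_exists:
  assumes Q: "embedded_submanifold Q" and q0: "q0 \<in> U" "q0 \<in> Q"
  shows "\<exists>N k E c \<rho> W' e. moving_frame Q N k E c \<rho> W' \<xi> e \<and> q0 \<in> N \<and> \<phi> q0 \<in> W' \<and>
    (\<Sum>i<k. (\<phi> q0 \<bullet> e i) *\<^sub>R e i) = \<phi> q0"
proof -
  obtain k and e :: "nat \<Rightarrow> 'a" where eL: "\<And>i. i < k \<Longrightarrow> e i \<in> L"
    and eo: "\<And>i j. i < k \<Longrightarrow> j < k \<Longrightarrow> e i \<bullet> e j = (if i = j then 1 else 0)"
    and ex: "\<And>x. x \<in> L \<Longrightarrow> (\<Sum>i<k. (x \<bullet> e i) *\<^sub>R e i) = x"
    using orthonormal_enumeration[OF subspace_L] by metis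
  obtain s where s: "s > 0" "cball q0 s \<subseteq> U" using open_U q0(1) open_contains_cball by blast
  \<comment> \<open>Half the radius, since the bump function vanishes only outside the ball of twice
    its inner radius.\<close>
  define r where "r = s / 2"
  have r: "r > 0" "cball q0 (2 * r) \<subseteq> U" using s by (auto simp: r_def)
  obtain \<zeta> :: "'a \<Rightarrow> real" where z: "smooth_on UNIV \<zeta>" and z1: "\<And>x. x \<in> cball q0 r \<Longrightarrow> \<zeta> x = 1"
    and z0: "\<And>x. x \<notin> cball q0 (2 * r) \<Longrightarrow> \<zeta> x = 0"
    using smooth_bump[OF r(1)] by metis
  define N where "N = ball q0 r"
  have NU: "N \<subseteq> U" using r(1) r(2) by (auto simp: N_def intro!: subsetD[OF r(2)])
  have zN: "\<zeta> x = 1" if "x \<in> N" for x using that by (intro z1) (simp add: N_def)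
  define E where "E i x = (if x \<in> U then \<zeta> x *\<^sub>R D\<xi> (\<phi> x) (e i) else 0)" for i x
  \<comment> \<open>Chart coordinates are not cut off: they are smooth on \<open>U\<close> and are
    multiplied by \<open>\<zeta>\<close> only where a coefficient on all of \<open>Q\<close> is
    wanted.\<close>
  define c where "c i x v = D\<phi> x v \<bullet> e i" for i x v
  \<comment> \<open>Cut-off fields and cut-off coefficients each carry a factor
    \<open>\<zeta>\<close>, so together they represent \<open>\<zeta>^2\<close> times the
    field.\<close>
  define \<rho> where "\<rho> x = \<zeta> x * \<zeta> x" for x
  \<comment> \<open>Restricting the parameters to the preimage of \<open>N\<close> keeps
    \<open>\<xi>\<close> where \<open>\<zeta>\<close> is 1.\<close>
  define W' where "W' = W \<inter> \<xi> -` N"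
  have oW: "open W'" unfolding W'_def N_def
    by (rule continuous_open_preimage[OF smooth_on_continuous[OF smooth_xi] open_W open_ball])
  have W'L: "y \<in> L" if "(\<Sum>i<k. (y \<bullet> e i) *\<^sub>R e i) = y" for y
  proof -
    have "(\<Sum>i<k. (y \<bullet> e i) *\<^sub>R e i) \<in> L"
      by (intro subspace_sum subspace_L subspace_scale) (use eL in auto)
    then show ?thesis using that by simp
  qed
  have Es: "smooth_on UNIV (E i)" for i
    unfolding E_def[abs_def]
    by (rule smooth_on_cutoff[OF _ z, of U _ "cball q0 (2 * r)"])
      (auto intro!: smooth_on_frechet_derivative[OF smooth_xi smooth_phi] smooth_on_const open_U phi_in_W z0
        intro: subsetD[OF r(2)])
  have Et: "E i q \<in> tangent_space Q q" if "i < k" "q \<in> Q" for i q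
  proof (cases "q \<in> U")
    case True
    then show ?thesis using Dxi_tangent[OF True that(2) eL[OF that(1)]]
      by (simp add: E_def subspace_scale[OF subspace_tangent_space[OF Q that(2)]])
  next
    case False
    then show ?thesis by (simp add: E_def subspace_0[OF subspace_tangent_space[OF Q that(2)]])
  qed
  have cs: "smooth_on (U \<times> UNIV) (\<lambda>z. c i (fst z) (snd z))" for i
    unfolding c_def
    by (intro smooth_on_bounded_linear_compose[OF bounded_linear_inner_left]
        smooth_on_frechet_derivative[OF smooth_phi])
      (auto intro!: smooth_on_bounded_linear bounded_linear_fst bounded_linear_snd open_Times open_U)
  have expand: "(\<Sum>i<k. c i q v *\<^sub>R D\<xi> (\<phi> q) (e i)) = v"
    if "q \<in> U" "q \<in> Q" "v \<in> tangent_space Q q" for q v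
  proof -
    have "D\<phi> q v \<in> L" using that tangent_space_eq by auto
    then have "(\<Sum>i<k. c i q v *\<^sub>R e i) = D\<phi> q v" unfolding c_def by (rule ex)
    moreover have "D\<xi> (\<phi> q) (\<Sum>i<k. c i q v *\<^sub>R e i) = (\<Sum>i<k. c i q v *\<^sub>R D\<xi> (\<phi> q) (e i))"
      using linear_Dxi[OF phi_in_W[OF that(1)]] by (simp add: linear_sum linear_scale)
    ultimately show ?thesis using Dxi_Dphi[OF that(1)] by simp
  qed
  have mf: "moving_frame Q N k E c \<rho> W' \<xi> e"
  proof (rule moving_frame.intro)
    show "embedded_submanifold Q" by (rule Q)
    show "open N" by (simp add: N_def)
    show "vector_field Q (E i)" if "i < k" for i
      unfolding vector_field_def using Et[OF that] smooth_on_imp_smooth_map[OF Es] by simp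
    show "smooth_on UNIV (E i)" for i by (rule Es)
    show "smooth_on (N \<times> UNIV) (\<lambda>z. c i (fst z) (snd z))" for i
      by (rule smooth_on_subset[OF cs]) (use NU in \<open>auto simp: N_def intro: open_Times\<close>)
    show "linear (c i q)" if "q \<in> N" for i q
      unfolding c_def[abs_def]
      using linear_compose[OF linear_Dphi bounded_linear.linear[OF bounded_linear_inner_left], of q "e i"] that NU
      by (auto simp: o_def)
    show "(\<Sum>i<k. c i q v *\<^sub>R E i q) = v" if "q \<in> N" "q \<in> Q" "v \<in> tangent_space Q q" for q v
    proof -
      have "q \<in> U" using that NU by auto
      then show ?thesis using expand[OF _ that(2,3)] zN[OF that(1)] by (simp add: E_def)
    qed
    show "smooth_map Q \<rho>"
      unfolding \<rho>_def[abs_def] by (intro smooth_map_mult smooth_on_imp_smooth_map[OF z]) auto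
    show "\<rho> q = 1" if "q \<in> N" for q using zN[OF that] by (simp add: \<rho>_def)
    show "\<exists>f. (\<forall>i<k. smooth_map Q (f i)) \<and> (\<forall>i<k. \<forall>q\<in>N \<inter> Q. f i q = c i q (X q)) \<and>
        (\<forall>q\<in>Q. \<rho> q *\<^sub>R X q = (\<Sum>i<k. f i q *\<^sub>R E i q))" if X: "vector_field Q X" for X
    proof (intro exI[of _ "\<lambda>i x. if x \<in> U then \<zeta> x *\<^sub>R c i x (X x) else 0"] conjI allI impI ballI)
      have Xs: "smooth_map Q X" and Xt: "\<And>q. q \<in> Q \<Longrightarrow> X q \<in> tangent_space Q q"
        using X by (auto simp: vector_field_def)
      have "smooth_map (U \<times> UNIV) (\<lambda>z. c i (fst z) (snd z))" for i
        by (rule smooth_on_imp_smooth_map[OF cs]) simp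
      from smooth_map_compose[OF this smooth_map_Pair[OF smooth_map_ident smooth_map_subset[OF Xs]], of "Q \<inter> U"]
      have "smooth_map (Q \<inter> U) (\<lambda>x. c i x (X x))" for i
        by (simp add: Int_lower1 Int_iff)
      then show "smooth_map Q (\<lambda>x. if x \<in> U then \<zeta> x *\<^sub>R c i x (X x) else 0)" for i
        by (rule smooth_map_cutoff[OF _ open_U z closed_cball r(2) z0])
      show "(if q \<in> U then \<zeta> q *\<^sub>R c i q (X q) else 0) = c i q (X q)" if "q \<in> N \<inter> Q" for i q
        using that NU zN by auto
      show "\<rho> q *\<^sub>R X q = (\<Sum>i<k. (if q \<in> U then \<zeta> q *\<^sub>R c i q (X q) else 0) *\<^sub>R E i q)" if "q \<in> Q" for q
      proof (cases "q \<in> U")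
        case True
        have "(\<Sum>i<k. (\<zeta> q *\<^sub>R c i q (X q)) *\<^sub>R (\<zeta> q *\<^sub>R D\<xi> (\<phi> q) (e i)))
          = \<rho> q *\<^sub>R (\<Sum>i<k. c i q (X q) *\<^sub>R D\<xi> (\<phi> q) (e i))"
          by (simp add: scaleR_sum_right \<rho>_def ac_simps)
        then show ?thesis using True expand[OF True that Xt[OF that]] by (simp add: E_def)
      next
        case False
        then have "q \<notin> cball q0 (2 * r)" using r(2) by blast
        then show ?thesis using False z0 by (simp add: \<rho>_def)
      qed
    qed
    show "open W'" by (rule oW)
    show "continuous_on W' \<xi>"
      by (rule continuous_on_subset[OF smooth_on_continuous[OF smooth_xi]]) (simp add: W'_def)
    show "e i \<bullet> e j = (if i = j then 1 else 0)" if "i < k" "j < k" for i j by (rule eo[OF that])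
    show "\<xi> y \<in> N \<inter> Q" if "y \<in> W'" "(\<Sum>i<k. (y \<bullet> e i) *\<^sub>R e i) = y" for y
      using that xi_in_Q W'L by (auto simp: W'_def)
    show "\<exists>D. (\<xi> has_derivative D) (at y) \<and> (\<forall>i<k. D (e i) = E i (\<xi> y))"
      if "y \<in> W'" "(\<Sum>i<k. (y \<bullet> e i) *\<^sub>R e i) = y" for y
    proof -
      have y: "y \<in> W" "\<xi> y \<in> N" using that by (auto simp: W'_def)
      then have "E i (\<xi> y) = D\<xi> y (e i)" for i
        using NU zN by (auto simp: E_def phi_xi)
      then show ?thesis using xi_deriv[OF y(1)] by metis
    qed
  qed
  have "q0 \<in> N" using r by (simp add: N_def)
  moreover have "\<phi> q0 \<in> W'" using \<open>q0 \<in> N\<close> q0 by (simp add: W'_def phi_in_W xi_phi)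
  moreover have "(\<Sum>i<k. (\<phi> q0 \<bullet> e i) *\<^sub>R e i) = \<phi> q0" by (rule ex[OF phi_in_L[OF q0]])
  ultimately show ?thesis using mf by metis
qed

end

lemma obtain_moving_frame:
  assumes Q: "embedded_submanifold Q" and q0: "q0 \<in> Q"
  obtains N k E c \<rho> W \<xi> e y0 where "moving_frame Q N k E c \<rho> W \<xi> e" "q0 \<in> N"
    "y0 \<in> W" "(\<Sum>i<k. (y0 \<bullet> e i) *\<^sub>R e i) = y0" "\<xi> y0 = q0"
proof -
  obtain U W \<phi> \<xi> L where ch: "slice_chart Q U W \<phi> \<xi> L" "q0 \<in> U" using obtain_slice_chart[OF Q q0] .
  interpret slice_chart Q U W \<phi> \<xi> L by (rule ch)
  from frame_exists[OF Q ch(2) q0] obtain N k E c \<rho> W' e where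
    "moving_frame Q N k E c \<rho> W' \<xi> e" "q0 \<in> N" "\<phi> q0 \<in> W'" "(\<Sum>i<k. (\<phi> q0 \<bullet> e i) *\<^sub>R e i) = \<phi> q0"
    by (elim exE conjE)
  then show ?thesis using that xi_phi[OF ch(2)] by metis
qed

section \<open>The metric and the connection along curves\<close>

locale levi_civita_manifold =
  fixes Q :: "'a::euclidean_space set" and g :: "'a \<Rightarrow> 'a \<Rightarrow> 'a \<Rightarrow> real"
    and nabla :: "('a \<Rightarrow> 'a) \<Rightarrow> ('a \<Rightarrow> 'a) \<Rightarrow> 'a \<Rightarrow> 'a"
  assumes proper: "properly_embedded_submanifold Q" and metric: "riemannian_metric Q g"
    and connection: "levi_civita_connection Q g nabla"
begin

abbreviation T where "T q \<equiv> tangent_space Q q"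

lemma embedded: "embedded_submanifold Q" and closed_Q: "closed Q"
  using proper by (auto simp: properly_embedded_submanifold_def)

lemma sub_T: "q \<in> Q \<Longrightarrow> subspace (T q)"
  by (rule subspace_tangent_space[OF embedded])

lemma T_0 [simp]: "q \<in> Q \<Longrightarrow> 0 \<in> T q" by (rule subspace_0[OF sub_T])

lemma T_add: "q \<in> Q \<Longrightarrow> u \<in> T q \<Longrightarrow> v \<in> T q \<Longrightarrow> u + v \<in> T q" by (rule subspace_add[OF sub_T])

lemma T_diff: "q \<in> Q \<Longrightarrow> u \<in> T q \<Longrightarrow> v \<in> T q \<Longrightarrow> u - v \<in> T q" by (rule subspace_diff[OF sub_T])

lemma T_scale: "q \<in> Q \<Longrightarrow> u \<in> T q \<Longrightarrow> r *\<^sub>R u \<in> T q" by (rule subspace_scale[OF sub_T])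

lemma T_sum: "q \<in> Q \<Longrightarrow> (\<And>i. i \<in> I \<Longrightarrow> u i \<in> T q) \<Longrightarrow> (\<Sum>i\<in>I. r i *\<^sub>R u i) \<in> T q"
  by (intro subspace_sum sub_T T_scale)

lemma g_sym: "q \<in> Q \<Longrightarrow> u \<in> T q \<Longrightarrow> v \<in> T q \<Longrightarrow> g q u v = g q v u"
  using metric unfolding riemannian_metric_def by simp

lemma g_pos: "q \<in> Q \<Longrightarrow> u \<in> T q \<Longrightarrow> u \<noteq> 0 \<Longrightarrow> 0 < g q u u"
  using metric unfolding riemannian_metric_def by simp

lemma g_add_right: "q \<in> Q \<Longrightarrow> u \<in> T q \<Longrightarrow> v \<in> T q \<Longrightarrow> w \<in> T q \<Longrightarrow> g q u (v + w) = g q u v + g q u w"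
  using metric unfolding riemannian_metric_def linear_map_on_def by simp

lemma g_scale_right: "q \<in> Q \<Longrightarrow> u \<in> T q \<Longrightarrow> v \<in> T q \<Longrightarrow> g q u (r *\<^sub>R v) = r * g q u v"
  using metric unfolding riemannian_metric_def linear_map_on_def by simp

lemma g_add_left: "q \<in> Q \<Longrightarrow> u \<in> T q \<Longrightarrow> v \<in> T q \<Longrightarrow> w \<in> T q \<Longrightarrow> g q (v + w) u = g q v u + g q w u"
  using g_add_right[of q u v w] g_sym T_add by metis

lemma g_scale_left: "q \<in> Q \<Longrightarrow> u \<in> T q \<Longrightarrow> v \<in> T q \<Longrightarrow> g q (r *\<^sub>R v) u = r * g q v u"
  using g_scale_right[of q u v r] g_sym T_scale by metis

lemma g_diff_left: "q \<in> Q \<Longrightarrow> u \<in> T q \<Longrightarrow> v \<in> T q \<Longrightarrow> w \<in> T q \<Longrightarrow> g q (v - w) u = g q v u - g q w u"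
  using g_add_left[of q u v "(-1) *\<^sub>R w"] g_scale_left[of q u w "-1"] T_scale[of q w "-1"] by simp

lemma g_0_right [simp]: "q \<in> Q \<Longrightarrow> u \<in> T q \<Longrightarrow> g q u 0 = 0"
  using g_scale_right[of q u u 0] by simp

lemma g_nonneg: "q \<in> Q \<Longrightarrow> u \<in> T q \<Longrightarrow> 0 \<le> g q u u"
  using g_pos[of q u] g_0_right[of q u] by (cases "u = 0") auto

lemma g_sum_right:
  assumes "q \<in> Q" "u \<in> T q" "\<And>i. i < m \<Longrightarrow> z i \<in> T q"
  shows "g q u (\<Sum>i<(m::nat). r i *\<^sub>R z i) = (\<Sum>i<m. r i * g q u (z i))"
  using assms(3)
proof (induction m)
  case 0
  then show ?case using assms by simp
next
  case (Suc m)
  have "(\<Sum>i<m. r i *\<^sub>R z i) \<in> T q" using Suc.prems by (intro T_sum assms(1)) auto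
  then show ?case using Suc assms(1,2) by (simp add: g_add_right T_scale g_scale_right)
qed

lemma g_sum_left:
  assumes "q \<in> Q" "u \<in> T q" "\<And>i. i < m \<Longrightarrow> z i \<in> T q"
  shows "g q (\<Sum>i<(m::nat). r i *\<^sub>R z i) u = (\<Sum>i<m. r i * g q (z i) u)"
proof -
  have "(\<Sum>i<m. r i *\<^sub>R z i) \<in> T q" using assms by (intro T_sum) auto
  then have "g q (\<Sum>i<m. r i *\<^sub>R z i) u = g q u (\<Sum>i<m. r i *\<^sub>R z i)" using assms g_sym by metis
  also have "\<dots> = (\<Sum>i<m. r i * g q u (z i))" by (rule g_sum_right) (use assms in auto)
  also have "\<dots> = (\<Sum>i<m. r i * g q (z i) u)"
    by (rule sum.cong[OF refl]) (use assms g_sym in auto)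
  finally show ?thesis .
qed

lemma g_sum_sum:
  assumes "q \<in> Q" "\<And>i. i < m \<Longrightarrow> y i \<in> T q" "\<And>j. j < n \<Longrightarrow> z j \<in> T q"
  shows "g q (\<Sum>i<(m::nat). r i *\<^sub>R y i) (\<Sum>j<(n::nat). s j *\<^sub>R z j) = (\<Sum>i<m. \<Sum>j<n. r i * s j * g q (y i) (z j))"
proof -
  have "g q (\<Sum>i<m. r i *\<^sub>R y i) (\<Sum>j<n. s j *\<^sub>R z j) = (\<Sum>i<m. r i * g q (y i) (\<Sum>j<n. s j *\<^sub>R z j))"
    using assms by (intro g_sum_left T_sum) auto
  also have "\<dots> = (\<Sum>i<m. r i * (\<Sum>j<n. s j * g q (y i) (z j)))"
    by (rule sum.cong[OF refl]) (use assms in \<open>simp add: g_sum_right\<close>)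
  finally show ?thesis by (simp add: sum_distrib_left mult.assoc)
qed

lemma field_smooth: "vector_field Q X \<Longrightarrow> smooth_map Q X"
  and field_T: "vector_field Q X \<Longrightarrow> q \<in> Q \<Longrightarrow> X q \<in> T q"
  by (auto simp: vector_field_def)

lemma field_zero: "vector_field Q (\<lambda>p. 0)"
  by (simp add: vector_field_def smooth_map_const)

lemma field_sum:
  "(\<And>i. i < m \<Longrightarrow> smooth_map Q (f i)) \<Longrightarrow> (\<And>i. i < m \<Longrightarrow> vector_field Q (E i)) \<Longrightarrow>
   vector_field Q (\<lambda>p. \<Sum>i<(m::nat). f i p *\<^sub>R E i p)"
  unfolding vector_field_def by (auto intro!: smooth_map_sum smooth_map_scaleR T_sum)

lemma field_scale: "smooth_map Q f \<Longrightarrow> vector_field Q X \<Longrightarrow> vector_field Q (\<lambda>p. f p *\<^sub>R X p)"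
  unfolding vector_field_def by (auto intro!: smooth_map_scaleR T_scale)

lemma g_smooth: "smooth_map {(q, u, w). q \<in> Q \<and> u \<in> T q \<and> w \<in> T q} (\<lambda>(q, u, w). g q u w)"
  using metric unfolding riemannian_metric_def by (elim conjE)

lemma g_field_smooth:
  assumes "vector_field Q Y" "vector_field Q Z"
  shows "smooth_map Q (\<lambda>p. g p (Y p) (Z p))"
proof -
  have "smooth_map Q (\<lambda>p. (p, Y p, Z p))"
    by (intro smooth_map_Pair smooth_map_ident field_smooth assms)
  from smooth_map_compose[OF g_smooth this] show ?thesis using assms by (simp add: field_T)
qed

section \<open>Rules for the connection and its pointwise dependence on the direction\<close>

lemma nabla_field: "vector_field Q X \<Longrightarrow> vector_field Q Y \<Longrightarrow> vector_field Q (nabla X Y)"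
  using connection unfolding levi_civita_connection_def affine_connection_def by simp

lemma nabla_add_left: "vector_field Q X \<Longrightarrow> vector_field Q X' \<Longrightarrow> vector_field Q Y \<Longrightarrow> q \<in> Q \<Longrightarrow>
    nabla (\<lambda>p. X p + X' p) Y q = nabla X Y q + nabla X' Y q"
  using connection unfolding levi_civita_connection_def affine_connection_def by simp

lemma nabla_scale_left: "smooth_map Q f \<Longrightarrow> vector_field Q X \<Longrightarrow> vector_field Q Y \<Longrightarrow> q \<in> Q \<Longrightarrow>
    nabla (\<lambda>p. f p *\<^sub>R X p) Y q = f q *\<^sub>R nabla X Y q"
  using connection unfolding levi_civita_connection_def affine_connection_def by simp

lemma nabla_compatible: "vector_field Q X \<Longrightarrow> vector_field Q Y \<Longrightarrow> vector_field Q Z \<Longrightarrow> q \<in> Q \<Longrightarrow>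
    differential Q (\<lambda>p. g p (Y p) (Z p)) q (X q) = g q (nabla X Y q) (Z q) + g q (Y q) (nabla X Z q)"
  using connection unfolding levi_civita_connection_def by simp

text \<open>Fields are total functions, so a connection could a priori depend on their values off \<open>Q\<close>; the
  smooth function that is \<open>1\<close> on \<open>Q\<close> and \<open>0\<close> elsewhere shows that it does not.\<close>

lemma nabla_cong_left:
  assumes X: "vector_field Q X" and X': "vector_field Q X'" and Y: "vector_field Q Y" and q: "q \<in> Q"
    and eq: "\<And>p. p \<in> Q \<Longrightarrow> X p = X' p"
  shows "nabla X Y q = nabla X' Y q"
proof -
  define f where "f p = (if p \<in> Q then 1 else 0 :: real)" for p
  have f: "smooth_map Q f"
    by (rule smooth_map_cong[OF smooth_map_const[of Q 1]]) (simp add: f_def)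
  have "(\<lambda>p. f p *\<^sub>R X p) = (\<lambda>p. f p *\<^sub>R X' p)" by (rule ext) (simp add: f_def eq)
  then show ?thesis
    using nabla_scale_left[OF f X Y q] nabla_scale_left[OF f X' Y q] q by (simp add: f_def)
qed

lemma nabla_sum_left:
  assumes "\<And>i. i < m \<Longrightarrow> smooth_map Q (f i)" "\<And>i. i < m \<Longrightarrow> vector_field Q (E i)" "vector_field Q Y" "q \<in> Q"
  shows "nabla (\<lambda>p. \<Sum>i<(m::nat). f i p *\<^sub>R E i p) Y q = (\<Sum>i<m. f i q *\<^sub>R nabla (E i) Y q)"
  using assms(1,2)
proof (induction m)
  case 0
  show ?case using nabla_scale_left[OF smooth_map_const[of Q 0] field_zero assms(3,4)] by simp
next
  case (Suc m)
  have "nabla (\<lambda>p. (\<Sum>i<m. f i p *\<^sub>R E i p) + f m p *\<^sub>R E m p) Y q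
      = nabla (\<lambda>p. \<Sum>i<m. f i p *\<^sub>R E i p) Y q + nabla (\<lambda>p. f m p *\<^sub>R E m p) Y q"
    by (rule nabla_add_left) (use Suc.prems assms in \<open>auto intro!: field_sum field_scale\<close>)
  also have "nabla (\<lambda>p. f m p *\<^sub>R E m p) Y q = f m q *\<^sub>R nabla (E m) Y q"
    by (rule nabla_scale_left) (use Suc.prems assms in auto)
  finally show ?case using Suc by simp
qed

text \<open>At \<open>q\<close> the field may be multiplied by \<open>\<rho>\<close>, which is 1
  there, and \<open>\<rho> X\<close> is on \<open>Q\<close> a combination of global frame fields
  with coefficients smooth on all of \<open>Q\<close>.\<close>

lemma nabla_frame:
  assumes fr: "moving_frame Q N k E c \<rho> W \<xi> e" and q: "q \<in> N" "q \<in> Q"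
    and X: "vector_field Q X" and Y: "vector_field Q Y"
  shows "nabla X Y q = (\<Sum>i<k. c i q (X q) *\<^sub>R nabla (E i) Y q)"
proof -
  interpret moving_frame Q N k E c \<rho> W \<xi> e by (rule fr)
  from frame_cutoff[OF X] obtain f where f0: "(\<forall>i<k. smooth_map Q (f i)) \<and>
      (\<forall>i<k. \<forall>q\<in>N \<inter> Q. f i q = c i q (X q)) \<and> (\<forall>q\<in>Q. \<rho> q *\<^sub>R X q = (\<Sum>i<k. f i q *\<^sub>R E i q))"
    by (elim exE)
  then have f: "\<And>i. i < k \<Longrightarrow> smooth_map Q (f i)" "\<And>i. i < k \<Longrightarrow> f i q = c i q (X q)"
    "\<And>q. q \<in> Q \<Longrightarrow> \<rho> q *\<^sub>R X q = (\<Sum>i<k. f i q *\<^sub>R E i q)"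
    using q by simp_all
  have "nabla X Y q = nabla (\<lambda>p. \<rho> p *\<^sub>R X p) Y q"
    using nabla_scale_left[OF rho_smooth X Y q(2)] rho_1[OF q] by simp
  also have "\<dots> = nabla (\<lambda>p. \<Sum>i<k. f i p *\<^sub>R E i p) Y q"
    by (rule nabla_cong_left) (intro field_scale rho_smooth X field_sum f E_field Y q; assumption)+
  also have "\<dots> = (\<Sum>i<k. f i q *\<^sub>R nabla (E i) Y q)"
    by (rule nabla_sum_left) (intro f E_field Y q; assumption)+
  finally show ?thesis using f(2) by simp
qed

text \<open>\<open>has_covariant_derivative\<close> lets the velocity be extended to a field in any
  way; the frame expansion shows that all extensions of the same velocity give the same
  result.\<close>

lemma nabla_tensorial:
  assumes q: "q \<in> Q" and X: "vector_field Q X" "vector_field Q X'" and Y: "vector_field Q Y" and eq: "X q = X' q"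
  shows "nabla X Y q = nabla X' Y q"
proof -
  obtain N k E c \<rho> W \<xi> e y0 where fr: "moving_frame Q N k E c \<rho> W \<xi> e" "q \<in> N"
    by (rule obtain_moving_frame[OF embedded q])
  show ?thesis using nabla_frame[OF fr q X(1) Y] nabla_frame[OF fr q X(2) Y] eq by simp
qed

section \<open>Product rule and uniqueness for covariant derivatives along curves\<close>

lemma has_covE:
  assumes "has_covariant_derivative Q nabla \<gamma> w a t"
  obtains X and m :: nat and E c c' where "vector_field Q X" "(\<gamma> has_vector_derivative X (\<gamma> t)) (at t)"
    "\<forall>i<m. vector_field Q (E i)" "\<forall>i<m. (c i has_real_derivative c' i) (at t)"
    "\<forall>\<^sub>F s in nhds t. w s = (\<Sum>i<m. c i s *\<^sub>R E i (\<gamma> s))"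
    "a = (\<Sum>i<m. c' i *\<^sub>R E i (\<gamma> t) + c i t *\<^sub>R nabla X (E i) (\<gamma> t))"
proof -
  from assms obtain X and m :: nat and E c c' where *: "vector_field Q X \<and> (\<gamma> has_vector_derivative X (\<gamma> t)) (at t) \<and>
        (\<forall>i<m. vector_field Q (E i) \<and> (c i has_real_derivative c' i) (at t)) \<and>
        (\<forall>\<^sub>F s in nhds t. w s = (\<Sum>i<m. c i s *\<^sub>R E i (\<gamma> s))) \<and>
        a = (\<Sum>i<m. c' i *\<^sub>R E i (\<gamma> t) + c i t *\<^sub>R nabla X (E i) (\<gamma> t))"
    unfolding has_covariant_derivative_def by (elim exE)
  show ?thesis by (rule that[of X m E c c']) (use * in \<open>simp_all\<close>)
qed

text \<open>After expansion in the two representations the function is a double sum of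
  \<open>c i * d j * G i j\<close>. Compatibility of the connection with the metric gives the
  derivative of \<open>G i j\<close> along the curve; the four resulting sums regroup into the two
  inner products.\<close>

lemma has_cov_metric:
  assumes w: "has_covariant_derivative Q nabla \<gamma> w a t" and z: "has_covariant_derivative Q nabla \<gamma> z b t"
    and ev: "\<forall>\<^sub>F s in nhds t. \<gamma> s \<in> Q"
  shows "((\<lambda>s. g (\<gamma> s) (w s) (z s)) has_real_derivative g (\<gamma> t) a (z t) + g (\<gamma> t) (w t) b) (at t)"
proof -
  have Qt: "\<gamma> t \<in> Q" using eventually_nhds_x_imp_x[OF ev] .
  obtain X and m :: nat and E c c' where X: "vector_field Q X" "(\<gamma> has_vector_derivative X (\<gamma> t)) (at t)"
    and E': "\<forall>i<m. vector_field Q (E i)" and c': "\<forall>i<m. (c i has_real_derivative c' i) (at t)"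
    and ew: "\<forall>\<^sub>F s in nhds t. w s = (\<Sum>i<m. c i s *\<^sub>R E i (\<gamma> s))"
    and a: "a = (\<Sum>i<m. c' i *\<^sub>R E i (\<gamma> t) + c i t *\<^sub>R nabla X (E i) (\<gamma> t))"
    using has_covE[OF w] .
  obtain Y and n :: nat and F d d' where Y: "vector_field Q Y" "(\<gamma> has_vector_derivative Y (\<gamma> t)) (at t)"
    and F': "\<forall>i<n. vector_field Q (F i)" and d': "\<forall>i<n. (d i has_real_derivative d' i) (at t)"
    and ez: "\<forall>\<^sub>F s in nhds t. z s = (\<Sum>i<n. d i s *\<^sub>R F i (\<gamma> s))"
    and b: "b = (\<Sum>i<n. d' i *\<^sub>R F i (\<gamma> t) + d i t *\<^sub>R nabla Y (F i) (\<gamma> t))"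
    using has_covE[OF z] .
  note E = E'[rule_format] and c = c'[rule_format] and F = F'[rule_format] and d = d'[rule_format]
  \<comment> \<open>The representations of \<open>w\<close> and \<open>z\<close> may use different
    extensions of the velocity; from here on \<open>X\<close> serves both.\<close>
  have XY: "X (\<gamma> t) = Y (\<gamma> t)" using vector_derivative_unique_at X(2) Y(2) by metis
  have nF: "nabla Y (F j) (\<gamma> t) = nabla X (F j) (\<gamma> t)" if "j < n" for j
    by (rule nabla_tensorial[OF Qt Y(1) X(1) F[OF that] XY[symmetric]])
  define G where "G i j s = g (\<gamma> s) (E i (\<gamma> s)) (F j (\<gamma> s))" for i j s
  define A where "A i j = g (\<gamma> t) (nabla X (E i) (\<gamma> t)) (F j (\<gamma> t))" for i j
  define B where "B i j = g (\<gamma> t) (E i (\<gamma> t)) (nabla X (F j) (\<gamma> t))" for i j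
  have dG: "(G i j has_real_derivative A i j + B i j) (at t)" if "i < m" "j < n" for i j
    using differential_along_curve[OF g_field_smooth[OF E[OF that(1)] F[OF that(2)]] ev X(2)]
      nabla_compatible[OF X(1) E[OF that(1)] F[OF that(2)] Qt]
    by (simp add: G_def[abs_def] A_def B_def)
  have rep: "\<forall>\<^sub>F s in nhds t. g (\<gamma> s) (w s) (z s) = (\<Sum>i<m. \<Sum>j<n. c i s * d j s * G i j s)"
    using ew ez ev
  proof eventually_elim
    case (elim s)
    then show ?case using E F by (simp add: g_sum_sum field_T G_def)
  qed
  have "((\<lambda>s. \<Sum>i<m. \<Sum>j<n. c i s * d j s * G i j s) has_real_derivative
      (\<Sum>i<m. \<Sum>j<n. (c' i * d j t + d' j * c i t) * G i j t + (A i j + B i j) * (c i t * d j t))) (at t)"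
    by (intro DERIV_sum DERIV_mult c d dG) auto
  also have "(\<Sum>i<m. \<Sum>j<n. (c' i * d j t + d' j * c i t) * G i j t + (A i j + B i j) * (c i t * d j t))
    = ((\<Sum>i<m. \<Sum>j<n. c' i * d j t * G i j t) + (\<Sum>i<m. \<Sum>j<n. c i t * d j t * A i j))
      + ((\<Sum>i<m. \<Sum>j<n. c i t * d' j * G i j t) + (\<Sum>i<m. \<Sum>j<n. c i t * d j t * B i j))"
    by (simp add: sum.distrib[symmetric] algebra_simps)
  also have "(\<Sum>i<m. \<Sum>j<n. c' i * d j t * G i j t) + (\<Sum>i<m. \<Sum>j<n. c i t * d j t * A i j) = g (\<gamma> t) a (z t)"
  proof -
    have "z t = (\<Sum>j<n. d j t *\<^sub>R F j (\<gamma> t))" using eventually_nhds_x_imp_x[OF ez] .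
    moreover have "a = (\<Sum>i<m. c' i *\<^sub>R E i (\<gamma> t)) + (\<Sum>i<m. c i t *\<^sub>R nabla X (E i) (\<gamma> t))"
      by (simp add: a sum.distrib)
    moreover have "g (\<gamma> t) ((\<Sum>i<m. c' i *\<^sub>R E i (\<gamma> t)) + (\<Sum>i<m. c i t *\<^sub>R nabla X (E i) (\<gamma> t))) (\<Sum>j<n. d j t *\<^sub>R F j (\<gamma> t))
      = g (\<gamma> t) (\<Sum>i<m. c' i *\<^sub>R E i (\<gamma> t)) (\<Sum>j<n. d j t *\<^sub>R F j (\<gamma> t))
      + g (\<gamma> t) (\<Sum>i<m. c i t *\<^sub>R nabla X (E i) (\<gamma> t)) (\<Sum>j<n. d j t *\<^sub>R F j (\<gamma> t))"
      by (intro g_add_left Qt T_sum field_T nabla_field E F X(1)) auto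
    moreover have "g (\<gamma> t) (\<Sum>i<m. c' i *\<^sub>R E i (\<gamma> t)) (\<Sum>j<n. d j t *\<^sub>R F j (\<gamma> t)) = (\<Sum>i<m. \<Sum>j<n. c' i * d j t * G i j t)"
      unfolding G_def by (intro g_sum_sum Qt field_T E F)
    moreover have "g (\<gamma> t) (\<Sum>i<m. c i t *\<^sub>R nabla X (E i) (\<gamma> t)) (\<Sum>j<n. d j t *\<^sub>R F j (\<gamma> t)) = (\<Sum>i<m. \<Sum>j<n. c i t * d j t * A i j)"
      unfolding A_def by (intro g_sum_sum Qt field_T nabla_field X(1) E F)
    ultimately show ?thesis by simp
  qed
  also have "(\<Sum>i<m. \<Sum>j<n. c i t * d' j * G i j t) + (\<Sum>i<m. \<Sum>j<n. c i t * d j t * B i j) = g (\<gamma> t) (w t) b"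
  proof -
    have "w t = (\<Sum>i<m. c i t *\<^sub>R E i (\<gamma> t))" using eventually_nhds_x_imp_x[OF ew] .
    moreover have "b = (\<Sum>j<n. d' j *\<^sub>R F j (\<gamma> t)) + (\<Sum>j<n. d j t *\<^sub>R nabla X (F j) (\<gamma> t))"
      by (simp add: b sum.distrib nF)
    moreover have "g (\<gamma> t) (\<Sum>i<m. c i t *\<^sub>R E i (\<gamma> t)) ((\<Sum>j<n. d' j *\<^sub>R F j (\<gamma> t)) + (\<Sum>j<n. d j t *\<^sub>R nabla X (F j) (\<gamma> t)))
      = g (\<gamma> t) (\<Sum>i<m. c i t *\<^sub>R E i (\<gamma> t)) (\<Sum>j<n. d' j *\<^sub>R F j (\<gamma> t))
      + g (\<gamma> t) (\<Sum>i<m. c i t *\<^sub>R E i (\<gamma> t)) (\<Sum>j<n. d j t *\<^sub>R nabla X (F j) (\<gamma> t))"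
      by (intro g_add_right Qt T_sum field_T nabla_field E F X(1)) auto
    moreover have "g (\<gamma> t) (\<Sum>i<m. c i t *\<^sub>R E i (\<gamma> t)) (\<Sum>j<n. d' j *\<^sub>R F j (\<gamma> t)) = (\<Sum>i<m. \<Sum>j<n. c i t * d' j * G i j t)"
      unfolding G_def by (intro g_sum_sum Qt field_T E F)
    moreover have "g (\<gamma> t) (\<Sum>i<m. c i t *\<^sub>R E i (\<gamma> t)) (\<Sum>j<n. d j t *\<^sub>R nabla X (F j) (\<gamma> t)) = (\<Sum>i<m. \<Sum>j<n. c i t * d j t * B i j)"
      unfolding B_def by (intro g_sum_sum Qt field_T nabla_field X(1) E F)
    ultimately show ?thesis by simp
  qed
  finally show ?thesis
    using DERIV_cong_ev[OF refl rep refl] by blast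
qed

text \<open>One summand with constant coefficient 1. This supplies test fields with known covariant
  derivative for the product rule.\<close>

lemma has_cov_field:
  assumes X: "vector_field Q X" "(\<gamma> has_vector_derivative X (\<gamma> t)) (at t)" and Z: "vector_field Q Z"
  shows "has_covariant_derivative Q nabla \<gamma> (\<lambda>s. Z (\<gamma> s)) (nabla X Z (\<gamma> t)) t"
  unfolding has_covariant_derivative_def
  by (rule exI[of _ X], rule exI[of _ 1], rule exI[of _ "\<lambda>i. Z"], rule exI[of _ "\<lambda>i s. 1"], rule exI[of _ "\<lambda>i. 0"])
    (use assms in simp)

lemma has_cov_T:
  assumes w: "has_covariant_derivative Q nabla \<gamma> w a t" and Qt: "\<gamma> t \<in> Q"
  shows "a \<in> T (\<gamma> t)"
proof -
  obtain X and m :: nat and E c c' where X: "vector_field Q X" "(\<gamma> has_vector_derivative X (\<gamma> t)) (at t)"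
    and E: "\<forall>i<m. vector_field Q (E i)" and c: "\<forall>i<m. (c i has_real_derivative c' i) (at t)"
    and ew: "\<forall>\<^sub>F s in nhds t. w s = (\<Sum>i<m. c i s *\<^sub>R E i (\<gamma> s))"
    and a: "a = (\<Sum>i<m. c' i *\<^sub>R E i (\<gamma> t) + c i t *\<^sub>R nabla X (E i) (\<gamma> t))"
    using has_covE[OF w] .
  have "c' i *\<^sub>R E i (\<gamma> t) + c i t *\<^sub>R nabla X (E i) (\<gamma> t) \<in> T (\<gamma> t)" if "i < m" for i
    using E that by (intro T_add T_scale Qt field_T nabla_field X(1)) auto
  then show ?thesis unfolding a by (intro subspace_sum sub_T Qt) auto
qed

lemma has_cov_velocity:
  assumes w: "has_covariant_derivative Q nabla \<gamma> w a t"
  obtains X where "vector_field Q X" "(\<gamma> has_vector_derivative X (\<gamma> t)) (at t)"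
proof -
  obtain X and m :: nat and E c c' where X: "vector_field Q X" "(\<gamma> has_vector_derivative X (\<gamma> t)) (at t)"
    and E: "\<forall>i<m. vector_field Q (E i)" and c: "\<forall>i<m. (c i has_real_derivative c' i) (at t)"
    and ew: "\<forall>\<^sub>F s in nhds t. w s = (\<Sum>i<m. c i s *\<^sub>R E i (\<gamma> s))"
    and a: "a = (\<Sum>i<m. c' i *\<^sub>R E i (\<gamma> t) + c i t *\<^sub>R nabla X (E i) (\<gamma> t))"
    using has_covE[OF w] .
  show ?thesis by (rule that[OF X])
qed

text \<open>Independence of the representation: the product rule determines \<open>g a z\<close> for every tangent vector \<open>z\<close>.\<close>

lemma has_cov_unique:
  assumes w: "has_covariant_derivative Q nabla \<gamma> w a t" "has_covariant_derivative Q nabla \<gamma> w b t"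
    and ev: "\<forall>\<^sub>F s in nhds t. \<gamma> s \<in> Q"
  shows "a = b"
proof -
  have Qt: "\<gamma> t \<in> Q" using eventually_nhds_x_imp_x[OF ev] .
  obtain N k E c \<rho> W \<xi> e y0 where fr: "moving_frame Q N k E c \<rho> W \<xi> e" "\<gamma> t \<in> N"
    by (rule obtain_moving_frame[OF embedded Qt])
  interpret moving_frame Q N k E c \<rho> W \<xi> e by (rule fr)
  obtain X where X: "vector_field Q X" "(\<gamma> has_vector_derivative X (\<gamma> t)) (at t)"
    using has_cov_velocity[OF w(1)] .
  have ab: "a \<in> T (\<gamma> t)" "b \<in> T (\<gamma> t)" using has_cov_T w Qt by blast+
  have d: "a - b \<in> T (\<gamma> t)" by (rule T_diff[OF Qt ab])
  \<comment> \<open>Constant coefficients suffice to extend the tangent vector \<open>a - b\<close>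
    to a global field.\<close>
  define Z where "Z p = (\<Sum>i<k. c i (\<gamma> t) (a - b) *\<^sub>R E i p)" for p
  have Z: "vector_field Q Z" unfolding Z_def by (rule field_sum) (intro smooth_map_const E_field; assumption)+
  have Zt: "Z (\<gamma> t) = a - b" unfolding Z_def by (rule frame_expand[OF fr(2) Qt d])
  have "g (\<gamma> t) a (Z (\<gamma> t)) + g (\<gamma> t) (w t) (nabla X Z (\<gamma> t)) = g (\<gamma> t) b (Z (\<gamma> t)) + g (\<gamma> t) (w t) (nabla X Z (\<gamma> t))"
    using has_cov_metric[OF w(1) has_cov_field[OF X Z] ev] has_cov_metric[OF w(2) has_cov_field[OF X Z] ev]
    by (rule DERIV_unique)
  then have "g (\<gamma> t) (a - b) (a - b) = 0"
    using g_diff_left[OF Qt d ab] by (simp add: Zt)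
  then show ?thesis using g_pos[OF Qt d] by force
qed

end

section \<open>Covariant and ambient derivatives in a frame\<close>

lemma has_vector_derivative_cong_nhds:
  assumes ev: "\<forall>\<^sub>F s in nhds t. f s = h s"
  shows "(f has_vector_derivative d) (at t) \<longleftrightarrow> (h has_vector_derivative d) (at t)"
  using eventually_nhds_x_imp_x[OF ev] ev by (intro has_vector_derivative_cong_ev) auto

context levi_civita_manifold
begin

text \<open>The ambient minus the covariant derivative of a field with value \<open>w\<close> along
  a curve with velocity \<open>v\<close>. The derivatives of the coefficients cancel, and each frame
  field contributes its ambient derivative along \<open>v\<close> minus its covariant one. Since
  \<open>c\<close> supplies all coefficients, only \<open>q\<close>, \<open>v\<close> and
  \<open>w\<close> enter.\<close>

definition christoffel :: "nat \<Rightarrow> (nat \<Rightarrow> 'a \<Rightarrow> 'a) \<Rightarrow> (nat \<Rightarrow> 'a \<Rightarrow> 'a \<Rightarrow> real) \<Rightarrow> 'a \<Rightarrow> 'a \<Rightarrow> 'a \<Rightarrow> 'a" where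
  "christoffel k E c q v w =
    (\<Sum>i<k. c i q w *\<^sub>R (frechet_derivative (E i) (at q) v - (\<Sum>j<k. c j q v *\<^sub>R nabla (E j) (E i) q)))"

text \<open>The coefficients \<open>c i (\<gamma> s) (w s)\<close> are differentiable by joint
  smoothness of \<open>c\<close>. Computing \<open>w'\<close> from the frame representation
  expresses the sum of the \<open>u' i *\<^sub>R E i (\<gamma> t)\<close> by \<open>w'\<close>, and
  the remaining terms form \<open>christoffel\<close>.\<close>

lemma has_cov_of_derivative:
  assumes fr: "moving_frame Q N k E c \<rho> W \<xi> e" and N: "\<gamma> t \<in> N"
    and evQ: "\<forall>\<^sub>F s in nhds t. \<gamma> s \<in> Q" and evT: "\<forall>\<^sub>F s in nhds t. w s \<in> T (\<gamma> s)"
    and \<gamma>: "(\<gamma> has_vector_derivative v) (at t)" and v: "v \<in> T (\<gamma> t)"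
    and w: "(w has_vector_derivative w') (at t)"
  shows "has_covariant_derivative Q nabla \<gamma> w (w' - christoffel k E c (\<gamma> t) v (w t)) t"
proof -
  interpret moving_frame Q N k E c \<rho> W \<xi> e by (rule fr)
  have Qt: "\<gamma> t \<in> Q" using eventually_nhds_x_imp_x[OF evQ] .
  define u where "u i s = c i (\<gamma> s) (w s)" for i s
  define u' where "u' i = frechet_derivative (\<lambda>z. c i (fst z) (snd z)) (at (\<gamma> t, w t)) (v, w')" for i
  have u: "(u i has_vector_derivative u' i) (at t)" if "i < k" for i
  proof -
    have "(\<gamma> t, w t) \<in> N \<times> UNIV" using N by simp
    note d = smooth_on_has_derivative[OF c_smooth[OF that] this]
    have "((\<lambda>s. (\<gamma> s, w s)) has_vector_derivative (v, w')) (at t)"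
      by (rule has_vector_derivative_Pair[OF \<gamma> w])
    from has_vector_derivative_compose_at[OF d refl this] show ?thesis
      by (simp add: u_def[abs_def] u'_def)
  qed
  have Ed: "((\<lambda>s. E i (\<gamma> s)) has_vector_derivative frechet_derivative (E i) (at (\<gamma> t)) v) (at t)" if "i < k" for i
    by (rule has_vector_derivative_compose_at[OF smooth_on_has_derivative[OF E_smooth[OF that] UNIV_I] refl \<gamma>])
  have evN: "\<forall>\<^sub>F s in nhds t. \<gamma> s \<in> N"
    by (rule has_vector_derivative_eventually_in_open[OF \<gamma> open_N N])
  have rep: "\<forall>\<^sub>F s in nhds t. w s = (\<Sum>i<k. u i s *\<^sub>R E i (\<gamma> s))"
    using evQ evT evN by eventually_elim (simp add: u_def frame_expand)
  have "((\<lambda>s. \<Sum>i<k. u i s *\<^sub>R E i (\<gamma> s)) has_vector_derivative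
      (\<Sum>i<k. u i t *\<^sub>R frechet_derivative (E i) (at (\<gamma> t)) v + u' i *\<^sub>R E i (\<gamma> t))) (at t)"
    by (intro has_vector_derivative_sum has_vector_derivative_scaleR Ed)
      (use u in \<open>auto simp: has_real_derivative_iff_has_vector_derivative\<close>)
  moreover have "((\<lambda>s. \<Sum>i<k. u i s *\<^sub>R E i (\<gamma> s)) has_vector_derivative w') (at t)"
    using has_vector_derivative_cong_nhds[OF rep] w by blast
  ultimately have w'_eq: "(\<Sum>i<k. u i t *\<^sub>R frechet_derivative (E i) (at (\<gamma> t)) v + u' i *\<^sub>R E i (\<gamma> t)) = w'"
    by (rule vector_derivative_unique_at)
  define X where "X p = (\<Sum>j<k. c j (\<gamma> t) v *\<^sub>R E j p)" for p
  have X: "vector_field Q X" unfolding X_def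
    by (rule field_sum) (intro smooth_map_const E_field; assumption)+
  have Xt: "X (\<gamma> t) = v" unfolding X_def by (rule frame_expand[OF N Qt v])
  have nX: "nabla X (E i) (\<gamma> t) = (\<Sum>j<k. c j (\<gamma> t) v *\<^sub>R nabla (E j) (E i) (\<gamma> t))" if "i < k" for i
    unfolding X_def[abs_def] by (rule nabla_sum_left) (intro smooth_map_const E_field that Qt; assumption)+
  have "w' - christoffel k E c (\<gamma> t) v (w t) = (\<Sum>i<k. u' i *\<^sub>R E i (\<gamma> t) + u i t *\<^sub>R nabla X (E i) (\<gamma> t))"
    unfolding christoffel_def w'_eq[symmetric] by (simp add: sum_subtractf[symmetric] u_def nX algebra_simps)
  then show ?thesis
    unfolding has_covariant_derivative_def
    using X \<gamma> Xt E_field u rep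
    by (intro exI[of _ X] exI[of _ k] exI[of _ E] exI[of _ u] exI[of _ u'])
      (simp add: has_real_derivative_iff_has_vector_derivative)
qed

text \<open>The representing fields are smooth merely on \<open>Q\<close>, hence the chain rule
  within \<open>Q\<close>.\<close>

lemma has_cov_differentiable:
  assumes w: "has_covariant_derivative Q nabla \<gamma> w a t" and evQ: "\<forall>\<^sub>F s in nhds t. \<gamma> s \<in> Q"
  shows "\<exists>w'. (w has_vector_derivative w') (at t)"
proof -
  obtain X and m :: nat and E c c' where X: "vector_field Q X" "(\<gamma> has_vector_derivative X (\<gamma> t)) (at t)"
    and E: "\<forall>i<m. vector_field Q (E i)" and c: "\<forall>i<m. (c i has_real_derivative c' i) (at t)"
    and ew: "\<forall>\<^sub>F s in nhds t. w s = (\<Sum>i<m. c i s *\<^sub>R E i (\<gamma> s))"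
    and a: "a = (\<Sum>i<m. c' i *\<^sub>R E i (\<gamma> t) + c i t *\<^sub>R nabla X (E i) (\<gamma> t))"
    using has_covE[OF w] .
  define D where "D i = frechet_derivative (E i) (at (\<gamma> t) within Q) (X (\<gamma> t))" for i
  have Ed: "((\<lambda>s. E i (\<gamma> s)) has_vector_derivative D i) (at t)" if "i < m" for i
    unfolding D_def using E that by (intro smooth_map_along_curve evQ X field_smooth) auto
  have "((\<lambda>s. \<Sum>i<m. c i s *\<^sub>R E i (\<gamma> s)) has_vector_derivative
      (\<Sum>i<m. c i t *\<^sub>R D i + c' i *\<^sub>R E i (\<gamma> t))) (at t)"
    by (intro has_vector_derivative_sum has_vector_derivative_scaleR Ed) (use c in auto)
  then have "(w has_vector_derivative (\<Sum>i<m. c i t *\<^sub>R D i + c' i *\<^sub>R E i (\<gamma> t))) (at t)"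
    using has_vector_derivative_cong_nhds[OF ew] by blast
  then show ?thesis by blast
qed

text \<open>Turns a covariant equation into an ordinary one: uniqueness compares a given covariant
  derivative with the one obtained from the ambient derivative.\<close>

lemma has_cov_iff:
  assumes fr: "moving_frame Q N k E c \<rho> W \<xi> e" and N: "\<gamma> t \<in> N"
    and evQ: "\<forall>\<^sub>F s in nhds t. \<gamma> s \<in> Q" and evT: "\<forall>\<^sub>F s in nhds t. w s \<in> T (\<gamma> s)"
    and \<gamma>: "(\<gamma> has_vector_derivative v) (at t)" and v: "v \<in> T (\<gamma> t)"
  shows "has_covariant_derivative Q nabla \<gamma> w a t \<longleftrightarrow>
    (w has_vector_derivative a + christoffel k E c (\<gamma> t) v (w t)) (at t)"
proof
  assume a: "has_covariant_derivative Q nabla \<gamma> w a t"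
  then obtain w' where w': "(w has_vector_derivative w') (at t)"
    using has_cov_differentiable evQ by metis
  have "a = w' - christoffel k E c (\<gamma> t) v (w t)"
    by (rule has_cov_unique[OF a has_cov_of_derivative[OF fr N evQ evT \<gamma> v w'] evQ])
  then show "(w has_vector_derivative a + christoffel k E c (\<gamma> t) v (w t)) (at t)" using w' by simp
next
  assume "(w has_vector_derivative a + christoffel k E c (\<gamma> t) v (w t)) (at t)"
  from has_cov_of_derivative[OF fr N evQ evT \<gamma> v this]
  show "has_covariant_derivative Q nabla \<gamma> w a t" by simp
qed

lemma christoffel_continuous:
  assumes fr: "moving_frame Q N k E c \<rho> W \<xi> e"
  shows "continuous_on {z. fst z \<in> N \<inter> Q} (\<lambda>z. christoffel k E c (fst z) (fst (snd z)) (snd (snd z)))"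
proof -
  interpret moving_frame Q N k E c \<rho> W \<xi> e by (rule fr)
  let ?A = "{z :: 'a \<times> 'a \<times> 'a. fst z \<in> N \<inter> Q}"
  have c: "continuous_on ?A (\<lambda>z. c i (fst z) (h (snd z)))" if "i < k" "continuous_on UNIV h" for i h
  proof -
    have "continuous_on ?A (\<lambda>z. (fst z, h (snd z)))"
      by (intro continuous_on_Pair continuous_on_fst continuous_on_id continuous_on_compose2[OF that(2)]
          continuous_on_snd) auto
    from continuous_on_compose2[OF smooth_on_continuous[OF c_smooth[OF that(1)]] this]
    show ?thesis by auto
  qed
  have D: "continuous_on ?A (\<lambda>z. frechet_derivative (E i) (at (fst z)) (fst (snd z)))" if "i < k" for i
  proof -
    have "smooth_on UNIV (\<lambda>z::'a \<times> 'a \<times> 'a. frechet_derivative (E i) (at (fst z)) (fst (snd z)))"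
      by (rule smooth_on_frechet_derivative[OF E_smooth[OF that]])
        (auto intro!: smooth_on_bounded_linear bounded_linear_fst
          bounded_linear_compose[OF bounded_linear_fst bounded_linear_snd])
    then show ?thesis using continuous_on_subset[OF smooth_on_continuous] by blast
  qed
  have n: "continuous_on ?A (\<lambda>z. nabla (E j) (E i) (fst z))" if "i < k" "j < k" for i j
    by (rule continuous_on_compose2[OF smooth_map_continuous_on[OF field_smooth[OF nabla_field[OF E_field E_field]]]])
      (use that in \<open>auto intro: continuous_intros\<close>)
  show ?thesis
    unfolding christoffel_def
    by (intro continuous_on_sum continuous_on_scaleR continuous_on_diff D n c continuous_on_fst
        continuous_on_snd continuous_on_id; simp)
qed

subsection \<open>Gradients\<close>

text \<open>The Gram operator of the metric on \<open>T q\<close> is extended by the identity on the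
  orthogonal complement to a linear map \<open>A\<close> of the whole space. Positivity makes it
  injective, hence it is surjective for reasons of dimension.\<close>

lemma metric_riesz:
  assumes q: "q \<in> Q" and f: "linear f"
  shows "\<exists>w\<in>T q. \<forall>v\<in>T q. g q w v = f v"
proof (rule orthonormal_enumeration[OF sub_T[OF q]])
  fix k and e :: "nat \<Rightarrow> 'a" assume eT: "\<And>i. i < k \<Longrightarrow> e i \<in> T q"
    and eo: "\<And>i j. i < k \<Longrightarrow> j < k \<Longrightarrow> e i \<bullet> e j = (if i = j then 1 else 0)"
    and ex: "\<And>x. x \<in> T q \<Longrightarrow> (\<Sum>i<k. (x \<bullet> e i) *\<^sub>R e i) = x"
  define P where "P z = (\<Sum>i<k. (z \<bullet> e i) *\<^sub>R e i)" for z
  define A where "A z = (z - P z) + (\<Sum>i<k. g q (P z) (e i) *\<^sub>R e i)" for z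
  have PT: "P z \<in> T q" for z unfolding P_def by (rule T_sum[OF q]) (use eT in auto)
  have Pe: "P z \<bullet> e j = z \<bullet> e j" if "j < k" for z j
    using that by (simp add: P_def inner_sum_left eo if_distrib[of "\<lambda>x. _ * x"] cong: if_cong)
  have Padd: "P (x + y) = P x + P y" for x y by (simp add: P_def algebra_simps sum.distrib)
  have Pscale: "P (r *\<^sub>R x) = r *\<^sub>R P x" for r x by (simp add: P_def scaleR_sum_right)
  have linA: "linear A"
  proof (rule linearI)
    show "A (x + y) = A x + A y" for x y
      by (simp add: A_def Padd g_add_left q PT eT scaleR_add_left sum.distrib)
    show "A (r *\<^sub>R x) = r *\<^sub>R A x" for r x
      by (simp add: A_def Pscale g_scale_left q PT eT scaleR_sum_right algebra_simps)
  qed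
  have Ae: "A z \<bullet> e j = g q (P z) (e j)" if "j < k" for z j
    using that Pe by (simp add: A_def inner_add_left inner_diff_left inner_sum_left eo
        if_distrib[of "\<lambda>x. _ * x"] cong: if_cong)
  have gP: "g q (P z) v = (\<Sum>j<k. (v \<bullet> e j) * (A z \<bullet> e j))" if "v \<in> T q" for z v
  proof -
    have "g q (P z) v = g q (P z) (\<Sum>j<k. (v \<bullet> e j) *\<^sub>R e j)" by (simp only: ex[OF that])
    also have "\<dots> = (\<Sum>j<k. (v \<bullet> e j) * g q (P z) (e j))" by (rule g_sum_right[OF q PT eT])
    finally show ?thesis using Ae by simp
  qed
  have inj: "inj A"
  proof (rule linear_injective_0[OF linA, THEN iffD2], intro allI impI)
    fix z assume z: "A z = 0"
    then have "g q (P z) (P z) = 0" using gP[OF PT, of z z] by simp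
    then have "P z = 0" using g_pos[OF q PT, of z] by force
    moreover have "g q (P z) (e i) = 0" if "i < k" for i using Ae[OF that, of z] z by simp
    ultimately show "z = 0" using z by (simp add: A_def)
  qed
  then obtain z where z: "A z = (\<Sum>i<k. f (e i) *\<^sub>R e i)"
    using linear_injective_imp_surjective[OF linA] by (metis surjD)
  have "g q (P z) v = f v" if "v \<in> T q" for v
  proof -
    have "A z \<bullet> e j = f (e j)" if "j < k" for j
      using that by (simp add: z inner_sum_left eo if_distrib[of "\<lambda>x. _ * x"] cong: if_cong)
    then have "g q (P z) v = (\<Sum>j<k. (v \<bullet> e j) * f (e j))" using gP[OF that] by simp
    also have "\<dots> = f (\<Sum>j<k. (v \<bullet> e j) *\<^sub>R e j)" using f by (simp add: linear_sum linear_scale)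
    finally show ?thesis by (simp only: ex[OF that])
  qed
  then show ?thesis using PT by blast
qed

lemma gradient_props:
  assumes \<psi>: "smooth_map Q \<psi>" and q: "q \<in> Q"
  shows gradient_T: "gradient Q g \<psi> q \<in> T q"
    and g_gradient: "v \<in> T q \<Longrightarrow> g q (gradient Q g \<psi> q) v = differential Q \<psi> q v"
proof -
  let ?P = "\<lambda>w. w \<in> T q \<and> (\<forall>v\<in>T q. g q w v = differential Q \<psi> q v)"
  obtain w where w: "?P w" using metric_riesz[OF q linear_differential[OF \<psi> q]] by blast
  have "w' = w" if w': "?P w'" for w'
  proof -
    have d: "w' - w \<in> T q" using w w' T_diff[OF q] by blast
    have "g q (w' - w) (w' - w) = 0" using g_diff_left[OF q d, of w' w] w w' d by simp
    then show ?thesis using g_pos[OF q d] by force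
  qed
  then have "?P (gradient Q g \<psi> q)" unfolding gradient_def by (rule theI[of ?P, OF w])
  then show "gradient Q g \<psi> q \<in> T q" "v \<in> T q \<Longrightarrow> g q (gradient Q g \<psi> q) v = differential Q \<psi> q v"
    by blast+
qed

lemma g_continuous:
  assumes "continuous_on A q" "continuous_on A u" "continuous_on A v"
    "\<And>x. x \<in> A \<Longrightarrow> q x \<in> Q" "\<And>x. x \<in> A \<Longrightarrow> u x \<in> T (q x)" "\<And>x. x \<in> A \<Longrightarrow> v x \<in> T (q x)"
  shows "continuous_on A (\<lambda>x. g (q x) (u x) (v x))"
proof -
  have "continuous_on A (\<lambda>x. (q x, u x, v x))" by (intro continuous_on_Pair assms)
  from continuous_on_compose2[OF smooth_map_continuous_on[OF g_smooth] this]
  show ?thesis using assms by auto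
qed

text \<open>By homogeneity the minimum over unit tangent vectors based in \<open>C\<close> decides;
  these form a compact set because the tangent bundle is closed.\<close>

lemma g_lower_bound:
  assumes C: "compact C" "C \<subseteq> Q"
  obtains \<mu> where "\<mu> > 0" "\<And>q v. q \<in> C \<Longrightarrow> v \<in> T q \<Longrightarrow> \<mu> * (norm v)\<^sup>2 \<le> g q v v"
proof -
  define K where "K = tangent_bundle Q \<inter> (C \<times> sphere 0 1)"
  have "compact K" unfolding K_def
    by (intro closed_Int_compact closed_tangent_bundle embedded closed_Q compact_Times C compact_sphere)
  have cont: "continuous_on K (\<lambda>z. g (fst z) (snd z) (snd z))"
    by (rule g_continuous) (auto simp: K_def tangent_bundle_def intro: continuous_intros)
  have K: "(q, (1 / norm v) *\<^sub>R v) \<in> K" if "q \<in> C" "v \<in> T q" "v \<noteq> 0" for q v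
    using that C(2) by (auto simp: K_def tangent_bundle_def intro!: T_scale)
  have scale: "g q v v = (norm v)\<^sup>2 * g q ((1 / norm v) *\<^sub>R v) ((1 / norm v) *\<^sub>R v)"
    if "q \<in> C" "v \<in> T q" "v \<noteq> 0" for q v
  proof -
    have q: "q \<in> Q" using that C by auto
    show ?thesis
      using that by (simp only: g_scale_left[OF q T_scale[OF q that(2)] that(2)] g_scale_right[OF q that(2,2)])
        (simp add: power2_eq_square)
  qed
  \<comment> \<open>An empty \<open>K\<close> means that all tangent vectors over \<open>C\<close>
    are 0, and then any constant works.\<close>
  show ?thesis
  proof (cases "K = {}")
    case True
    then have "v = 0" if "q \<in> C" "v \<in> T q" for q v using K[OF that] by auto
    then have "1 * (norm v)\<^sup>2 \<le> g q v v" if "q \<in> C" "v \<in> T q" for q v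
      using that C(2) g_0_right[of q 0] by (metis T_0 mult_zero_right norm_zero order_refl power2_eq_square subsetD)
    then show ?thesis by (intro that[of 1]) simp
  next
    case False
    obtain z where z: "z \<in> K" "\<And>y. y \<in> K \<Longrightarrow> g (fst z) (snd z) (snd z) \<le> g (fst y) (snd y) (snd y)"
      using continuous_attains_inf[OF \<open>compact K\<close> False cont] by blast
    let ?m = "g (fst z) (snd z) (snd z)"
    have pos: "?m > 0"
    proof (rule g_pos)
      show "fst z \<in> Q" "snd z \<in> T (fst z)" "snd z \<noteq> 0"
        using z(1) by (auto simp: K_def tangent_bundle_def)
    qed
    have "?m * (norm v)\<^sup>2 \<le> g q v v" if "q \<in> C" "v \<in> T q" for q v
    proof (cases "v = 0")
      case True
      then show ?thesis using that C(2) g_0_right[of q 0] by auto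
    next
      case False
      have "?m \<le> g q ((1 / norm v) *\<^sub>R v) ((1 / norm v) *\<^sub>R v)" using z(2)[OF K[OF that False]] by simp
      then show ?thesis unfolding scale[OF that False] by (simp add: mult.commute mult_left_mono)
    qed
    with pos show ?thesis using that by blast
  qed
qed

text \<open>Near \<open>p\<close> the gradient is compared with a smooth field \<open>w\<close> that
  agrees with it at \<open>p\<close>. The inner products of the difference with the frame are the
  continuous functions \<open>s i\<close>, which vanish at \<open>p\<close>; the lower bound for the
  metric turns this into smallness of the difference.\<close>

lemma gradient_continuous:
  assumes \<psi>: "smooth_map Q \<psi>"
  shows "continuous_on Q (gradient Q g \<psi>)"
  unfolding continuous_on_def
proof
  fix p assume p: "p \<in> Q"
  let ?G = "gradient Q g \<psi>"
  obtain N k E c \<rho> W \<xi> e y0 where fr: "moving_frame Q N k E c \<rho> W \<xi> e" "p \<in> N"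
    by (rule obtain_moving_frame[OF embedded p])
  interpret moving_frame Q N k E c \<rho> W \<xi> e by (rule fr)
  obtain r where r: "r > 0" "cball p r \<subseteq> N" using open_N fr(2) open_contains_cball by blast
  define C where "C = cball p r \<inter> Q"
  have C: "compact C" "C \<subseteq> Q" "C \<subseteq> N" using r closed_Q by (auto simp: C_def intro: compact_Int_closed)
  obtain \<mu> where \<mu>: "\<mu> > 0" "\<And>q v. q \<in> C \<Longrightarrow> v \<in> T q \<Longrightarrow> \<mu> * (norm v)\<^sup>2 \<le> g q v v"
    using g_lower_bound[OF C(1,2)] by metis
  define w where "w q = (\<Sum>i<k. c i p (?G p) *\<^sub>R E i q)" for q
  have wf: "vector_field Q w" unfolding w_def by (rule field_sum) (intro smooth_map_const E_field; assumption)+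
  have wp: "w p = ?G p" unfolding w_def by (rule frame_expand[OF fr(2) p gradient_T[OF \<psi> p]])
  define d where "d q = ?G q - w q" for q
  have dT: "d q \<in> T q" if "q \<in> Q" for q
    unfolding d_def by (intro T_diff that gradient_T \<psi> field_T[OF wf])
  define s where "s i q = differential Q \<psi> q (E i q) - g q (w q) (E i q)" for i q
  have s_cont: "continuous_on Q (s i)" if "i < k" for i
    unfolding s_def
    by (intro continuous_on_diff smooth_map_continuous_on smooth_map_differential g_field_smooth \<psi> E_field wf that)
  have s_p: "s i p = 0" if "i < k" for i
    unfolding s_def wp using g_gradient[OF \<psi> p field_T[OF E_field[OF that] p]] by simp
  \<comment> \<open>A bound for the frame coefficients that is linear in \<open>norm v\<close> and
    uniform over \<open>C\<close>, obtained from unit vectors by homogeneity.\<close>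
  obtain M where M: "M \<ge> 0" "\<And>q v. q \<in> C \<Longrightarrow> (\<Sum>i<k. \<bar>c i q v\<bar>) \<le> M * norm v"
  proof -
    have CN: "C \<times> sphere 0 1 \<subseteq> N \<times> UNIV" using C(3) by (rule Sigma_mono) simp
    have "continuous_on (C \<times> sphere 0 1) (\<lambda>z. c i (fst z) (snd z))" if "i < k" for i
      by (rule continuous_on_subset[OF smooth_on_continuous[OF c_smooth[OF that]] CN])
    then have "continuous_on (C \<times> sphere 0 1) (\<lambda>z. \<Sum>i<k. \<bar>c i (fst z) (snd z)\<bar>)"
      by (intro continuous_on_sum continuous_on_rabs) (simp only: lessThan_iff)
    then have "compact ((\<lambda>z. \<Sum>i<k. \<bar>c i (fst z) (snd z)\<bar>) ` (C \<times> sphere 0 1))"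
      by (intro compact_continuous_image compact_Times C compact_sphere)
    from compact_imp_bounded[OF this]
    obtain B where B: "\<forall>y \<in> (\<lambda>z. \<Sum>i<k. \<bar>c i (fst z) (snd z)\<bar>) ` (C \<times> sphere 0 1). norm y \<le> B"
      unfolding bounded_iff ..
    have "(\<Sum>i<k. \<bar>c i q v\<bar>) \<le> max B 0 * norm v" if q: "q \<in> C" for q v
    proof (cases "v = 0")
      case True
      have "c i q v = 0" if "i < k" for i
        using linear_0[OF c_linear[OF that subsetD[OF C(3) q]]] True by simp
      then show ?thesis using True by simp
    next
      case False
      define n where "n = (1 / norm v) *\<^sub>R v"
      have n: "n \<in> sphere 0 1" "v = norm v *\<^sub>R n" using False by (auto simp: n_def)
      have "c i q v = norm v * c i q n" if "i < k" for i
        using linear_scale[OF c_linear[OF that subsetD[OF C(3) q]], of "norm v" n] n(2) by simp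
      then have "(\<Sum>i<k. \<bar>c i q v\<bar>) = norm v * (\<Sum>i<k. \<bar>c i q n\<bar>)"
        by (simp add: sum_distrib_left abs_mult)
      moreover have "norm (\<Sum>i<k. \<bar>c i q n\<bar>) \<le> B"
        by (rule bspec[OF B], rule image_eqI[of _ _ "(q, n)"]) (use q n in auto)
      ultimately show ?thesis by (simp add: mult.commute mult_left_mono)
    qed
    then show ?thesis by (intro that[of "max B 0"]) auto
  qed
  have bound: "norm (d q) \<le> (M / \<mu>) * (\<Sum>i<k. \<bar>s i q\<bar>)" if q: "q \<in> C" for q
  proof (cases "d q = 0")
    case True
    then show ?thesis using M \<mu> by (simp add: sum_nonneg)
  next
    case False
    have qQ: "q \<in> Q" "q \<in> N" using q C by auto
    \<comment> \<open>The chain is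
      \<open>\<mu> |d|^2 \<le> g(d, d) \<le> M |d| (sum of |s i|)\<close>, afterwards divided by
      \<open>|d|\<close>.\<close>
    have "\<mu> * (norm (d q))\<^sup>2 \<le> g q (d q) (d q)" by (rule \<mu>(2)[OF q dT[OF qQ(1)]])
    also have "\<dots> = differential Q \<psi> q (d q) - g q (w q) (d q)"
      using g_diff_left[OF qQ(1) dT[OF qQ(1)] gradient_T[OF \<psi> qQ(1)] field_T[OF wf qQ(1)]]
        g_gradient[OF \<psi> qQ(1) dT[OF qQ(1)]] by (simp add: d_def)
    also have "\<dots> = (\<Sum>i<k. c i q (d q) * s i q)"
    proof -
      have "differential Q \<psi> q (\<Sum>i<k. c i q (d q) *\<^sub>R E i q) = (\<Sum>i<k. c i q (d q) * differential Q \<psi> q (E i q))"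
        using linear_differential[OF \<psi> qQ(1)] by (simp add: linear_sum linear_scale)
      moreover have "g q (w q) (\<Sum>i<k. c i q (d q) *\<^sub>R E i q) = (\<Sum>i<k. c i q (d q) * g q (w q) (E i q))"
        by (intro g_sum_right qQ field_T wf E_field)
      ultimately show ?thesis
        unfolding frame_expand[OF qQ(2,1) dT[OF qQ(1)]]
        by (simp add: s_def right_diff_distrib sum_subtractf)
    qed
    also have "\<dots> \<le> (\<Sum>i<k. \<bar>c i q (d q)\<bar> * (\<Sum>i<k. \<bar>s i q\<bar>))"
    proof (rule sum_mono)
      fix i assume i: "i \<in> {..<k}"
      have "c i q (d q) * s i q \<le> \<bar>c i q (d q)\<bar> * \<bar>s i q\<bar>" by (metis abs_ge_self abs_mult)
      also have "\<dots> \<le> \<bar>c i q (d q)\<bar> * (\<Sum>i<k. \<bar>s i q\<bar>)"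
        by (intro mult_left_mono member_le_sum[OF i]) auto
      finally show "c i q (d q) * s i q \<le> \<bar>c i q (d q)\<bar> * (\<Sum>i<k. \<bar>s i q\<bar>)" .
    qed
    also have "\<dots> = (\<Sum>i<k. \<bar>c i q (d q)\<bar>) * (\<Sum>i<k. \<bar>s i q\<bar>)" by (simp add: sum_distrib_right)
    also have "\<dots> \<le> (M * norm (d q)) * (\<Sum>i<k. \<bar>s i q\<bar>)"
      by (intro mult_right_mono M(2)[OF q] sum_nonneg) auto
    finally have "norm (d q) * (\<mu> * norm (d q)) \<le> norm (d q) * (M * (\<Sum>i<k. \<bar>s i q\<bar>))"
      by (simp add: power2_eq_square ac_simps)
    then have "\<mu> * norm (d q) \<le> M * (\<Sum>i<k. \<bar>s i q\<bar>)" using False by simp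
    then show ?thesis using \<mu>(1) by (simp add: field_simps)
  qed
  have "((\<lambda>q. (M / \<mu>) * (\<Sum>i<k. \<bar>s i q\<bar>)) \<longlongrightarrow> (M / \<mu>) * (\<Sum>i<k. \<bar>s i p\<bar>)) (at p within Q)"
    using s_cont p by (intro tendsto_intros) (auto simp: continuous_on_def)
  then have lim0: "((\<lambda>q. (M / \<mu>) * (\<Sum>i<k. \<bar>s i q\<bar>)) \<longlongrightarrow> 0) (at p within Q)" using s_p by simp
  have "\<forall>\<^sub>F q in at p within Q. q \<in> C"
    unfolding eventually_at C_def using r(1) by (intro exI[of _ r]) (auto simp: dist_commute)
  then have "\<forall>\<^sub>F q in at p within Q. norm (d q) \<le> (M / \<mu>) * (\<Sum>i<k. \<bar>s i q\<bar>)"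
    by eventually_elim (rule bound)
  from Lim_null_comparison[OF this lim0] have "(d \<longlongrightarrow> 0) (at p within Q)" .
  moreover have "(w \<longlongrightarrow> w p) (at p within Q)"
    using smooth_map_continuous_on[OF field_smooth[OF wf]] p by (simp add: continuous_on_def)
  ultimately have "((\<lambda>q. d q + w q) \<longlongrightarrow> 0 + w p) (at p within Q)" by (rule tendsto_add)
  then show "(?G \<longlongrightarrow> ?G p) (at p within Q)" by (simp add: d_def wp)
qed

end

section \<open>Peano's existence theorem\<close>

lemma has_vector_derivative_at_split:
  fixes f :: "real \<Rightarrow> 'b::real_normed_vector"
  assumes l: "(f has_vector_derivative d) (at t within {..t})"
    and r: "(f has_vector_derivative d) (at t within {t..})"
  shows "(f has_vector_derivative d) (at t)"
proof -
  have "({..t} \<union> {t..}) = UNIV" by auto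
  then show ?thesis
    using l r unfolding has_vector_derivative_def has_derivative_within
    by (auto intro: Lim_Un_univ)
qed

text \<open>Tonelli's approximation with delay \<open>\<delta>\<close>: the equation with delay is solved exactly by iterating
  finitely often, since each iteration determines the solution on one more interval of length \<open>\<delta>\<close>.\<close>

lemma delayed_integral_equation:
  fixes F :: "'b::euclidean_space \<Rightarrow> 'b"
  assumes contF: "continuous_on UNIV F" and bdF: "\<And>x. norm (F x) \<le> M" and \<delta>: "\<delta> > 0"
  obtains x where "continuous_on UNIV x"
    "\<And>t. t \<le> T \<Longrightarrow> x t = x0 + integral {0..t - \<delta>} (\<lambda>s. F (x s))"
    "\<And>s t. norm (x s - x t) \<le> M * \<bar>s - t\<bar>"
proof -
  define \<Phi> where "\<Phi> x t = x0 + integral {0..t - \<delta>} (\<lambda>s. F (x s))" for x and t :: real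
  have M0: "M \<ge> 0" using bdF[of undefined] norm_ge_zero order_trans by blast
  have lip1: "norm (\<Phi> x s - \<Phi> x t) \<le> M * \<bar>s - t\<bar>" if c: "continuous_on UNIV x" and st: "s \<le> t" for x s t
  proof -
    have int: "(\<lambda>s. F (x s)) integrable_on {a..b}" for a b :: real
      by (intro integrable_continuous_real continuous_on_compose2[OF contF]
          continuous_on_subset[OF c]) auto
    have bd: "norm (integral {a..b} (\<lambda>s. F (x s))) \<le> M * (b - a)" if "a \<le> b" for a b
      using integral_bound[OF that, of "\<lambda>s. F (x s)" M] bdF
      by (simp add: continuous_on_compose2[OF contF continuous_on_subset[OF c]])
    \<comment> \<open>Up to time \<open>\<delta>\<close> the integral over
      \<open>{0..t - \<delta>}\<close> is 0 and \<open>\<Phi> x\<close> is constant; the cases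
      locate \<open>\<delta>\<close> relative to \<open>s \<le> t\<close>.\<close>
    consider "t - \<delta> \<le> 0" | "s - \<delta> \<le> 0" "0 < t - \<delta>" | "0 < s - \<delta>" by linarith
    then show ?thesis
    proof cases
      case 1
      then have "integral {0..t - \<delta>} (\<lambda>s. F (x s)) = 0" "integral {0..s - \<delta>} (\<lambda>s. F (x s)) = 0"
        using st by (cases "t = \<delta>"; cases "s = \<delta>"; simp)+
      then show ?thesis by (simp add: \<Phi>_def M0)
    next
      case 2
      then have "integral {0..s - \<delta>} (\<lambda>s. F (x s)) = 0" by (cases "s = \<delta>") simp_all
      then have "norm (\<Phi> x s - \<Phi> x t) = norm (integral {0..t-\<delta>} (\<lambda>s. F (x s)))"
        by (simp add: \<Phi>_def)
      also have "\<dots> \<le> M * (t - \<delta>)" using bd[of 0 "t - \<delta>"] 2 by simp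
      also have "\<dots> \<le> M * \<bar>s - t\<bar>" using 2 M0 st by (intro mult_left_mono) auto
      finally show ?thesis .
    next
      case 3
      have "integral {0..s - \<delta>} (\<lambda>s. F (x s)) + integral {s - \<delta>..t - \<delta>} (\<lambda>s. F (x s))
          = integral {0..t - \<delta>} (\<lambda>s. F (x s))"
        by (rule Henstock_Kurzweil_Integration.integral_combine) (use 3 st int in auto)
      then have "\<Phi> x t - \<Phi> x s = integral {s - \<delta>..t-\<delta>} (\<lambda>s. F (x s))"
        unfolding \<Phi>_def by (metis add_diff_cancel_left add_diff_cancel_left')
      then have "norm (\<Phi> x s - \<Phi> x t) = norm (integral {s - \<delta>..t-\<delta>} (\<lambda>s. F (x s)))"
        by (metis norm_minus_commute)
      also have "\<dots> \<le> M * (t - s)" using bd[of "s - \<delta>" "t - \<delta>"] st by simp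
      finally show ?thesis using st by simp
    qed
  qed
  have lip: "norm (\<Phi> x s - \<Phi> x t) \<le> M * \<bar>s - t\<bar>" if c: "continuous_on UNIV x" for x s t
    using lip1[OF c, of s t] lip1[OF c, of t s] by (metis abs_minus_commute linear norm_minus_commute)
  have contPhi: "continuous_on UNIV (\<Phi> x)" if c: "continuous_on UNIV x" for x
  proof -
    have "M-lipschitz_on UNIV (\<Phi> x)"
      unfolding lipschitz_on_def dist_norm using lip[OF c] M0 by auto
    then show ?thesis by (rule lipschitz_on_continuous_on)
  qed
  define X where "X k = (\<Phi> ^^ k) (\<lambda>t. x0)" for k
  have XS: "X (Suc k) = \<Phi> (X k)" for k by (simp add: X_def)
  have contX: "continuous_on UNIV (X k)" for k
    by (induction k) (auto simp: XS contPhi, simp add: X_def)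
  have agree: "t \<le> real k * \<delta> \<Longrightarrow> X (Suc k) t = X k t" for k t
  proof (induction k arbitrary: t)
    case 0
    then have "integral {0..t - \<delta>} f = 0" for f :: "real \<Rightarrow> 'b" using \<delta> by simp
    then show ?case by (simp add: XS \<Phi>_def) (simp add: X_def)
  next
    case (Suc k)
    have "integral {0..t-\<delta>} (\<lambda>s. F (X (Suc k) s)) = integral {0..t-\<delta>} (\<lambda>s. F (X k s))"
    proof (rule integral_cong)
      fix s assume "s \<in> {0..t-\<delta>}"
      then have "s \<le> real k * \<delta>" using Suc.prems by (auto simp: algebra_simps)
      then show "F (X (Suc k) s) = F (X k s)" using Suc.IH by simp
    qed
    then have "\<Phi> (X (Suc k)) t = \<Phi> (X k) t" by (simp add: \<Phi>_def)
    then show ?case by (simp only: XS)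
  qed
  \<comment> \<open>\<open>X (Suc k)\<close> solves the delayed equation up to time
    \<open>(k + 1) * \<delta>\<close>; being a value of \<open>\<Phi>\<close> it also has the
    Lipschitz bound.\<close>
  obtain k where k: "T \<le> real k * \<delta>"
    using \<delta> by (metis ex_less_of_nat_mult less_imp_le)
  show ?thesis
  proof
    show "continuous_on UNIV (X (Suc k))" by (rule contX)
    show "X (Suc k) t = x0 + integral {0..t - \<delta>} (\<lambda>s. F (X (Suc k) s))" if "t \<le> T" for t
    proof -
      have "t \<le> real (Suc k) * \<delta>" using k that \<delta> by (simp add: distrib_right)
      from agree[OF this] have "X (Suc k) t = \<Phi> (X (Suc k)) t" by (simp only: XS[of "Suc k"])
      then show ?thesis by (simp only: \<Phi>_def)
    qed
    show "norm (X (Suc k) s - X (Suc k) t) \<le> M * \<bar>s - t\<bar>" for s t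
      unfolding XS by (rule lip[OF contX])
  qed
qed

text \<open>The delayed solutions share the Lipschitz constant \<open>M\<close>, so Arzela-Ascoli
  yields a uniform limit of a subsequence. Dominated convergence passes to the limit under the
  integral, and a delay \<open>d\<close> changes the integral by at most
  \<open>M * d\<close>.\<close>

lemma integral_equation_limit:
  fixes F :: "'b::euclidean_space \<Rightarrow> 'b"
  fixes T :: real
  assumes contF: "continuous_on UNIV F" and bdF: "\<And>x. norm (F x) \<le> M"
  obtains x where "continuous_on {0..T} x"
    "\<And>t. t \<in> {0..T} \<Longrightarrow> x t = x0 + integral {0..t} (\<lambda>s. F (x s))"
proof -
  have M0: "M \<ge> 0" using bdF[of undefined] norm_ge_zero order_trans by blast
  have "\<exists>x. continuous_on UNIV x \<and>
    (\<forall>t\<le>T. x t = x0 + integral {0..t - 1 / real (Suc n)} (\<lambda>s. F (x s))) \<and>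
    (\<forall>s t. norm (x s - x t) \<le> M * \<bar>s - t\<bar>)" for n :: nat
    using delayed_integral_equation[OF contF bdF, of "1 / real (Suc n)" T x0] by simp metis
  then obtain X where contX: "\<And>n. continuous_on UNIV (X n)"
    and eqX: "\<And>n t. t \<le> T \<Longrightarrow> X n t = x0 + integral {0..t - 1 / real (Suc n)} (\<lambda>s. F (X n s))"
    and lipX: "\<And>n s t. norm (X n s - X n t) \<le> M * \<bar>s - t\<bar>"
    by metis
  have int: "(\<lambda>s. F (X n s)) integrable_on {a..b}" for a b :: real and n
    by (intro integrable_continuous_real continuous_on_compose2[OF contF]
          continuous_on_subset[OF contX]) auto
  show ?thesis
  proof (cases "T \<ge> 0")
    case False
    then show ?thesis using that[of "\<lambda>t. x0"] by auto
  next
    case True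
    have X0: "X n 0 = x0" for n using eqX[of 0 n] True by simp
    obtain x k where x: "continuous_on {0..T} x" and k: "strict_mono (k :: nat \<Rightarrow> nat)"
      and lim: "\<And>e. 0 < e \<Longrightarrow> \<exists>N. \<forall>n t. n \<ge> N \<and> t \<in> {0..T} \<longrightarrow> norm (X (k n) t - x t) < e"
    proof (rule Arzela_Ascoli[of "{0..T}" X "norm x0 + M * T"])
      show "norm (X n t) \<le> norm x0 + M * T" if "t \<in> {0..T}" for n t
      proof -
        have "norm (X n t) \<le> norm (X n 0) + norm (X n t - X n 0)"
          by (metis add.commute norm_triangle_sub)
        also have "\<dots> \<le> norm x0 + M * \<bar>t - 0\<bar>"
          unfolding X0[symmetric, of n] using lipX[of n t 0] by simp
        also have "\<dots> \<le> norm x0 + M * T" using that M0 by (auto intro!: mult_left_mono)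
        finally show ?thesis .
      qed
      show "\<exists>d>0. \<forall>n y. y \<in> {0..T} \<and> norm (t - y) < d \<longrightarrow> norm (X n t - X n y) < e"
        if "t \<in> {0..T}" "0 < e" for t e
      proof (intro exI conjI allI impI)
        show "0 < e / (M + 1)" using M0 that by simp
        fix n y assume y: "y \<in> {0..T} \<and> norm (t - y) < e / (M + 1)"
        have "norm (X n t - X n y) \<le> M * \<bar>t - y\<bar>" by (rule lipX)
        also have "\<dots> \<le> (M + 1) * \<bar>t - y\<bar>" by (simp add: distrib_right)
        also have "\<dots> < (M + 1) * (e / (M + 1))"
          using y M0 by (intro mult_strict_left_mono) auto
        also have "\<dots> = e" using M0 by simp
        finally show "norm (X n t - X n y) < e" .
      qed
    qed auto
    have ptw: "(\<lambda>n. X (k n) t) \<longlonglongrightarrow> x t" if "t \<in> {0..T}" for t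
      unfolding LIMSEQ_iff using lim that by blast
    have "x t = x0 + integral {0..t} (\<lambda>s. F (x s))" if t: "t \<in> {0..T}" for t
    proof -
      have "(\<lambda>n. integral {0..t} (\<lambda>s. F (X (k n) s))) \<longlonglongrightarrow> integral {0..t} (\<lambda>s. F (x s))"
      proof (rule dominated_convergence(2)[where h = "\<lambda>_. M"])
        show "(\<lambda>s. F (X (k n) s)) integrable_on {0..t}" for n by (rule int)
        show "(\<lambda>n. F (X (k n) s)) \<longlonglongrightarrow> F (x s)" if "s \<in> {0..t}" for s
          using ptw[of s] that t contF
          by (metis UNIV_I atLeastAtMost_iff continuous_on_tendsto_compose eventually_sequentiallyI order_trans)
      qed (use bdF in auto)
      then have l1: "(\<lambda>n. x0 + integral {0..t} (\<lambda>s. F (X (k n) s))) \<longlonglongrightarrow> x0 + integral {0..t} (\<lambda>s. F (x s))"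
        by (intro tendsto_intros)
      have l2: "(\<lambda>n. X (k n) t - (x0 + integral {0..t} (\<lambda>s. F (X (k n) s)))) \<longlonglongrightarrow> 0"
      proof (rule Lim_null_comparison)
        show "\<forall>\<^sub>F n in sequentially. norm (X (k n) t - (x0 + integral {0..t} (\<lambda>s. F (X (k n) s)))) \<le> M * (1 / real (Suc n))"
        proof (rule always_eventually, rule allI)
          fix n
          define d where "d = 1 / real (Suc (k n))"
          have d: "0 < d" "d \<le> 1 / real (Suc n)"
            using seq_suble[OF k, of n] by (auto simp: d_def divide_simps)
          let ?f = "\<lambda>s. F (X (k n) s)"
          have bd: "norm (integral {a..b} ?f) \<le> M * (b - a)" if "a \<le> b" for a b
            using integral_bound[OF that, of ?f M] bdF
            by (simp add: continuous_on_compose2[OF contF continuous_on_subset[OF contX]])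
          have "norm (X (k n) t - (x0 + integral {0..t} ?f)) = norm (integral {0..t} ?f - integral {0..t-d} ?f)"
            using eqX[of t "k n"] t by (simp add: d_def norm_minus_commute)
          also have "\<dots> \<le> M * d"
          proof (cases "t - d \<ge> 0")
            case True
            then have "integral {0..t} ?f - integral {0..t-d} ?f = integral {t-d..t} ?f"
              using Henstock_Kurzweil_Integration.integral_combine[of 0 "t-d" t ?f] d int
              by (simp add: algebra_simps)
            then show ?thesis using bd[of "t-d" t] d by simp
          next
            case False
            then have "norm (integral {0..t} ?f - integral {0..t-d} ?f) \<le> M * t" using bd[of 0 t] t by simp
            also have "\<dots> \<le> M * d" using False M0 by (intro mult_left_mono) auto
            finally show ?thesis .
          qed
          also have "\<dots> \<le> M * (1 / real (Suc n))" using d M0 by (intro mult_left_mono) auto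
          finally show "norm (X (k n) t - (x0 + integral {0..t} ?f)) \<le> M * (1 / real (Suc n))" .
        qed
        show "(\<lambda>n. M * (1 / real (Suc n))) \<longlonglongrightarrow> 0"
          using tendsto_mult_right_zero[OF LIMSEQ_Suc[OF lim_1_over_n]] by simp
      qed
      from tendsto_add[OF l2 l1] have "(\<lambda>n. X (k n) t) \<longlonglongrightarrow> x0 + integral {0..t} (\<lambda>s. F (x s))"
        by simp
      then show ?thesis using ptw[OF t] LIMSEQ_unique by blast
    qed
    then show ?thesis using that x by blast
  qed
qed

lemma peano_forward:
  fixes F :: "'b::euclidean_space \<Rightarrow> 'b"
  assumes contF: "continuous_on UNIV F" and bdF: "\<And>x. norm (F x) \<le> M"
  obtains x where "x 0 = x0"
    "\<And>t. t \<in> {0..T} \<Longrightarrow> (x has_vector_derivative F (x t)) (at t within {0..T})"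
    "\<And>t. t \<in> {0..T} \<Longrightarrow> norm (x t - x0) \<le> M * t"
proof (cases "T \<ge> 0")
  case False
  then show ?thesis using that[of "\<lambda>_. x0"] by auto
next
  case T: True
  from integral_equation_limit[OF contF bdF, of T x0]
  obtain x where x: "continuous_on {0..T} x"
    and eq: "\<And>t. t \<in> {0..T} \<Longrightarrow> x t = x0 + integral {0..t} (\<lambda>s. F (x s))" by blast
  have cont: "continuous_on {0..T} (\<lambda>s. F (x s))"
    by (intro continuous_on_compose2[OF contF x]) auto
  show ?thesis
  proof
    show "x 0 = x0" using eq[of 0] T by simp
    fix t assume t: "t \<in> {0..T}"
    have "((\<lambda>t. x0 + integral {0..t} (\<lambda>s. F (x s))) has_vector_derivative 0 + F (x t)) (at t within {0..T})"
      by (intro has_vector_derivative_add integral_has_vector_derivative cont t has_vector_derivative_const)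
    then have "((\<lambda>t. x0 + integral {0..t} (\<lambda>s. F (x s))) has_vector_derivative F (x t)) (at t within {0..T})"
      by simp
    then show "(x has_vector_derivative F (x t)) (at t within {0..T})"
      by (rule has_vector_derivative_transform[OF t, rotated]) (use eq in simp)
    have "norm (integral {0..t} (\<lambda>s. F (x s))) \<le> M * (t - 0)"
      using t bdF by (intro integral_bound continuous_on_subset[OF cont]) auto
    then show "norm (x t - x0) \<le> M * t" using eq[OF t] by simp
  qed
qed

text \<open>Composition with the closest-point projection onto a closed ball in \<open>U\<close>
  makes \<open>F\<close> bounded and globally defined. Up to time \<open>T = r / M'\<close> a
  solution of speed at most \<open>M'\<close> stays in the ball, where the projection is the
  identity. Past times come from the reversed field.\<close>

theorem peano_existence:
  fixes F :: "'b::euclidean_space \<Rightarrow> 'b"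
  assumes "open U" "x0 \<in> U" and contF: "continuous_on U F"
  obtains e x where "e > 0" "x t0 = x0"
    "\<And>t. t \<in> {t0-e<..<t0+e} \<Longrightarrow> x t \<in> U \<and> (x has_vector_derivative F (x t)) (at t)"
proof -
  obtain r where r: "r > 0" "cball x0 r \<subseteq> U" using assms(1,2) open_contains_cball by blast
  define p where "p = closest_point (cball x0 r)"
  have ne: "cball x0 r \<noteq> {}" using r by simp
  have contp: "continuous_on UNIV p"
    unfolding p_def by (rule continuous_on_closest_point) (use ne in auto)
  have pin: "p x \<in> cball x0 r" for x
    unfolding p_def using closest_point_in_set[OF closed_cball ne] .
  have pid: "x \<in> cball x0 r \<Longrightarrow> p x = x" for x unfolding p_def by (rule closest_point_self)
  have contFp: "continuous_on UNIV (\<lambda>x. F (p x))"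
    by (rule continuous_on_compose2[OF contF contp]) (use pin r in blast)
  have "compact (F ` cball x0 r)"
    by (rule compact_continuous_image[OF continuous_on_subset[OF contF r(2)]]) simp
  then obtain M where M: "\<And>y. y \<in> F ` cball x0 r \<Longrightarrow> norm y \<le> M"
    using compact_imp_bounded bounded_iff by metis
  define M' where "M' = max M 0 + 1"
  have bd: "norm (F (p x)) \<le> M'" for x using M[of "F (p x)"] pin[of x] by (auto simp: M'_def)
  have M'0: "M' > 0" by (simp add: M'_def)
  have contm: "continuous_on UNIV (\<lambda>x. - F (p x))" by (intro continuous_intros contFp)
  define T where "T = r / M'"
  have T0: "T > 0" using r M'0 by (simp add: T_def)
  from peano_forward[OF contFp bd, of x0 T] obtain a where a: "a 0 = x0"
    "\<And>t. t \<in> {0..T} \<Longrightarrow> (a has_vector_derivative F (p (a t))) (at t within {0..T})"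
    "\<And>t. t \<in> {0..T} \<Longrightarrow> norm (a t - x0) \<le> M' * t" by blast
  from peano_forward[OF contm, of M' x0 T] bd obtain b where b: "b 0 = x0"
    "\<And>t. t \<in> {0..T} \<Longrightarrow> (b has_vector_derivative - F (p (b t))) (at t within {0..T})"
    "\<And>t. t \<in> {0..T} \<Longrightarrow> norm (b t - x0) \<le> M' * t" by (metis norm_minus_cancel)
  have small: "M' * t \<le> r" if "t \<le> T" for t
    using that M'0 by (simp add: T_def field_simps)
  have ab: "a t \<in> cball x0 r" "b t \<in> cball x0 r" if "t \<in> {0..T}" for t
    using a(3)[OF that] b(3)[OF that] small[of t] that by (auto simp: dist_norm norm_minus_commute)
  define x where "x t = (if t \<ge> t0 then a (t - t0) else b (t0 - t))" for t
  have xr: "(x has_vector_derivative F (x t)) (at t within {t0..t0+T})" if t: "t \<in> {t0..t0+T}" for t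
  proof -
    have "((a \<circ> (\<lambda>s. s - t0)) has_vector_derivative 1 *\<^sub>R F (p (a (t - t0)))) (at t within {t0..t0+T})"
      by (rule vector_diff_chain_within)
        (use t in \<open>auto intro!: derivative_eq_intros has_vector_derivative_within_subset[OF a(2)]\<close>)
    then have "((\<lambda>s. a (s - t0)) has_vector_derivative F (x t)) (at t within {t0..t0+T})"
      using pid[OF ab(1)[of "t - t0"]] t by (auto simp: x_def o_def)
    then show ?thesis
      by (rule has_vector_derivative_transform[rotated 2]) (use t in \<open>auto simp: x_def\<close>)
  qed
  have xl: "(x has_vector_derivative F (x t)) (at t within {t0-T..t0})" if t: "t \<in> {t0-T..t0}" for t
  proof -
    have "((b \<circ> (\<lambda>s. t0 - s)) has_vector_derivative (-1) *\<^sub>R - F (p (b (t0 - t)))) (at t within {t0-T..t0})"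
      by (rule vector_diff_chain_within)
        (use t in \<open>auto intro!: derivative_eq_intros has_vector_derivative_within_subset[OF b(2)]\<close>)
    then have "((\<lambda>s. b (t0 - s)) has_vector_derivative F (x t)) (at t within {t0-T..t0})"
      using pid[OF ab(2)[of "t0 - t"]] t a(1) b(1) by (auto simp: x_def o_def split: if_splits)
    then show ?thesis
      by (rule has_vector_derivative_transform[rotated 2]) (use t a b in \<open>auto simp: x_def\<close>)
  qed
  have "x t \<in> U \<and> (x has_vector_derivative F (x t)) (at t)" if t: "t \<in> {t0-T<..<t0+T}" for t
  proof
    show "x t \<in> U" using ab(1)[of "t-t0"] ab(2)[of "t0-t"] r t by (auto simp: x_def)
    consider "t < t0" | "t = t0" | "t > t0" by linarith
    then show "(x has_vector_derivative F (x t)) (at t)"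
    proof cases
      case 1
      then have "at t within {t0-T..t0} = at t" using t by (intro at_within_interior) auto
      then show ?thesis using xl[of t] 1 t by auto
    next
      case 3
      then have "at t within {t0..t0+T} = at t" using t by (intro at_within_interior) auto
      then show ?thesis using xr[of t] 3 t by auto
    next
      case 2
      have "at t0 within {..t0} = at t0 within {t0-T..t0}"
        by (rule at_within_nhd[of _ "{t0-T<..<t0+T}"]) (use T0 in auto)
      moreover have "at t0 within {t0..} = at t0 within {t0..t0+T}"
        by (rule at_within_nhd[of _ "{t0-T<..<t0+T}"]) (use T0 in auto)
      ultimately show ?thesis
        using xr[of t0] xl[of t0] T0 2 by (intro has_vector_derivative_at_split) auto
    qed
  qed
  then show ?thesis using that[of T x] T0 a(1) by (auto simp: x_def)
qed

section \<open>Autonomous equations on closed sets\<close>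

definition autonomous_solution ::
    "'x::euclidean_space set \<Rightarrow> ('x \<Rightarrow> 'x) \<Rightarrow> real set \<Rightarrow> (real \<Rightarrow> 'x) \<Rightarrow> bool" where
  "autonomous_solution M F I x \<longleftrightarrow> open I \<and> is_interval I \<and>
     (\<forall>t\<in>I. x t \<in> M \<and> (x has_vector_derivative F (x t)) (at t))"

lemma Icc_subset_interval: "is_interval I \<Longrightarrow> a \<in> I \<Longrightarrow> b \<in> I \<Longrightarrow> {a..b} \<subseteq> (I :: real set)"
  unfolding is_interval_1 by (meson atLeastAtMost_iff subsetI)

text \<open>Solutions are represented by their graphs, so that extending a solution becomes
  inclusion of sets and Zorn's lemma applies. In a chain the graphs agree where their domains
  overlap, and nested open intervals have an open interval as union.\<close>

lemma maximal_solution_exists: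
  assumes sol0: "autonomous_solution M F I0 x0" "t0 \<in> I0"
  shows "\<exists>I x. maximal_solution (autonomous_solution M F) I x \<and> t0 \<in> I \<and> x t0 = x0 t0"
proof -
  define graph where "graph I x = (\<lambda>t. (t, x t)) ` I" for I :: "real set" and x :: "real \<Rightarrow> 'a"
  have graph_iff: "(t, v) \<in> graph I x \<longleftrightarrow> t \<in> I \<and> v = x t" for t v I x
    by (auto simp: graph_def)
  define \<A> where "\<A> = {G. \<exists>I x. autonomous_solution M F I x \<and> t0 \<in> I \<and> x t0 = x0 t0 \<and> G = graph I x}"
  have "\<exists>G\<in>\<A>. \<forall>H\<in>\<A>. G \<subseteq> H \<longrightarrow> H = G"
  proof (rule subset_Zorn_nonempty)
    show "\<A> \<noteq> {}" using sol0 unfolding \<A>_def by blast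
    fix C assume C: "C \<noteq> {}" "subset.chain \<A> C"
    have CA: "G \<in> \<A>" if "G \<in> C" for G using C(2) that by (auto simp: subset.chain_def)
    have cmp: "G \<subseteq> H \<or> H \<subseteq> G" if "G \<in> C" "H \<in> C" for G H
      using C(2) that by (auto simp: subset.chain_def)
    define dom where "dom G = fst ` G" for G :: "(real \<times> 'a) set"
    define y where "y t = (SOME v. (t, v) \<in> \<Union>C)" for t
    have single: "v = v'" if vv: "(t, v) \<in> \<Union>C" "(t, v') \<in> \<Union>C" for t v v'
    proof -
      obtain G H where "G \<in> C" "(t, v) \<in> G" "H \<in> C" "(t, v') \<in> H" using vv by blast
      then obtain B where "B \<in> C" "(t, v) \<in> B" "(t, v') \<in> B" using cmp by blast
      then show ?thesis using CA[of B] by (auto simp: \<A>_def graph_iff)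
    qed
    have y: "y t = v" if "(t, v) \<in> \<Union>C" for t v
      unfolding y_def by (rule some_equality, rule that, rule single[OF _ that])
    have G: "open (dom G) \<and> is_interval (dom G) \<and> t0 \<in> dom G \<and> y t0 = x0 t0 \<and>
        (\<forall>t\<in>dom G. (t, y t) \<in> G \<and> y t \<in> M \<and> (y has_vector_derivative F (y t)) (at t))" if "G \<in> C" for G
    proof -
      obtain I x where x: "autonomous_solution M F I x" "t0 \<in> I" "x t0 = x0 t0" "G = graph I x"
        using CA[OF \<open>G \<in> C\<close>] unfolding \<A>_def by blast
      have dom: "dom G = I" by (auto simp: dom_def x(4) graph_def image_iff)
      have yx: "y t = x t" if "t \<in> I" for t
        by (rule y) (use that \<open>G \<in> C\<close> x(4) graph_iff in blast)
      have I: "open I" "is_interval I" using x(1) by (auto simp: autonomous_solution_def)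
      have "(y has_vector_derivative F (y t)) (at t)" if "t \<in> I" for t
      proof (rule has_vector_derivative_transform_within_open[OF _ I(1) that])
        show "(x has_vector_derivative F (y t)) (at t)"
          using x(1) that yx by (auto simp: autonomous_solution_def)
      qed (simp add: yx)
      then show ?thesis unfolding dom using I x yx by (auto simp: autonomous_solution_def graph_iff)
    qed
    define I where "I = (\<Union>G\<in>C. dom G)"
    have "open I" unfolding I_def using G by blast
    moreover have "is_interval I"
      unfolding is_interval_1
    proof (intro ballI allI impI)
      fix a b s assume ab: "a \<in> I" "b \<in> I" and s: "a \<le> s \<and> s \<le> b"
      then obtain A B where AB: "A \<in> C" "a \<in> dom A" "B \<in> C" "b \<in> dom B" by (auto simp: I_def)
      have "dom A \<subseteq> dom B \<or> dom B \<subseteq> dom A" using cmp[OF AB(1,3)] by (auto simp: dom_def)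
      then obtain H where "H \<in> C" "a \<in> dom H" "b \<in> dom H" using AB by blast
      then show "s \<in> I" using G[of H] s unfolding I_def is_interval_1 by blast
    qed
    moreover have "\<forall>t\<in>I. y t \<in> M \<and> (y has_vector_derivative F (y t)) (at t)"
      unfolding I_def using G by blast
    ultimately have "autonomous_solution M F I y" by (simp add: autonomous_solution_def)
    moreover have "t0 \<in> I" "y t0 = x0 t0" using G C(1) unfolding I_def by blast+
    moreover have "\<Union>C = graph I y"
    proof (intro subset_antisym subsetI)
      fix z assume z: "z \<in> \<Union>C"
      then have "fst z \<in> I" by (auto simp: I_def dom_def)
      moreover have "y (fst z) = snd z" by (rule y) (use z in simp)
      ultimately show "z \<in> graph I y" using graph_iff[of "fst z" "snd z"] by simp
    next
      fix z assume "z \<in> graph I y"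
      then obtain t where "t \<in> I" "z = (t, y t)" by (auto simp: graph_def)
      then show "z \<in> \<Union>C" using G unfolding I_def by blast
    qed
    ultimately show "\<Union>C \<in> \<A>" unfolding \<A>_def by blast
  qed
  then obtain G where G: "G \<in> \<A>" "\<forall>H\<in>\<A>. G \<subseteq> H \<longrightarrow> H = G" ..
  from G(1) obtain I x where x: "autonomous_solution M F I x" "t0 \<in> I" "x t0 = x0 t0" "G = graph I x"
    unfolding \<A>_def by auto
  have max: "H = graph I x" if "H \<in> \<A>" "graph I x \<subseteq> H" for H
    using G(2) that unfolding x(4) by simp
  have "J = I" if J: "autonomous_solution M F J y" "I \<subseteq> J" "\<forall>t\<in>I. y t = x t" for J y
  proof -
    have "t0 \<in> J" "y t0 = x0 t0" using J x by auto
    with J(1) have "graph J y \<in> \<A>" unfolding \<A>_def by blast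
    moreover have "graph I x \<subseteq> graph J y" using J by (auto simp: graph_def)
    ultimately have "graph J y = graph I x" using max by blast
    then have "fst ` graph J y = fst ` graph I x" by simp
    then show ?thesis by (simp add: graph_def image_image)
  qed
  then have "maximal_solution (autonomous_solution M F) I x"
    using x(1) unfolding maximal_solution_def by blast
  then show ?thesis using x by blast
qed

lemma autonomous_solution_lipschitz:
  assumes sol: "autonomous_solution M F I x" and ab: "convex A" "A \<subseteq> I"
    and B: "\<And>t. t \<in> A \<Longrightarrow> norm (F (x t)) \<le> B" and st: "s \<in> A" "t \<in> A"
  shows "norm (x s - x t) \<le> B * norm (s - t)"
proof (rule differentiable_bound[OF ab(1) _ _ st(1,2), where f' = "\<lambda>t r. r *\<^sub>R F (x t)"])
  show "(x has_derivative (\<lambda>r. r *\<^sub>R F (x t))) (at t within A)" if "t \<in> A" for t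
    using sol ab that by (auto simp: autonomous_solution_def has_vector_derivative_def intro: has_derivative_at_withinI)
  show "onorm (\<lambda>r. r *\<^sub>R F (x t)) \<le> B" if "t \<in> A" for t
  proof (rule onorm_le)
    fix r :: real
    have "\<bar>r\<bar> * norm (F (x t)) \<le> \<bar>r\<bar> * B" by (rule mult_left_mono[OF B[OF that] abs_ge_zero])
    then show "norm (r *\<^sub>R F (x t)) \<le> B * norm r" by (simp add: mult.commute)
  qed
qed

text \<open>If the domain ended at \<open>b\<close>, compactness of \<open>S\<close> would make the
  solution Lipschitz and give it a limit in \<open>S\<close> at \<open>b\<close>. A solution through
  this limit continues it beyond \<open>b\<close>, contrary to maximality. The delicate point is
  differentiability at the junction.\<close>

lemma maximal_solution_global:
  assumes M: "closed M" and F: "continuous_on M F"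
    and ex: "\<And>p t. p \<in> M \<Longrightarrow> \<exists>I x. autonomous_solution M F I x \<and> t \<in> I \<and> x t = p"
    and max: "maximal_solution (autonomous_solution M F) I x" and t0: "t0 \<in> I"
    and S: "compact S" "S \<subseteq> M" "\<And>t. t \<in> I \<Longrightarrow> t0 \<le> t \<Longrightarrow> x t \<in> S"
  shows "{t0..} \<subseteq> I"
proof (rule ccontr)
  assume "\<not> {t0..} \<subseteq> I"
  then obtain s where s: "t0 \<le> s" "s \<notin> I" by auto
  have sol: "autonomous_solution M F I x" using max by (simp add: maximal_solution_def)
  then have I: "open I" "is_interval I" by (auto simp: autonomous_solution_def)
  have Is: "t < s" if "t \<in> I" for t
    using I(2) t0 that s unfolding is_interval_1 by (metis not_le)
  then have bdd: "bdd_above I" by (meson bdd_aboveI less_imp_le)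
  define b where "b = Sup I"
  have le_b: "t \<le> b" if "t \<in> I" for t unfolding b_def by (rule cSup_upper[OF that bdd])
  have bI: "b \<notin> I"
  proof
    assume "b \<in> I"
    then obtain e where "e > 0" "ball b e \<subseteq> I" using I(1) open_contains_ball by blast
    then have "b + e / 2 \<in> I" by (auto simp: subset_iff dist_real_def)
    then show False using le_b[of "b + e / 2"] \<open>e > 0\<close> by simp
  qed
  have t0b: "t0 < b" using le_b[OF t0] bI t0 by (cases "t0 = b") auto
  have sub: "{t0..<b} \<subseteq> I"
  proof
    fix t assume t: "t \<in> {t0..<b}"
    then obtain u where "u \<in> I" "t < u" unfolding b_def using t0 bdd less_cSup_iff[of I t] by auto
    then show "t \<in> I" using Icc_subset_interval[OF I(2) t0, of u] t by auto
  qed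
  have "compact (F ` S)" by (rule compact_continuous_image[OF continuous_on_subset[OF F S(2)] S(1)])
  then obtain B where B: "\<forall>y\<in>F ` S. norm y \<le> B" using compact_imp_bounded bounded_iff by blast
  have lip: "norm (x s - x t) \<le> B * norm (s - t)" if "s \<in> {t0..<b}" "t \<in> {t0..<b}" for s t
    by (rule autonomous_solution_lipschitz[OF sol _ sub _ that]) (use B S(3) sub in auto)
  have "B \<ge> 0" using B S(3)[OF t0] by (meson image_eqI norm_ge_zero order_trans order_refl)
  then have "B-lipschitz_on {t0..<b} x"
    unfolding lipschitz_on_def dist_norm using lip by auto
  then have "uniformly_continuous_on {t0..<b} x" by (rule lipschitz_on_uniformly_continuous)
  moreover have "b \<in> closure {t0..<b}" using t0b by simp
  ultimately obtain l where l: "(x \<longlongrightarrow> l) (at b within {t0..<b})"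
    by (rule uniformly_continuous_on_extension_at_closure)
  have nb: "at b within {t0..<b} \<noteq> bot"
    using t0b by (simp add: trivial_limit_within islimpt_in_closure)
  have "\<forall>\<^sub>F t in at b within {t0..<b}. x t \<in> S"
    unfolding eventually_at_filter using S(3) sub by (auto intro!: always_eventually)
  then have lS: "l \<in> S" using Lim_in_closed_set[OF compact_imp_closed[OF S(1)] _ nb l] by blast
  then obtain J z where z: "autonomous_solution M F J z" "b \<in> J" "z b = l" using ex S(2) by blast
  obtain e where e: "e > 0" "ball b e \<subseteq> J"
    using z(1,2) open_contains_ball unfolding autonomous_solution_def by blast
  \<comment> \<open>Small enough that the new interval lies in \<open>J\<close> and does not reach
    back beyond \<open>t0\<close>.\<close>
  define d where "d = min e (b - t0)"
  have "{b-d<..<b+d} \<subseteq> ball b e" by (auto simp: d_def ball_eq_greaterThanLessThan)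
  then have d: "d > 0" "{b-d<..<b+d} \<subseteq> J" "d \<le> b - t0"
    using e t0b by (auto simp: d_def)
  define y where "y t = (if t < b then x t else z t)" for t
  have yM: "y t \<in> M" if "t \<in> I \<union> {b-d<..<b+d}" for t
  proof (cases "t < b")
    case True
    then have "t \<in> I" using that d(3) by (cases "t \<in> I") (auto intro!: subsetD[OF sub])
    then show ?thesis using True sol by (simp add: y_def autonomous_solution_def)
  next
    case False
    then have "t \<in> {b-d<..<b+d}" using that le_b[of t] bI d(1) by (cases "t = b") auto
    then have "t \<in> J" using d(2) by blast
    then show ?thesis using False z(1) by (simp add: y_def autonomous_solution_def)
  qed
  have yl: "y b = l" by (simp add: y_def z)
  have ycont: "continuous_on {t0..b} y"
    unfolding continuous_on_def
  proof
    fix t assume t: "t \<in> {t0..b}"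
    show "(y \<longlongrightarrow> y t) (at t within {t0..b})"
    proof (cases "t = b")
      case True
      have "at b within {t0..b} = at b within {t0..<b}"
        by (rule at_within_nhd[of _ "{t0<..}"]) (use t0b in auto)
      moreover have "\<forall>\<^sub>F t in at b within {t0..<b}. x t = y t"
        unfolding eventually_at_filter by (rule always_eventually) (simp add: y_def)
      then have "(y \<longlongrightarrow> l) (at b within {t0..<b})" by (rule Lim_transform_eventually[OF l])
      ultimately show ?thesis using True yl by simp
    next
      case False
      then have tb: "t < b" "t \<in> I" using t sub by auto
      have "isCont x t" using sol tb has_vector_derivative_continuous unfolding autonomous_solution_def by blast
      then have "(x \<longlongrightarrow> x t) (at t within {t0..b})" by (simp add: continuous_at_imp_continuous_at_within continuous_within[symmetric])
      moreover have "\<forall>\<^sub>F s in at t within {t0..b}. x s = y s"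
        unfolding eventually_at_topological
        by (rule exI[of _ "{..<b}"]) (use tb in \<open>auto simp: y_def\<close>)
      ultimately show ?thesis using tb by (auto simp: y_def intro: Lim_transform_eventually)
    qed
  qed
  have yint: "y t \<in> M" if "t \<in> {t0..b}" for t
  proof (rule yM)
    show "t \<in> I \<union> {b-d<..<b+d}" using that d(1) by (cases "t = b") (auto intro!: subsetD[OF sub])
  qed
  have Fy: "continuous_on {t0..b} (\<lambda>t. F (y t))"
    by (rule continuous_on_compose2[OF F ycont]) (use yint in auto)
  have der_lt: "(y has_vector_derivative F (y t)) (at t)" if "t \<in> I" "t < b" for t
  proof (rule has_vector_derivative_transform_within_open[of x _ _ "{..<b}"])
    show "(x has_vector_derivative F (y t)) (at t)"
      using sol that unfolding autonomous_solution_def y_def by auto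
  qed (use that in \<open>auto simp: y_def\<close>)
  \<comment> \<open>Holds up to and including \<open>b\<close>, since the fundamental theorem asks
    only for continuity at the end points. Differentiating the integral then gives the left
    derivative at \<open>b\<close>.\<close>
  have inteq: "y t = y t0 + integral {t0..t} (\<lambda>t. F (y t))" if t: "t \<in> {t0..b}" for t
  proof -
    have "((\<lambda>t. F (y t)) has_integral (y t - y t0)) {t0..t}"
    proof (rule fundamental_theorem_of_calculus_interior)
      show "continuous_on {t0..t} y" by (rule continuous_on_subset[OF ycont]) (use t in auto)
      show "(y has_vector_derivative F (y s)) (at s)" if "s \<in> {t0<..<t}" for s
        by (rule der_lt) (use that t sub in auto)
    qed (use t in auto)
    then show ?thesis by (simp add: integral_unique)
  qed
  have left: "(y has_vector_derivative F (y b)) (at b within {..b})"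
  proof -
    have b: "b \<in> {t0..b}" using t0b by simp
    have "((\<lambda>t. y t0 + integral {t0..t} (\<lambda>t. F (y t))) has_vector_derivative 0 + F (y b)) (at b within {t0..b})"
      by (intro has_vector_derivative_add has_vector_derivative_const integral_has_vector_derivative Fy b)
    then have "((\<lambda>t. y t0 + integral {t0..t} (\<lambda>t. F (y t))) has_vector_derivative F (y b)) (at b within {t0..b})"
      by simp
    then have "(y has_vector_derivative F (y b)) (at b within {t0..b})"
      by (rule has_vector_derivative_transform[OF b, rotated]) (rule inteq)
    moreover have "at b within {..b} = at b within {t0..b}"
      by (rule at_within_nhd[of _ "{t0<..}"]) (use t0b in auto)
    ultimately show ?thesis by simp
  qed
  have right: "(y has_vector_derivative F (y b)) (at b within {b..})"
  proof (rule has_vector_derivative_transform[of b "{b..}" y z])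
    show "(z has_vector_derivative F (y b)) (at b within {b..})"
      using z unfolding yl autonomous_solution_def by (blast intro: has_vector_derivative_at_within)
  qed (auto simp: y_def)
  have der_gt: "(y has_vector_derivative F (y t)) (at t)" if "t \<in> {b-d<..<b+d}" "t > b" for t
  proof (rule has_vector_derivative_transform_within_open[of z _ _ "{b<..}"])
    show "(z has_vector_derivative F (y t)) (at t)"
      using z(1) subsetD[OF d(2), of t] that unfolding autonomous_solution_def y_def by simp
  qed (use that in \<open>auto simp: y_def\<close>)
  have der: "(y has_vector_derivative F (y t)) (at t)" if "t \<in> I \<union> {b-d<..<b+d}" for t
  proof -
    consider "t < b" | "t = b" | "t > b" by linarith
    then show ?thesis
    proof cases
      case 1
      have "t \<in> I" using that 1 d(3) by (cases "t \<in> I") (auto intro!: subsetD[OF sub])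
      then show ?thesis using der_lt 1 by blast
    next
      case 2
      then show ?thesis using has_vector_derivative_at_split[OF left right] by simp
    next
      case 3
      then show ?thesis using der_gt that le_b[of t] by auto
    qed
  qed
  have "is_interval (I \<union> {b-d<..<b+d})"
  proof -
    have "connected (I \<union> {b-d<..<b+d})"
    proof (rule connected_Un)
      have "b - d / 2 \<in> I" using d by (intro subsetD[OF sub]) auto
      then have "b - d / 2 \<in> I \<inter> {b-d<..<b+d}" using d(1) by auto
      then show "I \<inter> {b-d<..<b+d} \<noteq> {}" by blast
    qed (use I(2) in \<open>auto simp: is_interval_connected_1\<close>)
    then show ?thesis by (simp add: is_interval_connected_1)
  qed
  then have "autonomous_solution M F (I \<union> {b-d<..<b+d}) y"
    unfolding autonomous_solution_def using I(1) yM der by (auto intro: open_Un)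
  moreover have "\<forall>t\<in>I. y t = x t" using le_b bI unfolding y_def by (metis order_le_less)
  ultimately have eq: "I \<union> {b-d<..<b+d} = I" using max unfolding maximal_solution_def by blast
  have "b \<in> I \<union> {b-d<..<b+d}" using d(1) by simp
  then show False unfolding eq using bI by (rule notE[rotated])
qed

section \<open>A LaSalle criterion for uniform asymptotic stability\<close>

lemma derivative_upper_bound:
  fixes f :: "real \<Rightarrow> real"
  assumes "a \<le> b" "\<And>t. t \<in> {a..b} \<Longrightarrow> (f has_real_derivative f' t) (at t)"
    "\<And>t. t \<in> {a..b} \<Longrightarrow> f' t \<le> c"
  shows "f b \<le> f a + c * (b - a)"
proof (cases "a = b")
  case False
  then have "a < b" using assms(1) by simp
  from MVT2[OF this, of f f'] assms(2) obtain z where z: "a < z" "z < b" "f b - f a = (b - a) * f' z" by auto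
  have "(b - a) * f' z \<le> (b - a) * c" using z assms(3)[of z] by (intro mult_left_mono) auto
  then show ?thesis using z(3) by (simp add: mult.commute)
qed simp

text \<open>\<open>w\<close> is the rate of change of \<open>V\<close>, postulated along solutions
  because \<open>M\<close> may have no interior on which to differentiate \<open>V\<close>.
  \<open>P\<close> is a linear observable: dissipation is strict where it is nonzero, and where
  dissipation stops at a level in \<open>{0<..l}\<close>, the observable changes at nonzero
  speed.\<close>

locale dissipative_system =
  fixes M :: "'x::euclidean_space set" and F :: "'x \<Rightarrow> 'x" and V w :: "'x \<Rightarrow> real" and l :: real
    and P :: "'x \<Rightarrow> 'y::euclidean_space"
  assumes closed_M: "closed M" and cont_F: "continuous_on M F"
    and local_existence: "p \<in> M \<Longrightarrow> \<exists>I x. autonomous_solution M F I x \<and> t \<in> I \<and> x t = p"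
    and cont_V: "continuous_on M V" and cont_w: "continuous_on M w"
    and w_nonpos: "p \<in> M \<Longrightarrow> w p \<le> 0"
    and V_derivative: "autonomous_solution M F I x \<Longrightarrow> t \<in> I \<Longrightarrow>
      ((\<lambda>t. V (x t)) has_real_derivative w (x t)) (at t)"
    and l_pos: "0 < l" and compact_sublevel: "compact {p \<in> M. V p \<le> l}"
    and linear_P: "bounded_linear P"
    and w_neg: "p \<in> M \<Longrightarrow> P p \<noteq> 0 \<Longrightarrow> w p < 0"
    and P_moves: "p \<in> M \<Longrightarrow> V p \<le> l \<Longrightarrow> 0 < V p \<Longrightarrow> w p = 0 \<Longrightarrow> P (F p) \<noteq> 0"
begin

abbreviation sol where "sol \<equiv> autonomous_solution M F"

definition S where "S = {p \<in> M. V p \<le> l}"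

lemma compact_S: "compact S" and S_M: "S \<subseteq> M"
  using compact_sublevel by (auto simp: S_def)

lemma V_mono:
  assumes x: "sol I x" and ab: "a \<in> I" "b \<in> I" "a \<le> b"
  shows "V (x b) \<le> V (x a)"
proof -
  have I: "{a..b} \<subseteq> I" using x ab Icc_subset_interval by (auto simp: autonomous_solution_def)
  have "V (x b) \<le> V (x a) + 0 * (b - a)"
  proof (rule derivative_upper_bound[OF ab(3), where f = "\<lambda>t. V (x t)"])
    show "((\<lambda>t. V (x t)) has_real_derivative w (x t)) (at t)" if "t \<in> {a..b}" for t
      using V_derivative[OF x] I that by auto
    show "w (x t) \<le> 0" if "t \<in> {a..b}" for t
      using w_nonpos x I that by (auto simp: autonomous_solution_def)
  qed
  then show ?thesis by simp
qed

lemma maximal_solution_in_sublevel: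
  assumes max: "maximal_solution sol I x" and t0: "t0 \<in> I" and V: "V (x t0) \<le> l"
  shows "{t0..} \<subseteq> I" "\<And>t. t \<ge> t0 \<Longrightarrow> x t \<in> S" "\<And>t. t \<ge> t0 \<Longrightarrow> V (x t) \<le> V (x t0)"
proof -
  have x: "sol I x" using max by (simp add: maximal_solution_def)
  have S: "x t \<in> S" if "t \<in> I" "t0 \<le> t" for t
    using V_mono[OF x t0 that] V x that(1) by (auto simp: S_def autonomous_solution_def)
  show *: "{t0..} \<subseteq> I"
    by (rule maximal_solution_global[OF closed_M cont_F local_existence max t0 compact_S S_M S])
  show "x t \<in> S" if "t \<ge> t0" for t using S * that by auto
  show "V (x t) \<le> V (x t0)" if "t \<ge> t0" for t using V_mono[OF x t0] * that by auto
qed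

section \<open>Decrease of \<open>V\<close> along trajectories, locally and uniformly\<close>

definition trajectory :: "real \<Rightarrow> (real \<Rightarrow> 'x) \<Rightarrow> bool" where
  "trajectory t0 x \<longleftrightarrow> (\<exists>I. sol I x \<and> {t0..} \<subseteq> I) \<and> (\<forall>t\<ge>t0. x t \<in> S)"

lemma trajectory_shift: "trajectory t0 x \<Longrightarrow> t0 \<le> t1 \<Longrightarrow> trajectory t1 x"
  unfolding trajectory_def by (meson atLeast_subset_iff order_trans)

lemma trajectory_mono:
  assumes x: "trajectory t0 x" and ab: "t0 \<le> a" "a \<le> b"
  shows "V (x b) \<le> V (x a)"
proof -
  obtain I where I: "sol I x" "{t0..} \<subseteq> I" using x unfolding trajectory_def by auto
  show ?thesis by (rule V_mono[OF I(1)]) (use I(2) ab in auto)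
qed

lemma trajectory_decrease:
  assumes x: "trajectory t0 x" and ab: "t0 \<le> a" "a \<le> b"
    and c: "\<And>t. t \<in> {a..b} \<Longrightarrow> w (x t) \<le> c"
  shows "V (x b) \<le> V (x a) + c * (b - a)"
proof -
  obtain I where I: "sol I x" "{t0..} \<subseteq> I" using x unfolding trajectory_def by auto
  show ?thesis
    by (rule derivative_upper_bound[OF ab(2) V_derivative[OF I(1)] c]) (use I(2) ab in auto)
qed

lemma speed_bound:
  obtains B where "B > 0" "\<And>t0 x t. trajectory t0 x \<Longrightarrow> t0 \<le> t \<Longrightarrow> norm (x t - x t0) \<le> B * (t - t0)"
proof -
  have "compact (F ` S)" by (rule compact_continuous_image[OF continuous_on_subset[OF cont_F S_M] compact_S])
  from compact_imp_bounded[OF this] obtain B where B: "\<forall>y\<in>F ` S. norm y \<le> B" unfolding bounded_iff ..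
  have "norm (x t - x t0) \<le> (\<bar>B\<bar> + 1) * (t - t0)" if x: "trajectory t0 x" and t: "t0 \<le> t" for t0 x t
  proof -
    obtain I where I: "sol I x" "{t0..} \<subseteq> I" using x unfolding trajectory_def by auto
    have "norm (x t - x t0) \<le> (\<bar>B\<bar> + 1) * norm (t - t0)"
    proof (rule autonomous_solution_lipschitz[OF I(1), of "{t0..}"])
      show "norm (F (x s)) \<le> \<bar>B\<bar> + 1" if "s \<in> {t0..}" for s
      proof -
        have "x s \<in> S" using x that by (simp add: trajectory_def)
        then have "norm (F (x s)) \<le> B" using B by blast
        then show ?thesis by linarith
      qed
    qed (use I t in auto)
    then show ?thesis using t by simp
  qed
  then show ?thesis by (intro that[of "\<bar>B\<bar> + 1"]) auto
qed

text \<open>Where \<open>w\<close> vanishes, \<open>P (F p) \<noteq> 0\<close> forces solutions to move into the region \<open>P x \<noteq> 0\<close>,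
  where \<open>w\<close> is negative, at a speed that is uniform near \<open>p\<close>.\<close>

lemma local_decrease:
  assumes p: "p \<in> S" and Vp: "0 < V p"
  shows "\<exists>U \<tau> \<delta>. open U \<and> p \<in> U \<and> \<tau> > 0 \<and> \<delta> > 0 \<and>
    (\<forall>t0 x. trajectory t0 x \<longrightarrow> x t0 \<in> U \<longrightarrow> V (x (t0 + \<tau>)) \<le> V (x t0) - \<delta>)"
proof -
  obtain B where B: "B > 0" "\<And>t0 x t. trajectory t0 x \<Longrightarrow> t0 \<le> t \<Longrightarrow> norm (x t - x t0) \<le> B * (t - t0)"
    using speed_bound by metis
  have pM: "p \<in> M" "V p \<le> l" using p by (auto simp: S_def)
  \<comment> \<open>At speed at most \<open>B\<close> a time of \<open>r / (4 * B)\<close> covers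
    only \<open>r / 4\<close>, so a start in the half ball cannot leave the ball of radius
    \<open>r\<close>.\<close>
  have near: "x t \<in> ball p r"
    if x: "trajectory t0 x" "x t0 \<in> ball p (r / 2)" and t: "t \<in> {t0..t0 + r / (4 * B)}" and r: "r > 0" for x t0 t r
  proof -
    have "norm (x t - x t0) \<le> B * (t - t0)" using B(2)[OF x(1)] t by auto
    also have "\<dots> \<le> B * (r / (4 * B))" using t B(1) by (intro mult_left_mono) auto
    also have "\<dots> < r / 2" using B(1) r by simp
    finally have "dist (x t0) (x t) < r / 2" by (simp add: dist_norm norm_minus_commute)
    then show ?thesis using x(2) dist_triangle_half_r[of "x t0" p r "x t"] by (simp add: dist_commute)
  qed
  show ?thesis
  proof (cases "w p = 0")
    case False
    then have wp: "w p < 0" using w_nonpos[OF pM(1)] by simp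
    have "\<forall>e>0. \<exists>d>0. \<forall>q\<in>M. dist q p < d \<longrightarrow> dist (w q) (w p) < e"
      using cont_w pM(1) unfolding continuous_on_iff by blast
    then obtain r where r: "r > 0" "\<forall>q\<in>M. dist q p < r \<longrightarrow> dist (w q) (w p) < - w p / 2"
      using wp by (metis half_gt_zero neg_0_less_iff_less)
    have r2: "w q \<le> w p / 2" if "q \<in> M" "q \<in> ball p r" for q
    proof -
      have "dist (w q) (w p) < - w p / 2" using r(2) that by (simp add: dist_commute[of p q])
      then show ?thesis by (simp add: dist_real_def abs_less_iff)
    qed
    define \<tau> where "\<tau> = r / (4 * B)"
    have \<tau>: "\<tau> > 0" using r B by (simp add: \<tau>_def)
    have "V (x (t0 + \<tau>)) \<le> V (x t0) - (- (w p / 2) * \<tau>)" if x: "trajectory t0 x" "x t0 \<in> ball p (r / 2)" for t0 x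
    proof -
      have "V (x (t0 + \<tau>)) \<le> V (x t0) + (w p / 2) * (t0 + \<tau> - t0)"
      proof (rule trajectory_decrease[OF x(1)])
        show "w (x t) \<le> w p / 2" if "t \<in> {t0..t0 + \<tau>}" for t
        proof (rule r2)
          show "x t \<in> M" using x(1) that S_M by (auto simp: trajectory_def)
          show "x t \<in> ball p r" using near[OF x] that r(1) by (simp add: \<tau>_def)
        qed
      qed (use \<tau> in auto)
      then show ?thesis by simp
    qed
    moreover have "- (w p / 2) * \<tau> > 0" using wp \<tau> by (simp add: mult_neg_pos)
    ultimately show ?thesis using r(1) \<tau>
      by (intro exI[of _ "ball p (r / 2)"] exI[of _ \<tau>] exI[of _ "- (w p / 2) * \<tau>"]) auto
  next
    case True
    \<comment> \<open>The velocity of the observable at \<open>p\<close>. As long as a solution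
      stays near \<open>p\<close>, the quantity \<open>P x \<bullet> a\<close> grows at rate at
      least \<open>a \<bullet> a / 2\<close>.\<close>
    define a where "a = P (F p)"
    have a: "a \<noteq> 0" unfolding a_def by (rule P_moves[OF pM Vp True])
    have Pp: "P p = 0" using w_neg[OF pM(1)] True by force
    have "continuous_on M (\<lambda>q. P (F q) \<bullet> a)"
      by (intro continuous_intros bounded_linear.continuous_on[OF linear_P] cont_F)
    then have "\<forall>e>0. \<exists>d>0. \<forall>q\<in>M. dist q p < d \<longrightarrow> dist (P (F q) \<bullet> a) (P (F p) \<bullet> a) < e"
      using pM(1) unfolding continuous_on_iff by blast
    moreover have aa: "a \<bullet> a / 2 > 0" using a by simp
    ultimately obtain r where r: "r > 0"
      "\<forall>q\<in>M. dist q p < r \<longrightarrow> dist (P (F q) \<bullet> a) (P (F p) \<bullet> a) < a \<bullet> a / 2" by blast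
    have r2: "P (F q) \<bullet> a \<ge> a \<bullet> a / 2" if "q \<in> M" "q \<in> ball p r" for q
    proof -
      have "dist (P (F q) \<bullet> a) (a \<bullet> a) < a \<bullet> a / 2" using r(2) that by (simp add: dist_commute[of p q] a_def)
      then show ?thesis unfolding dist_real_def by linarith
    qed
    define \<tau> where "\<tau> = r / (4 * B)"
    have \<tau>: "\<tau> > 0" using r B by (simp add: \<tau>_def)
    \<comment> \<open>Within time \<open>\<tau> / 2\<close> the quantity
      \<open>P x \<bullet> a\<close> gains at least \<open>2 * \<sigma>\<close>, so a start above
      \<open>-\<sigma>\<close> is led above \<open>\<sigma>\<close>, away from the zero set of
      \<open>P\<close>; the second half of the time then yields the loss of
      \<open>V\<close>.\<close>
    define \<sigma> where "\<sigma> = (a \<bullet> a) * \<tau> / 8"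
    have \<sigma>: "\<sigma> > 0" using a \<tau> by (simp add: \<sigma>_def)
    \<comment> \<open>Starts with \<open>P q \<bullet> a\<close> too negative are excluded, since
      they might only just reach \<open>P x = 0\<close> in the meantime.\<close>
    define U where "U = ball p (r / 2) \<inter> {q. - \<sigma> < P q \<bullet> a}"
    have contP: "continuous_on UNIV (\<lambda>q. P q \<bullet> a)"
      by (intro continuous_intros bounded_linear.continuous_on[OF linear_P])
    have U: "open U" "p \<in> U"
      unfolding U_def using r(1) \<sigma> Pp
      by (auto intro!: open_Int open_Collect_less continuous_on_const contP)
    define K where "K = S \<inter> {q. \<sigma> \<le> P q \<bullet> a}"
    have "compact K" unfolding K_def
      by (intro compact_Int_closed compact_S closed_Collect_le continuous_on_const contP)
    have wK: "w q < 0" if "q \<in> K" for q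
      using that \<sigma> S_M by (intro w_neg) (auto simp: K_def)
    obtain m where m: "m > 0" "\<And>q. q \<in> K \<Longrightarrow> w q \<le> - m"
    proof (cases "K = {}")
      case True
      then show ?thesis using that[of 1] by simp
    next
      case False
      have "continuous_on K w" by (rule continuous_on_subset[OF cont_w]) (use S_M in \<open>auto simp: K_def\<close>)
      from continuous_attains_sup[OF \<open>compact K\<close> False this]
      obtain q where q: "q \<in> K" "\<forall>y\<in>K. w y \<le> w q" by blast
      then show ?thesis using that[of "- w q"] wK[OF q(1)] by simp
    qed
    have "V (x (t0 + \<tau>)) \<le> V (x t0) - m * \<tau> / 2" if x: "trajectory t0 x" "x t0 \<in> U" for t0 x
    proof -
      have x0: "x t0 \<in> ball p (r / 2)" "- \<sigma> < P (x t0) \<bullet> a" using x(2) by (auto simp: U_def)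
      obtain I where I: "sol I x" "{t0..} \<subseteq> I" using x(1) unfolding trajectory_def by auto
      have inK: "x t \<in> K" if t: "t \<in> {t0 + \<tau> / 2..t0 + \<tau>}" for t
      proof -
        have t0t: "t0 \<le> t" using t \<tau> by auto
        have "- (P (x t) \<bullet> a) \<le> - (P (x t0) \<bullet> a) + (- (a \<bullet> a / 2)) * (t - t0)"
        proof (rule derivative_upper_bound[OF t0t])
          fix s assume s: "s \<in> {t0..t}"
          have sM: "x s \<in> M" using x(1) s S_M by (auto simp: trajectory_def)
          have "(x has_vector_derivative F (x s)) (at s)"
            using I s by (auto simp: autonomous_solution_def)
          then have "((\<lambda>s. P (x s) \<bullet> a) has_vector_derivative P (F (x s)) \<bullet> a) (at s)"
            by (intro bounded_linear.has_vector_derivative[OF bounded_linear_inner_left]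
                bounded_linear.has_vector_derivative[OF linear_P])
          then show "((\<lambda>s. - (P (x s) \<bullet> a)) has_real_derivative - (P (F (x s)) \<bullet> a)) (at s)"
            by (intro DERIV_minus) (simp add: has_real_derivative_iff_has_vector_derivative)
          have "x s \<in> ball p r" using near[OF x(1) x0(1) _ r(1)] s t by (simp add: \<tau>_def)
          then show "- (P (F (x s)) \<bullet> a) \<le> - (a \<bullet> a / 2)" using r2[OF sM] by simp
        qed
        then have "- (P (x t) \<bullet> a) \<le> - (P (x t0) \<bullet> a) - (a \<bullet> a / 2) * (t - t0)" by simp
        moreover have "(a \<bullet> a / 2) * (\<tau> / 2) = 2 * \<sigma>" by (simp add: \<sigma>_def)
        moreover have "(a \<bullet> a / 2) * (\<tau> / 2) \<le> (a \<bullet> a / 2) * (t - t0)"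
          using t aa by (intro mult_left_mono) auto
        ultimately have "P (x t) \<bullet> a \<ge> \<sigma>" using x0(2) by linarith
        then show ?thesis using x(1) t0t by (simp add: K_def trajectory_def)
      qed
      have "V (x (t0 + \<tau>)) \<le> V (x (t0 + \<tau> / 2)) + (- m) * ((t0 + \<tau>) - (t0 + \<tau> / 2))"
        by (rule trajectory_decrease[OF x(1)]) (use \<tau> m(2) inK in auto)
      moreover have "V (x (t0 + \<tau> / 2)) \<le> V (x t0)"
        by (rule trajectory_mono[OF x(1)]) (use \<tau> in auto)
      ultimately show ?thesis by (simp add: algebra_simps)
    qed
    moreover have "m * \<tau> / 2 > 0" using m \<tau> by simp
    ultimately show ?thesis using U \<tau> by (intro exI[of _ U] exI[of _ \<tau>] exI[of _ "m * \<tau> / 2"]) auto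
  qed
qed

text \<open>Finitely many of the local neighbourhoods cover the part of \<open>S\<close> at or above
  level \<open>c\<close>. The longest of their times serves all of them because \<open>V\<close>
  never increases.\<close>

lemma uniform_decrease:
  assumes c: "c > 0"
  obtains \<tau> \<delta> where "\<tau> > 0" "\<delta> > 0"
    "\<And>t0 x. trajectory t0 x \<Longrightarrow> c \<le> V (x t0) \<Longrightarrow> V (x (t0 + \<tau>)) \<le> V (x t0) - \<delta>"
proof -
  define K where "K = {p \<in> S. c \<le> V p}"
  have "closed {p \<in> S. c \<le> V p}"
    by (rule continuous_closed_preimage[of S V "{c..}", unfolded vimage_def Int_def, simplified])
      (auto intro: continuous_on_subset[OF cont_V S_M] compact_imp_closed compact_S)
  then have "compact (S \<inter> K)" unfolding K_def by (rule compact_Int_closed[OF compact_S])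
  then have K: "compact K" by (simp add: K_def Int_absorb1 Collect_mono_iff subset_iff Int_def cong: conj_cong)
  have "\<forall>p\<in>K. \<exists>U \<tau> \<delta>. open U \<and> p \<in> U \<and> \<tau> > 0 \<and> \<delta> > 0 \<and>
    (\<forall>t0 x. trajectory t0 x \<longrightarrow> x t0 \<in> U \<longrightarrow> V (x (t0 + \<tau>)) \<le> V (x t0) - \<delta>)"
    using local_decrease c by (auto simp: K_def)
  then obtain U \<tau> \<delta> where U: "\<forall>p\<in>K. open (U p) \<and> p \<in> U p \<and> \<tau> p > 0 \<and> \<delta> p > 0 \<and>
    (\<forall>t0 x. trajectory t0 x \<longrightarrow> x t0 \<in> U p \<longrightarrow> V (x (t0 + \<tau> p)) \<le> V (x t0) - (\<delta> p :: real))"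
    unfolding bchoice_iff by (elim exE)
  obtain D where D: "D \<subseteq> K" "finite D" "K \<subseteq> (\<Union>p\<in>D. U p)"
    by (rule compactE_image[OF K, of K U]) (use U in auto)
  \<comment> \<open>The inserted 1 keeps the maximum and the minimum meaningful when the cover is
    empty.\<close>
  define t where "t = Max (insert 1 (\<tau> ` D))"
  define d where "d = Min (insert 1 (\<delta> ` D))"
  have fin: "finite (insert 1 (\<tau> ` D))" "finite (insert 1 (\<delta> ` D))" using D by auto
  have "t \<ge> 1" unfolding t_def by (rule Max_ge[OF fin(1)]) simp
  have "d > 0" unfolding d_def using fin(2) U D(1) by (subst Min_gr_iff) auto
  show ?thesis
  proof (rule that[of t d])
    fix t0 x assume x: "trajectory t0 x" "c \<le> V (x t0)"
    then have "x t0 \<in> K" by (simp add: K_def trajectory_def)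
    then obtain p where p: "p \<in> D" "x t0 \<in> U p" using D(3) by blast
    then have pK: "p \<in> K" using D(1) by blast
    have le: "\<tau> p \<le> t" "d \<le> \<delta> p"
      unfolding t_def d_def using fin p(1) by (auto intro!: Max_ge Min_le)
    have "V (x (t0 + t)) \<le> V (x (t0 + \<tau> p))"
      by (rule trajectory_mono[OF x(1)]) (use le U pK in \<open>auto simp: less_imp_le\<close>)
    also have "\<dots> \<le> V (x t0) - \<delta> p" using U pK x(1) p(2) by blast
    finally show "V (x (t0 + t)) \<le> V (x t0) - d" using le by simp
  qed (use \<open>t \<ge> 1\<close> \<open>d > 0\<close> in auto)
qed

text \<open>As long as \<open>V\<close> stays at or above \<open>c\<close>, each step costs
  \<open>\<delta>\<close>, and the initial budget is at most \<open>l\<close>. With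
  \<open>n * \<delta> > l\<close> it would be overdrawn, so \<open>V\<close> has fallen to
  \<open>c\<close> by step \<open>n\<close> and remains there by monotonicity.\<close>

lemma uniform_attraction:
  assumes c: "c > 0"
  obtains \<Delta> where "\<Delta> > 0" "\<And>t0 x t. trajectory t0 x \<Longrightarrow> t0 + \<Delta> \<le> t \<Longrightarrow> V (x t) \<le> c"
proof -
  obtain \<tau> \<delta> where td: "\<tau> > 0" "\<delta> > 0"
    "\<And>t0 x. trajectory t0 x \<Longrightarrow> c \<le> V (x t0) \<Longrightarrow> V (x (t0 + \<tau>)) \<le> V (x t0) - \<delta>"
    using uniform_decrease[OF c] by metis
  have step: "V (x (t0 + real n * \<tau>)) \<le> c \<or> V (x (t0 + real n * \<tau>)) \<le> l - real n * \<delta>"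
    if x: "trajectory t0 x" for t0 x n
  proof (induction n)
    case 0
    show ?case using x by (auto simp: trajectory_def S_def)
  next
    case (Suc n)
    let ?t = "t0 + real n * \<tau>"
    have t: "t0 \<le> ?t" using td(1) by simp
    have xt: "trajectory ?t x" by (rule trajectory_shift[OF x t])
    have eq: "t0 + real (Suc n) * \<tau> = ?t + \<tau>" by (simp add: algebra_simps)
    show ?case
    proof (cases "c \<le> V (x ?t)")
      case True
      then have "V (x (?t + \<tau>)) \<le> V (x ?t) - \<delta>" using td(3) xt by blast
      then show ?thesis unfolding eq using Suc td(2) by (auto simp: algebra_simps)
    next
      case False
      have "V (x (?t + \<tau>)) \<le> V (x ?t)" by (rule trajectory_mono[OF xt]) (use td(1) in auto)
      then show ?thesis unfolding eq using False by simp
    qed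
  qed
  obtain n where n: "l < real n * \<delta>" using td(2) ex_less_of_nat_mult by blast
  \<comment> \<open>\<open>Suc n\<close> in place of \<open>n\<close> makes \<open>\<Delta>\<close>
    positive without inspecting \<open>n\<close>.\<close>
  show ?thesis
  proof (rule that[of "real (Suc n) * \<tau>"])
    show "0 < real (Suc n) * \<tau>" using td(1) by simp
    fix t0 x t assume x: "trajectory t0 x" and t: "t0 + real (Suc n) * \<tau> \<le> t"
    have "V (x (t0 + real n * \<tau>)) \<le> c" using step[OF x, of n] n c by linarith
    moreover have "V (x t) \<le> V (x (t0 + real n * \<tau>))"
      by (rule trajectory_mono[OF x]) (use t td(1) in \<open>auto simp: algebra_simps\<close>)
    ultimately show "V (x t) \<le> c" by simp
  qed
qed

lemma compact_zero_set: "compact {p \<in> M. V p \<le> 0}"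
proof -
  have "{p \<in> M. V p \<le> 0} = S \<inter> (M \<inter> V -` {..0})" using l_pos by (auto simp: S_def)
  moreover have "closed (M \<inter> V -` {..0})"
    by (rule continuous_closed_preimage[OF cont_V closed_M]) simp
  ultimately show ?thesis using compact_Int_closed[OF compact_S] by simp
qed

lemma open_sublevel:
  obtains U where "open U" "U \<inter> M = {p \<in> M. V p < c}"
proof -
  have "\<exists>A. open A \<and> A \<inter> M = V -` {..<c} \<inter> M"
    using cont_V unfolding continuous_on_open_invariant by simp
  then obtain A where "open A" "A \<inter> M = V -` {..<c} \<inter> M" by blast
  then show ?thesis by (intro that[of A]) auto
qed

text \<open>What remains is a translation between levels of \<open>V\<close> and distances to its
  zero set: \<open>small\<close> and \<open>close\<close> give the two directions, both by
  compactness. The bounds along trajectories do not involve the initial time, which makes everything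
  uniform in it.\<close>

theorem lasalle_stability:
  assumes ne: "{p \<in> M. V p \<le> 0} \<noteq> {}"
  shows "uniformly_asymptotically_stable M sol {p \<in> M. V p \<le> l} {p \<in> M. V p \<le> 0}"
proof -
  define K where "K = {p \<in> M. V p \<le> 0}"
  have K: "K \<noteq> {}" "compact K" "K \<subseteq> M" using ne compact_zero_set by (auto simp: K_def)
  \<comment> \<open>Treats every maximal solution through \<open>p\<close> at once: there is one, by
    extension of a local solution, and each of them is a trajectory.\<close>
  have sat: "maximal_solution_satisfies sol t0 p Q"
    if p: "p \<in> M" "V p \<le> l" and Q: "\<And>x t. trajectory t0 x \<Longrightarrow> V (x t0) = V p \<Longrightarrow> t0 \<le> t \<Longrightarrow> Q t (x t)" for p t0 Q
    unfolding maximal_solution_satisfies_def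
  proof (intro conjI allI impI)
    from local_existence[OF p(1), of t0] obtain I0 x0 where x0: "sol I0 x0" "t0 \<in> I0" "x0 t0 = p" by blast
    then show "\<exists>I x. maximal_solution sol I x \<and> t0 \<in> I \<and> x t0 = p"
      using maximal_solution_exists[OF x0(1,2)] by simp
    fix I x assume x: "maximal_solution sol I x" "t0 \<in> I" "x t0 = p"
    have V: "V (x t0) \<le> l" using x(3) p by simp
    note glob = maximal_solution_in_sublevel[OF x(1,2) V]
    show "{t0..} \<subseteq> I" by (rule glob(1))
    fix t assume t: "t0 \<le> t"
    have "trajectory t0 x"
      using x(1) glob(1,2) unfolding trajectory_def maximal_solution_def by blast
    then show "Q t (x t)" by (rule Q[OF _ _ t]) (simp add: x(3))
  qed
  \<comment> \<open>On the part of \<open>S\<close> at distance at least \<open>\<epsilon>\<close>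
    from \<open>K\<close> the function \<open>V\<close> has a positive minimum \<open>V a\<close>; a
    level of at most half of it excludes this part.\<close>
  have small: "\<exists>c>0. c \<le> l \<and> (\<forall>p\<in>M. V p \<le> c \<longrightarrow> infdist p K \<le> \<epsilon>)" if \<epsilon>: "\<epsilon> > 0" for \<epsilon>
  proof -
    define A where "A = S \<inter> {p. \<epsilon> \<le> infdist p K}"
    have A: "compact A" unfolding A_def
      by (intro compact_Int_closed compact_S closed_Collect_le continuous_on_const continuous_on_infdist continuous_on_id)
    show ?thesis
    proof (cases "A = {}")
      case True
      then have "infdist p K \<le> \<epsilon>" if "p \<in> M" "V p \<le> l" for p
        using that by (force simp: A_def S_def)
      then show ?thesis using l_pos by (intro exI[of _ l]) auto
    next
      case False
      have "continuous_on A V" by (rule continuous_on_subset[OF cont_V]) (use S_M in \<open>auto simp: A_def\<close>)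
      from continuous_attains_inf[OF A False this] obtain a where a: "a \<in> A" "\<forall>y\<in>A. V a \<le> V y" by blast
      have "V a > 0"
      proof (rule ccontr)
        assume "\<not> V a > 0"
        then have "a \<in> K" using a(1) S_M by (auto simp: A_def K_def)
        then show False using a(1) \<epsilon> by (auto simp: A_def)
      qed
      moreover have "infdist p K \<le> \<epsilon>" if "p \<in> M" "V p \<le> min l (V a / 2)" for p
      proof (rule ccontr)
        assume "\<not> infdist p K \<le> \<epsilon>"
        then have "p \<in> A" using that by (auto simp: A_def S_def)
        then show False using a(2) that(2) \<open>V a > 0\<close> by force
      qed
      ultimately show ?thesis using l_pos by (intro exI[of _ "min l (V a / 2)"]) auto
    qed
  qed
  \<comment> \<open>\<open>K\<close> has positive distance from the closed complement of an ambient
    open set whose trace on \<open>M\<close> is the region \<open>V p < c\<close>.\<close>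
  have close: "\<exists>\<delta>>0. \<forall>p\<in>M. infdist p K \<le> \<delta> \<longrightarrow> V p \<le> c" if c: "c > 0" for c
  proof -
    obtain U where U: "open U" "U \<inter> M = {p \<in> M. V p < c}" using open_sublevel .
    have "p \<in> U" if "p \<in> K" for p
    proof -
      have "p \<in> U \<inter> M" unfolding U(2) using that c by (simp add: K_def)
      then show ?thesis by blast
    qed
    then have KU: "K \<inter> - U = {}" by blast
    have "closed (- U)" using U(1) by (rule closed_Compl)
    from separate_compact_closed[OF K(2) this KU]
    obtain d where d: "d > 0" "\<And>a b. a \<in> K \<Longrightarrow> b \<in> - U \<Longrightarrow> d \<le> dist a b" by blast
    have "V p \<le> c" if p: "p \<in> M" "infdist p K \<le> d / 2" for p
    proof (rule ccontr)
      assume "\<not> V p \<le> c"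
      then have "p \<notin> U \<inter> M" unfolding U(2) by simp
      then have "p \<in> - U" using p(1) by blast
      obtain a where "a \<in> K" "infdist p K = dist p a"
        using infdist_attains_inf[OF compact_imp_closed[OF K(2)] K(1)] by blast
      then show False using d(2)[of a p] \<open>p \<in> - U\<close> p(2) d(1) by (simp add: dist_commute)
    qed
    then show ?thesis using d(1) by (intro exI[of _ "d / 2"]) auto
  qed
  have nb: "neighborhood_in M S K"
  proof -
    obtain U where U: "open U" "U \<inter> M = {p \<in> M. V p < l}" using open_sublevel .
    have "K \<subseteq> U"
    proof
      fix p assume "p \<in> K"
      then have "p \<in> U \<inter> M" unfolding U(2) using l_pos by (simp add: K_def)
      then show "p \<in> U" by blast
    qed
    moreover have "U \<inter> M \<subseteq> S" unfolding U(2) by (auto simp: S_def)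
    ultimately show ?thesis using U(1) S_M unfolding neighborhood_in_def by blast
  qed
  have "compact ((\<lambda>p. infdist p K) ` S)"
    by (intro compact_continuous_image compact_S continuous_on_infdist continuous_on_id)
  from compact_imp_bounded[OF this] obtain b where b: "\<forall>y\<in>(\<lambda>p. infdist p K) ` S. norm y \<le> b"
    unfolding bounded_iff ..
  \<comment> \<open>\<open>S\<close> is bounded, so one radius serves all \<open>r\<close> and
    \<open>\<epsilon>\<close>; the summand 1 makes it positive.\<close>
  define \<rho> where "\<rho> = \<bar>b\<bar> + 1"
  have \<rho>: "\<rho> > 0" "\<And>p. p \<in> S \<Longrightarrow> infdist p K \<le> \<rho>"
  proof -
    show "\<rho> > 0" by (simp add: \<rho>_def)
    fix p assume "p \<in> S"
    then have "norm (infdist p K) \<le> b" using b by blast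
    then show "infdist p K \<le> \<rho>" by (simp add: \<rho>_def)
  qed
  have i: "\<exists>\<delta>>0. \<forall>t0. \<forall>x0\<in>M. infdist x0 K \<le> \<delta> \<longrightarrow>
      maximal_solution_satisfies sol t0 x0 (\<lambda>t x. infdist x K \<le> \<epsilon>)" if \<epsilon>: "\<epsilon> > 0" for \<epsilon>
  proof -
    obtain c where c: "c > 0" "c \<le> l" "\<forall>p\<in>M. V p \<le> c \<longrightarrow> infdist p K \<le> \<epsilon>" using small[OF \<epsilon>] by blast
    obtain \<delta> where \<delta>: "\<delta> > 0" "\<forall>p\<in>M. infdist p K \<le> \<delta> \<longrightarrow> V p \<le> c" using close[OF c(1)] by blast
    have "maximal_solution_satisfies sol t0 p (\<lambda>t x. infdist x K \<le> \<epsilon>)"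
      if p: "p \<in> M" "infdist p K \<le> \<delta>" for t0 p
    proof (rule sat[OF p(1)])
      have Vp: "V p \<le> c" using \<delta>(2) p by blast
      then show "V p \<le> l" using c(2) by simp
      fix x t assume x: "trajectory t0 x" "V (x t0) = V p" "t0 \<le> t"
      have "x t \<in> M" using x S_M by (auto simp: trajectory_def)
      moreover have "V (x t) \<le> c" using trajectory_mono[OF x(1) order_refl x(3)] x(2) Vp by simp
      ultimately show "infdist (x t) K \<le> \<epsilon>" using c(3) by blast
    qed
    then show ?thesis using \<delta>(1) by blast
  qed
  have ii: "\<exists>\<Delta>>0. \<exists>\<rho>>0. \<forall>t0. \<forall>x0\<in>S. infdist x0 K \<le> r \<longrightarrow>
      maximal_solution_satisfies sol t0 x0
        (\<lambda>t x. infdist x K \<le> \<rho> \<and> (t \<ge> t0 + \<Delta> \<longrightarrow> infdist x K \<le> \<epsilon>))" if \<epsilon>: "\<epsilon> > 0" for r \<epsilon>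
  proof -
    obtain c where c: "c > 0" "c \<le> l" "\<forall>p\<in>M. V p \<le> c \<longrightarrow> infdist p K \<le> \<epsilon>" using small[OF \<epsilon>] by blast
    obtain \<Delta> where \<Delta>: "\<Delta> > 0" "\<And>t0 x t. trajectory t0 x \<Longrightarrow> t0 + \<Delta> \<le> t \<Longrightarrow> V (x t) \<le> c"
      using uniform_attraction[OF c(1)] by metis
    have "maximal_solution_satisfies sol t0 p
        (\<lambda>t x. infdist x K \<le> \<rho> \<and> (t \<ge> t0 + \<Delta> \<longrightarrow> infdist x K \<le> \<epsilon>))" if p: "p \<in> S" for t0 p
    proof (rule sat)
      show "p \<in> M" "V p \<le> l" using p by (auto simp: S_def)
      fix x t assume x: "trajectory t0 x" "V (x t0) = V p" "t0 \<le> t"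
      have xS: "x t \<in> S" using x by (simp add: trajectory_def)
      show "infdist (x t) K \<le> \<rho> \<and> (t \<ge> t0 + \<Delta> \<longrightarrow> infdist (x t) K \<le> \<epsilon>)"
      proof (intro conjI impI)
        show "infdist (x t) K \<le> \<rho>" by (rule \<rho>(2)[OF xS])
        assume "t0 + \<Delta> \<le> t"
        then have "V (x t) \<le> c" by (rule \<Delta>(2)[OF x(1)])
        then show "infdist (x t) K \<le> \<epsilon>" using c(3) xS S_M by blast
      qed
    qed
    then show ?thesis using \<Delta>(1) \<rho>(1) by blast
  qed
  show ?thesis
    unfolding uniformly_asymptotically_stable_def K_def[symmetric] S_def[symmetric]
    using K nb i ii by blast
qed

end

section \<open>The system as an autonomous equation on the state space\<close>

lemma mul_deriv_continuous:
  assumes "smooth_on UNIV \<alpha>"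
  shows "continuous_on UNIV (mul_deriv \<alpha>)"
proof -
  have "deriv \<alpha> z = frechet_derivative \<alpha> (at z) 1" for z
  proof (rule DERIV_imp_deriv)
    have d: "(\<alpha> has_derivative frechet_derivative \<alpha> (at z)) (at z)"
      by (rule smooth_on_has_derivative[OF assms UNIV_I])
    have "frechet_derivative \<alpha> (at z) = (*) (frechet_derivative \<alpha> (at z) 1)"
    proof
      fix v
      have "frechet_derivative \<alpha> (at z) (v *\<^sub>R 1) = v *\<^sub>R frechet_derivative \<alpha> (at z) 1"
        by (rule linear_scale[OF has_derivative_linear[OF d]])
      then show "frechet_derivative \<alpha> (at z) v = frechet_derivative \<alpha> (at z) 1 * v" by simp
    qed
    with d show "(\<alpha> has_real_derivative frechet_derivative \<alpha> (at z) 1) (at z)"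
      unfolding has_field_derivative_def by simp
  qed
  then have "mul_deriv \<alpha> = (\<lambda>z. \<alpha> z * frechet_derivative \<alpha> (at z) 1)"
    by (intro ext) (simp add: mul_deriv_def)
  moreover have "continuous_on UNIV (\<lambda>z. frechet_derivative \<alpha> (at z) 1)"
    by (intro smooth_on_continuous smooth_on_frechet_derivative[OF assms] smooth_on_ident smooth_on_const open_UNIV UNIV_I)
  ultimately show ?thesis
    using smooth_on_continuous[OF assms] by (simp add: continuous_on_mult)
qed

locale control_system = levi_civita_manifold Q g nabla
  for Q :: "'a::euclidean_space set" and g :: "'a \<Rightarrow> 'a \<Rightarrow> 'a \<Rightarrow> real"
    and nabla :: "('a \<Rightarrow> 'a) \<Rightarrow> ('a \<Rightarrow> 'a) \<Rightarrow> 'a \<Rightarrow> 'a" +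
  fixes R :: "'a \<Rightarrow> 'a \<Rightarrow> 'a" and \<psi> :: "'a \<Rightarrow> real" and \<alpha> :: "real \<Rightarrow> real" and \<kappa> h :: real
  assumes R_endo: "bundle_endomorphism Q R" and psi_smooth: "smooth_map Q \<psi>"
    and alpha_smooth: "smooth_on UNIV \<alpha>"
begin

abbreviation M where "M \<equiv> state_space Q"

abbreviation pos :: "('a \<times> 'a) \<times> real \<Rightarrow> 'a" where "pos x \<equiv> fst (fst x)"
abbreviation vel :: "('a \<times> 'a) \<times> real \<Rightarrow> 'a" where "vel x \<equiv> snd (fst x)"

lemma mem_M: "x \<in> M \<longleftrightarrow> pos x \<in> Q \<and> vel x \<in> T (pos x)"
  by (cases x) (auto simp: state_space_def tangent_bundle_def)

lemma closed_M: "closed M"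
  unfolding state_space_def by (intro closed_Times closed_tangent_bundle embedded closed_Q closed_UNIV)

lemma R_T: "q \<in> Q \<Longrightarrow> v \<in> T q \<Longrightarrow> R q v \<in> T q"
  using R_endo unfolding bundle_endomorphism_def by blast

lemma R_0: "q \<in> Q \<Longrightarrow> R q 0 = 0"
proof -
  assume q: "q \<in> Q"
  have "linear_map_on (T q) (R q)" using R_endo q unfolding bundle_endomorphism_def by simp
  then have "R q (0 *\<^sub>R 0) = 0 *\<^sub>R R q 0" using T_0[OF q] unfolding linear_map_on_def by metis
  then show ?thesis by simp
qed

definition acc :: "('a \<times> 'a) \<times> real \<Rightarrow> 'a" where
  "acc x = - R (pos x) (vel x) - (\<kappa> * mul_deriv \<alpha> (\<psi> (pos x) - snd x)) *\<^sub>R gradient Q g \<psi> (pos x)"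

lemma acc_T:
  assumes "x \<in> M"
  shows "acc x \<in> T (pos x)"
proof -
  have q: "pos x \<in> Q" "vel x \<in> T (pos x)" using assms mem_M by auto
  have "(-1) *\<^sub>R R (pos x) (vel x) \<in> T (pos x)" by (intro T_scale R_T q)
  then show ?thesis
    unfolding acc_def by (intro T_diff T_scale gradient_T psi_smooth q) simp
qed

lemma pos_continuous: "continuous_on A pos" and vel_continuous: "continuous_on A vel"
  by (intro continuous_on_fst continuous_on_snd continuous_on_id)+

lemma R_continuous: "continuous_on M (\<lambda>x. R (pos x) (vel x))"
proof -
  have "continuous_on (tangent_bundle Q) (\<lambda>z. R (fst z) (snd z))"
    using R_endo unfolding bundle_endomorphism_def
    by (simp add: case_prod_beta' smooth_map_continuous_on)
  then show ?thesis
    by (rule continuous_on_compose2[of _ _ _ fst]) (auto intro!: continuous_intros simp: state_space_def)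
qed

lemma psi_continuous: "continuous_on M (\<lambda>x. \<psi> (pos x))"
  by (rule continuous_on_compose2[OF smooth_map_continuous_on[OF psi_smooth] pos_continuous]) (use mem_M in auto)

lemma mul_deriv_psi_continuous: "continuous_on M (\<lambda>x. mul_deriv \<alpha> (\<psi> (pos x) - snd x))"
  by (rule continuous_on_compose2[OF mul_deriv_continuous[OF alpha_smooth]])
    (intro continuous_on_diff psi_continuous continuous_on_snd continuous_on_id subset_UNIV)+

lemma gradient_pos_continuous: "continuous_on M (\<lambda>x. gradient Q g \<psi> (pos x))"
  by (rule continuous_on_compose2[OF gradient_continuous[OF psi_smooth] pos_continuous]) (use mem_M in auto)

lemma acc_continuous: "continuous_on M acc"
  unfolding acc_def[abs_def]
  by (intro continuous_on_diff continuous_on_minus continuous_on_scaleR continuous_on_mult continuous_on_const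
      R_continuous gradient_pos_continuous mul_deriv_psi_continuous)

section \<open>The equation at a single instant, local solvability and the ambient field\<close>

definition sol_at :: "(real \<Rightarrow> ('a \<times> 'a) \<times> real) \<Rightarrow> real \<Rightarrow> bool" where
  "sol_at x t \<longleftrightarrow> x t \<in> M \<and> ((\<lambda>s. pos (x s)) has_vector_derivative vel (x t)) (at t) \<and>
     has_covariant_derivative Q nabla (\<lambda>s. pos (x s)) (\<lambda>s. vel (x s)) (acc (x t)) t \<and>
     ((\<lambda>s. snd (x s)) has_real_derivative - h * snd (x t) + h * \<psi> (pos (x t))) (at t)"

lemma solution_A_iff:
  "solution_A Q g nabla R \<psi> \<alpha> \<kappa> h I x \<longleftrightarrow> open I \<and> is_interval I \<and> (\<forall>t\<in>I. sol_at x t)"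
  by (simp add: solution_A_def sol_at_def acc_def Let_def)

text \<open>The ambient velocity that the system prescribes at a state, computed in one frame.
  \<open>christoffel\<close> is added because \<open>acc\<close> prescribes the covariant derivative
  of the velocity.\<close>

definition frame_field where
  "frame_field k E c x = ((vel x, acc x + christoffel k E c (pos x) (vel x) (vel x)),
     - h * snd x + h * \<psi> (pos x))"

text \<open>Both sides force the position to have derivative \<open>vel (x t)\<close>; then
  \<open>has_cov_iff\<close> translates the velocity component, and the \<eta> component is an
  ordinary derivative already.\<close>

lemma sol_at_iff:
  assumes fr: "moving_frame Q N k E c \<rho> W \<xi> e" and N: "pos (x t) \<in> N"
    and ev: "\<forall>\<^sub>F s in nhds t. x s \<in> M"
  shows "sol_at x t \<longleftrightarrow> (x has_vector_derivative frame_field k E c (x t)) (at t)"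
proof -
  have Mt: "x t \<in> M" using eventually_nhds_x_imp_x[OF ev] .
  have vT: "vel (x t) \<in> T (pos (x t))" using Mt mem_M by blast
  have evQ: "\<forall>\<^sub>F s in nhds t. pos (x s) \<in> Q" using ev by eventually_elim (simp add: mem_M)
  have evT: "\<forall>\<^sub>F s in nhds t. vel (x s) \<in> T (pos (x s))" using ev by eventually_elim (simp add: mem_M)
  have split: "(x has_vector_derivative ((a, b), r)) (at t) \<longleftrightarrow>
      ((\<lambda>s. pos (x s)) has_vector_derivative a) (at t) \<and> ((\<lambda>s. vel (x s)) has_vector_derivative b) (at t) \<and>
      ((\<lambda>s. snd (x s)) has_vector_derivative r) (at t)" for a b r
  proof
    assume d: "(x has_vector_derivative ((a, b), r)) (at t)"
    note d1 = bounded_linear.has_vector_derivative[OF bounded_linear_fst d, simplified]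
    show "((\<lambda>s. pos (x s)) has_vector_derivative a) (at t) \<and> ((\<lambda>s. vel (x s)) has_vector_derivative b) (at t) \<and>
      ((\<lambda>s. snd (x s)) has_vector_derivative r) (at t)"
      using bounded_linear.has_vector_derivative[OF bounded_linear_fst d1]
        bounded_linear.has_vector_derivative[OF bounded_linear_snd d1]
        bounded_linear.has_vector_derivative[OF bounded_linear_snd d] by simp
  next
    assume d: "((\<lambda>s. pos (x s)) has_vector_derivative a) (at t) \<and> ((\<lambda>s. vel (x s)) has_vector_derivative b) (at t) \<and>
      ((\<lambda>s. snd (x s)) has_vector_derivative r) (at t)"
    then have "((\<lambda>s. ((pos (x s), vel (x s)), snd (x s))) has_vector_derivative ((a, b), r)) (at t)"
      by (intro has_vector_derivative_Pair) simp_all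
    then show "(x has_vector_derivative ((a, b), r)) (at t)" by simp
  qed
  show ?thesis
  proof (cases "((\<lambda>s. pos (x s)) has_vector_derivative vel (x t)) (at t)")
    case True
    from has_cov_iff[OF fr N evQ evT True vT, of "acc (x t)"] show ?thesis
      using Mt True unfolding sol_at_def frame_field_def split has_real_derivative_iff_has_vector_derivative by simp
  next
    case False
    then show ?thesis unfolding sol_at_def frame_field_def split by simp
  qed
qed

text \<open>Peano's theorem is applied to \<open>z = (y, u, \<eta>)\<close>, where
  \<open>\<xi>\<close> maps \<open>y\<close> to the position and the inner products of
  \<open>u\<close> with the \<open>e i\<close> are the frame coefficients of the velocity. Mapped
  back, the velocity is by construction a combination of frame fields along the curve, which is the
  representation that \<open>has_covariant_derivative\<close> asks for.\<close>

lemma local_solution: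
  assumes p: "p \<in> M"
  shows "\<exists>d>0. \<exists>x. x t0 = p \<and> (\<forall>t\<in>{t0-d<..<t0+d}. x t \<in> M \<and> sol_at x t)"
proof -
  define q0 v0 where "q0 = pos p" and "v0 = vel p"
  have q0: "q0 \<in> Q" and v0: "v0 \<in> T q0" using p mem_M by (auto simp: q0_def v0_def)
  obtain N k E c \<rho> W \<xi> e y0 where fr: "moving_frame Q N k E c \<rho> W \<xi> e" and q0N: "q0 \<in> N"
    and y0: "y0 \<in> W" "(\<Sum>i<k. (y0 \<bullet> e i) *\<^sub>R e i) = y0" "\<xi> y0 = q0"
    by (rule obtain_moving_frame[OF embedded q0])
  interpret moving_frame Q N k E c \<rho> W \<xi> e by (rule fr)
  \<comment> \<open>The orthogonal projection onto the span of the \<open>e i\<close>. Parameters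
    are projected before \<open>\<xi>\<close> is applied, so that the equation makes sense on an
    open set of the full space while positions stay on \<open>Q\<close>.\<close>
  define P where "P y = (\<Sum>i<k. (y \<bullet> e i) *\<^sub>R e i)" for y
  have Pe: "P y \<bullet> e j = y \<bullet> e j" if "j < k" for y j
    using that by (simp add: P_def inner_sum_left e_orthonormal if_distrib[of "\<lambda>x. _ * x"] cong: if_cong)
  have PP: "P (P y) = P y" for y unfolding P_def[of "P y"] by (simp add: Pe) (simp add: P_def)
  have blP: "bounded_linear P"
    unfolding P_def[abs_def]
    by (intro bounded_linear_sum bounded_linear_scaleR_const bounded_linear_inner_left)
  have contP: "continuous_on A P" for A using bounded_linear.continuous_on[OF blP continuous_on_id] .
  define U where "U = {z :: 'a \<times> 'a \<times> real. P (fst z) \<in> W}"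
  have "open ((\<lambda>z :: 'a \<times> 'a \<times> real. P (fst z)) -` W)"
    by (rule open_vimage[OF open_W]) (intro bounded_linear.continuous_on[OF blP] continuous_on_fst continuous_on_id)
  then have U: "open U" by (simp add: U_def vimage_def)
  define qz where "qz z = \<xi> (P (fst z))" for z :: "'a \<times> 'a \<times> real"
  define vz where "vz z = (\<Sum>i<k. (fst (snd z) \<bullet> e i) *\<^sub>R E i (qz z))" for z :: "'a \<times> 'a \<times> real"
  define xz where "xz z = ((qz z, vz z), snd (snd z))" for z :: "'a \<times> 'a \<times> real"
  \<comment> \<open>The part of the covariant acceleration that comes from differentiating the frame
    fields, quadratic in the velocity coefficients.\<close>
  define cz where "cz z = (\<Sum>i<k. (fst (snd z) \<bullet> e i) *\<^sub>R
      (\<Sum>j<k. (fst (snd z) \<bullet> e j) *\<^sub>R nabla (E j) (E i) (qz z)))" for z :: "'a \<times> 'a \<times> real"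
  \<comment> \<open>The derivative that coefficient \<open>i\<close> must have for the covariant
    acceleration to equal \<open>acc\<close>.\<close>
  define G where "G i z = c i (qz z) (acc (xz z) - cz z)" for i and z :: "'a \<times> 'a \<times> real"
  define Fz where "Fz z = (P (fst (snd z)), \<Sum>i<k. G i z *\<^sub>R e i, - h * snd (snd z) + h * \<psi> (qz z))"
    for z :: "'a \<times> 'a \<times> real"
  have qzN: "qz z \<in> N" "qz z \<in> Q" if "z \<in> U" for z
    using xi_in[of "P (fst z)"] that PP[of "fst z"] by (auto simp: U_def qz_def P_def[of "P (fst z)"])
  have vzT: "vz z \<in> T (qz z)" if "z \<in> U" for z
    unfolding vz_def by (rule T_sum[OF qzN(2)[OF that]]) (auto intro: field_T[OF E_field] qzN(2)[OF that])
  have xzM: "xz z \<in> M" if "z \<in> U" for z using qzN[OF that] vzT[OF that] by (simp add: mem_M xz_def)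
  have czT: "cz z \<in> T (qz z)" if "z \<in> U" for z
    unfolding cz_def
    by (intro T_sum qzN(2)[OF that]) (auto intro!: field_T[OF nabla_field] E_field qzN(2)[OF that])
  have cq: "continuous_on U qz" unfolding qz_def[abs_def]
    by (rule continuous_on_compose2[OF xi_continuous])
      (auto simp: U_def intro!: bounded_linear.continuous_on[OF blP] continuous_intros)
  have cE: "continuous_on U (\<lambda>z. E i (qz z))" if "i < k" for i
    by (rule continuous_on_compose2[OF smooth_on_continuous[OF E_smooth[OF that]] cq]) simp
  have cn: "continuous_on U (\<lambda>z. nabla (E j) (E i) (qz z))" if "i < k" "j < k" for i j
    by (rule continuous_on_compose2[OF smooth_map_continuous_on[OF field_smooth[OF nabla_field[OF E_field[OF that(2)] E_field[OF that(1)]]]] cq])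
      (use qzN in auto)
  have cu: "continuous_on U (\<lambda>z. fst (snd z) \<bullet> e i)" for i
    by (intro continuous_on_inner continuous_on_fst continuous_on_snd continuous_on_id continuous_on_const)
  have cv: "continuous_on U vz" unfolding vz_def[abs_def]
    by (intro continuous_on_sum continuous_on_scaleR cu cE) simp
  have cx: "continuous_on U xz" unfolding xz_def[abs_def]
    by (intro continuous_on_Pair cq cv continuous_on_snd continuous_on_id)
  have cc: "continuous_on U cz" unfolding cz_def[abs_def]
    by (intro continuous_on_sum continuous_on_scaleR cu cn) simp_all
  have ca: "continuous_on U (\<lambda>z. acc (xz z))"
    by (rule continuous_on_compose2[OF acc_continuous cx]) (use xzM in auto)
  have cG: "continuous_on U (G i)" if "i < k" for i
  proof -
    have "continuous_on U (\<lambda>z. (qz z, acc (xz z) - cz z))"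
      by (intro continuous_on_Pair cq continuous_on_diff ca cc)
    moreover have "(\<lambda>z. (qz z, acc (xz z) - cz z)) ` U \<subseteq> N \<times> UNIV"
      by (rule image_subsetI) (simp add: qzN)
    ultimately have "continuous_on U (\<lambda>z. c i (fst (qz z, acc (xz z) - cz z)) (snd (qz z, acc (xz z) - cz z)))"
      by (rule continuous_on_compose2[OF smooth_on_continuous[OF c_smooth[OF that]]])
    then show ?thesis by (simp add: G_def[abs_def])
  qed
  have cpsi: "continuous_on U (\<lambda>z. \<psi> (qz z))"
    by (rule continuous_on_compose2[OF smooth_map_continuous_on[OF psi_smooth] cq]) (use qzN in auto)
  have contF: "continuous_on U Fz" unfolding Fz_def[abs_def]
    by (intro continuous_on_Pair bounded_linear.continuous_on[OF blP] continuous_on_sum continuous_on_scaleR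
        continuous_on_add continuous_on_mult continuous_on_fst continuous_on_snd continuous_on_id
        continuous_on_const cpsi cG) simp
  define z0 where "z0 = (y0, \<Sum>i<k. c i q0 v0 *\<^sub>R e i, snd p)"
  have Py0: "P y0 = y0" using y0(2) by (simp add: P_def)
  have z0U: "z0 \<in> U" using y0(1) by (simp add: U_def z0_def Py0)
  obtain d z where d: "d > 0" and z0: "z t0 = z0"
    and z: "\<And>t. t \<in> {t0-d<..<t0+d} \<Longrightarrow> z t \<in> U \<and> (z has_vector_derivative Fz (z t)) (at t)"
    using peano_existence[OF U z0U contF] by metis
  have x0: "xz (z t0) = p"
  proof -
    have qq: "qz z0 = q0" by (simp add: qz_def z0_def Py0 y0)
    have "(\<Sum>i<k. c i q0 v0 *\<^sub>R e i) \<bullet> e j = c j q0 v0" if "j < k" for j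
      using that by (simp add: inner_sum_left e_orthonormal if_distrib[of "\<lambda>x. _ * x"] cong: if_cong)
    then have "vz z0 = (\<Sum>i<k. c i q0 v0 *\<^sub>R E i q0)" by (simp add: vz_def qq) (simp add: z0_def)
    then have "vz z0 = v0" using frame_expand[OF q0N q0 v0] by simp
    then show ?thesis by (simp add: z0 xz_def qq) (simp add: z0_def q0_def v0_def)
  qed
  have sol: "sol_at (\<lambda>s. xz (z s)) t" if t: "t \<in> {t0-d<..<t0+d}" for t
  proof -
    have zU: "z t \<in> U" and dz: "(z has_vector_derivative Fz (z t)) (at t)" using z[OF t] by auto
    note dsnd = bounded_linear.has_vector_derivative[OF bounded_linear_snd dz]
    have dy: "((\<lambda>s. fst (z s)) has_vector_derivative P (fst (snd (z t)))) (at t)"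
      using bounded_linear.has_vector_derivative[OF bounded_linear_fst dz] by (simp add: Fz_def)
    have du: "((\<lambda>s. fst (snd (z s))) has_vector_derivative (\<Sum>i<k. G i (z t) *\<^sub>R e i)) (at t)"
      using bounded_linear.has_vector_derivative[OF bounded_linear_fst dsnd] by (simp add: Fz_def)
    have d\<eta>: "((\<lambda>s. snd (snd (z s))) has_vector_derivative - h * snd (snd (z t)) + h * \<psi> (qz (z t))) (at t)"
      using bounded_linear.has_vector_derivative[OF bounded_linear_snd dsnd] by (simp add: Fz_def)
    have dPy: "((\<lambda>s. P (fst (z s))) has_vector_derivative P (fst (snd (z t)))) (at t)"
      using bounded_linear.has_vector_derivative[OF blP dy] by (simp add: PP)
    have "P (fst (z t)) \<in> W" using zU by (simp add: U_def)
    moreover have "(\<Sum>i<k. (P (fst (z t)) \<bullet> e i) *\<^sub>R e i) = P (fst (z t))"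
      using PP[of "fst (z t)"] by (simp add: P_def[of "P (fst (z t))"])
    ultimately have "\<exists>D. (\<xi> has_derivative D) (at (P (fst (z t)))) \<and> (\<forall>i<k. D (e i) = E i (\<xi> (P (fst (z t)))))"
      by (rule xi_has_derivative)
    then obtain D where D: "(\<xi> has_derivative D) (at (P (fst (z t))))" "\<forall>i<k. D (e i) = E i (\<xi> (P (fst (z t))))"
      by (elim exE conjE)
    \<comment> \<open>The derivative of \<open>\<xi>\<close> maps the \<open>e i\<close> to the
      frame fields, so the position moves with the velocity whose coefficients are stored in the
      second component of \<open>z\<close>.\<close>
    have "D (P (fst (snd (z t)))) = vz (z t)"
      using has_derivative_linear[OF D(1)] D(2) unfolding P_def[of "fst (snd (z t))"] vz_def qz_def
      by (simp add: linear_sum linear_scale)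
    then have dq: "((\<lambda>s. qz (z s)) has_vector_derivative vz (z t)) (at t)"
      using has_vector_derivative_compose_at[OF D(1) refl dPy] by (simp add: qz_def)
    define X where "X p = (\<Sum>j<k. (fst (snd (z t)) \<bullet> e j) *\<^sub>R E j p)" for p
    have X: "vector_field Q X" unfolding X_def
      by (rule field_sum) (intro smooth_map_const E_field; assumption)+
    have Xt: "X (qz (z t)) = vz (z t)" by (simp add: X_def vz_def)
    have nX: "nabla X (E i) (qz (z t)) = (\<Sum>j<k. (fst (snd (z t)) \<bullet> e j) *\<^sub>R nabla (E j) (E i) (qz (z t)))" if "i < k" for i
      unfolding X_def[abs_def] by (rule nabla_sum_left) (intro smooth_map_const E_field that qzN(2)[OF zU]; assumption)+
    have cov: "has_covariant_derivative Q nabla (\<lambda>s. qz (z s)) (\<lambda>s. vz (z s)) (acc (xz (z t))) t"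
      unfolding has_covariant_derivative_def
    proof (intro exI[of _ X] exI[of _ k] exI[of _ E] exI[of _ "\<lambda>i s. fst (snd (z s)) \<bullet> e i"]
        exI[of _ "\<lambda>i. G i (z t)"] conjI allI impI)
      show "vector_field Q X" by (rule X)
      show "((\<lambda>s. qz (z s)) has_vector_derivative X (qz (z t))) (at t)" unfolding Xt by (rule dq)
      show "vector_field Q (E i)" if "i < k" for i by (rule E_field[OF that])
      show "((\<lambda>s. fst (snd (z s)) \<bullet> e i) has_real_derivative G i (z t)) (at t)" if "i < k" for i
      proof -
        have "(\<Sum>j<k. G j (z t) *\<^sub>R e j) \<bullet> e i = G i (z t)"
          using that by (simp add: inner_sum_left e_orthonormal if_distrib[of "\<lambda>x. _ * x"] cong: if_cong)
        then show ?thesis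
          using bounded_linear.has_vector_derivative[OF bounded_linear_inner_left du, of "e i"]
          by (simp add: has_real_derivative_iff_has_vector_derivative)
      qed
      show "\<forall>\<^sub>F s in nhds t. vz (z s) = (\<Sum>i<k. (fst (snd (z s)) \<bullet> e i) *\<^sub>R E i (qz (z s)))"
        by (simp add: vz_def)
      have "acc (xz (z t)) - cz (z t) \<in> T (qz (z t))"
        using acc_T[OF xzM[OF zU]] by (intro T_diff qzN(2)[OF zU] czT[OF zU]) (simp add: xz_def)
      from frame_expand[OF qzN[OF zU] this]
      have "(\<Sum>i<k. G i (z t) *\<^sub>R E i (qz (z t))) = acc (xz (z t)) - cz (z t)" by (simp add: G_def)
      moreover have "cz (z t) = (\<Sum>i<k. (fst (snd (z t)) \<bullet> e i) *\<^sub>R nabla X (E i) (qz (z t)))"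
        unfolding cz_def by (rule sum.cong[OF refl]) (simp add: nX)
      ultimately show "acc (xz (z t)) = (\<Sum>i<k. G i (z t) *\<^sub>R E i (qz (z t)) +
          (fst (snd (z t)) \<bullet> e i) *\<^sub>R nabla X (E i) (qz (z t)))"
        by (simp add: sum.distrib)
    qed
    show ?thesis
      unfolding sol_at_def using xzM[OF zU] dq cov d\<eta>
      by (simp add: xz_def has_real_derivative_iff_has_vector_derivative)
  qed
  show ?thesis
  proof (intro exI[of _ d] exI[of _ "\<lambda>s. xz (z s)"] conjI ballI)
    show "xz (z t) \<in> M" if "t \<in> {t0-d<..<t0+d}" for t using z[OF that] xzM by blast
  qed (use d x0 sol in auto)
qed

text \<open>Taken as the derivative of some curve through \<open>p\<close> that satisfies the system
  at time 0, hence without reference to a frame, since no single frame need cover \<open>Q\<close>.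
  Off \<open>M\<close> there is no such curve and the value is arbitrary.\<close>

definition F :: "('a \<times> 'a) \<times> real \<Rightarrow> ('a \<times> 'a) \<times> real" where
  "F p = (SOME d. \<exists>x. x 0 = p \<and> (\<forall>\<^sub>F s in nhds 0. x s \<in> M) \<and> sol_at x 0 \<and> (x has_vector_derivative d) (at 0))"

text \<open>Local solvability provides a curve to choose, and \<open>sol_at_iff\<close> shows that
  all admissible curves have the same derivative.\<close>

lemma F_eq_frame_field:
  assumes fr: "moving_frame Q N k E c \<rho> W \<xi> e" and N: "pos p \<in> N" and p: "p \<in> M"
  shows "F p = frame_field k E c p"
  unfolding F_def
proof (rule some_equality)
  obtain d x where d: "d > 0" and x: "x 0 = p" "\<forall>t\<in>{0-d<..<0+d}. x t \<in> M \<and> sol_at x t"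
    using local_solution[OF p, of 0] by (elim exE conjE)
  have "\<forall>\<^sub>F s in nhds 0. s \<in> {0-d<..<0+d}" by (rule eventually_nhds_in_open) (use d in auto)
  then have ev: "\<forall>\<^sub>F s in nhds 0. x s \<in> M" by eventually_elim (use x(2) in blast)
  have s: "sol_at x 0" using x(2) d by simp
  have "(x has_vector_derivative frame_field k E c p) (at 0)"
    using sol_at_iff[OF fr _ ev] N s x(1) by simp
  then show "\<exists>x. x 0 = p \<and> (\<forall>\<^sub>F s in nhds 0. x s \<in> M) \<and> sol_at x 0 \<and> (x has_vector_derivative frame_field k E c p) (at 0)"
    using x(1) ev s by blast
next
  fix d assume "\<exists>x. x 0 = p \<and> (\<forall>\<^sub>F s in nhds 0. x s \<in> M) \<and> sol_at x 0 \<and> (x has_vector_derivative d) (at 0)"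
  then obtain x where x: "x 0 = p" "\<forall>\<^sub>F s in nhds 0. x s \<in> M" "sol_at x 0" "(x has_vector_derivative d) (at 0)"
    by (elim exE conjE)
  have "(x has_vector_derivative frame_field k E c p) (at 0)"
    using sol_at_iff[OF fr _ x(2)] N x(1,3) by simp
  then show "d = frame_field k E c p" by (rule vector_derivative_unique_at[OF x(4)])
qed

lemma sol_at_iff_F:
  assumes ev: "\<forall>\<^sub>F s in nhds t. x s \<in> M"
  shows "sol_at x t \<longleftrightarrow> (x has_vector_derivative F (x t)) (at t)"
proof -
  have Mt: "x t \<in> M" using eventually_nhds_x_imp_x[OF ev] .
  then have "pos (x t) \<in> Q" by (simp add: mem_M)
  then obtain N k E c \<rho> W \<xi> e y0 where fr: "moving_frame Q N k E c \<rho> W \<xi> e" and N: "pos (x t) \<in> N"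
    by (rule obtain_moving_frame[OF embedded])
  show ?thesis unfolding F_eq_frame_field[OF fr N Mt] by (rule sol_at_iff[OF fr N ev])
qed

text \<open>Domains of solutions are open, so around each of its times a solution runs in
  \<open>M\<close>; there the equation at an instant amounts to \<open>x' = F x\<close>.\<close>

lemma solution_A_eq: "solution_A Q g nabla R \<psi> \<alpha> \<kappa> h = autonomous_solution M F"
proof (intro ext)
  fix I x
  show "solution_A Q g nabla R \<psi> \<alpha> \<kappa> h I x = autonomous_solution M F I x"
  proof (cases "open I \<and> is_interval I \<and> (\<forall>t\<in>I. x t \<in> M)")
    case True
    have "\<forall>\<^sub>F s in nhds t. x s \<in> M" if "t \<in> I" for t
      using True that unfolding eventually_nhds by blast
    then show ?thesis
      using True sol_at_iff_F unfolding solution_A_iff autonomous_solution_def by blast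
  next
    case False
    then show ?thesis unfolding solution_A_iff autonomous_solution_def sol_at_def by blast
  qed
qed

text \<open>Continuity is local, and near \<open>p\<close> a single frame computes
  \<open>F\<close>.\<close>

lemma F_continuous: "continuous_on M F"
  unfolding continuous_on_eq_continuous_within
proof
  fix p assume p: "p \<in> M"
  then have "pos p \<in> Q" by (simp add: mem_M)
  then obtain N k E c \<rho> W \<xi> e y0 where fr: "moving_frame Q N k E c \<rho> W \<xi> e" and N: "pos p \<in> N"
    by (rule obtain_moving_frame[OF embedded])
  interpret moving_frame Q N k E c \<rho> W \<xi> e by (rule fr)
  define A where "A = pos -` N"
  have A: "open A" unfolding A_def by (rule open_vimage[OF open_N pos_continuous])
  have pA: "p \<in> M \<inter> A" using p N by (simp add: A_def)
  have "continuous_on (M \<inter> A) (\<lambda>x. christoffel k E c (pos x) (vel x) (vel x))"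
  proof -
    have "continuous_on (M \<inter> A) (\<lambda>x. (pos x, vel x, vel x))"
      by (intro continuous_on_Pair pos_continuous vel_continuous)
    moreover have "(\<lambda>x. (pos x, vel x, vel x)) ` (M \<inter> A) \<subseteq> {z. fst z \<in> N \<inter> Q}"
      by (rule image_subsetI) (simp add: A_def mem_M)
    ultimately have "continuous_on (M \<inter> A) (\<lambda>x. christoffel k E c (fst (pos x, vel x, vel x))
        (fst (snd (pos x, vel x, vel x))) (snd (snd (pos x, vel x, vel x))))"
      by (rule continuous_on_compose2[OF christoffel_continuous[OF fr]])
    then show ?thesis by simp
  qed
  then have "continuous_on (M \<inter> A) (frame_field k E c)"
    unfolding frame_field_def[abs_def]
    by (intro continuous_on_Pair vel_continuous continuous_on_add continuous_on_mult continuous_on_const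
        continuous_on_snd continuous_on_id continuous_on_subset[OF acc_continuous] continuous_on_subset[OF psi_continuous])
      auto
  then have "continuous_on (M \<inter> A) F"
    by (rule continuous_on_eq) (use F_eq_frame_field[OF fr] in \<open>simp add: A_def\<close>)
  then have "continuous (at p within M \<inter> A) F"
    using pA unfolding continuous_on_eq_continuous_within by blast
  moreover have "at p within M \<inter> A = at p within M"
    by (rule at_within_nhd[OF _ A]) (use pA in auto)
  ultimately show "continuous (at p within M) F" by simp
qed

lemma F_solution_exists:
  assumes "p \<in> M"
  shows "\<exists>I x. autonomous_solution M F I x \<and> t \<in> I \<and> x t = p"
proof -
  obtain d x where d: "d > 0" and x: "x t = p" "\<forall>s\<in>{t-d<..<t+d}. x s \<in> M \<and> sol_at x s"
    using local_solution[OF assms, of t] by (elim exE conjE)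
  have "solution_A Q g nabla R \<psi> \<alpha> \<kappa> h {t-d<..<t+d} x"
    unfolding solution_A_iff using x(2) by simp
  then show ?thesis unfolding solution_A_eq using d x(1) by (intro exI[of _ "{t-d<..<t+d}"] exI[of _ x]) simp
qed

end

section \<open>The Lyapunov function\<close>

lemma \<beta>_fun_0: "\<beta>_fun \<alpha> 0 = 0"
  by (simp add: \<beta>_fun_def)

lemma \<beta>_fun_derivative:
  assumes "continuous_on UNIV (mul_deriv \<alpha>)"
  shows "(\<beta>_fun \<alpha> has_real_derivative mul_deriv \<alpha> z - mul_deriv \<alpha> 0) (at z)"
proof -
  define b where "b = \<bar>z\<bar> + 1"
  have cont: "continuous_on {-b..b} (\<lambda>s. mul_deriv \<alpha> s - mul_deriv \<alpha> 0)"
    by (intro continuous_on_diff continuous_on_const continuous_on_subset[OF assms]) simp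
  have "((\<lambda>u. LBINT s=ereal 0..ereal u. mul_deriv \<alpha> s - mul_deriv \<alpha> 0) has_vector_derivative
      mul_deriv \<alpha> z - mul_deriv \<alpha> 0) (at z within {-b..b})"
    by (rule interval_integral_FTC2[OF _ _ cont]) (auto simp: b_def)
  moreover have "at z within {-b..b} = at z" by (rule at_within_interior) (auto simp: b_def)
  ultimately show ?thesis
    by (simp add: \<beta>_fun_def[abs_def] has_real_derivative_iff_has_vector_derivative)
qed

text \<open>By the mean value theorem, since the derivative of \<open>\<beta>_fun\<close> has the
  sign of its argument.\<close>

lemma \<beta>_fun_pos:
  assumes cont: "continuous_on UNIV (mul_deriv \<alpha>)" and mono: "strict_mono (mul_deriv \<alpha>)" and "z \<noteq> 0"
  shows "0 < \<beta>_fun \<alpha> z"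
proof -
  note d = \<beta>_fun_derivative[OF cont]
  show ?thesis
  proof (cases "0 < z")
    case True
    from MVT2[OF this d] obtain s where s: "0 < s" "\<beta>_fun \<alpha> z - \<beta>_fun \<alpha> 0 = (z - 0) * (mul_deriv \<alpha> s - mul_deriv \<alpha> 0)"
      by blast
    have "mul_deriv \<alpha> 0 < mul_deriv \<alpha> s" using mono s(1) by (simp add: strict_mono_def)
    then have "0 < z * (mul_deriv \<alpha> s - mul_deriv \<alpha> 0)" using True by simp
    then show ?thesis using s(2) by (simp add: \<beta>_fun_0)
  next
    case False
    then have "z < 0" using assms(3) by simp
    from MVT2[OF this d] obtain s where s: "s < 0" "\<beta>_fun \<alpha> 0 - \<beta>_fun \<alpha> z = (0 - z) * (mul_deriv \<alpha> s - mul_deriv \<alpha> 0)"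
      by blast
    have "mul_deriv \<alpha> s < mul_deriv \<alpha> 0" using mono s(1) by (simp add: strict_mono_def)
    then have "0 < z * (mul_deriv \<alpha> s - mul_deriv \<alpha> 0)" using \<open>z < 0\<close> by (simp add: mult_neg_neg)
    then show ?thesis using s(2) by (simp add: \<beta>_fun_0)
  qed
qed

text \<open>Outside \<open>{-1..1}\<close> strict monotonicity keeps the slope at least
  \<open>\<mu>\<close> in absolute value; inside, the lower bound is nonpositive.\<close>

lemma \<beta>_fun_growth:
  assumes cont: "continuous_on UNIV (mul_deriv \<alpha>)" and mono: "strict_mono (mul_deriv \<alpha>)"
  shows "\<exists>\<mu>>0. \<forall>z. \<mu> * (\<bar>z\<bar> - 1) \<le> \<beta>_fun \<alpha> z"
proof -
  note d = \<beta>_fun_derivative[OF cont]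
  let ?m = "mul_deriv \<alpha>"
  define \<mu> where "\<mu> = min (?m 1 - ?m 0) (?m 0 - ?m (-1))"
  have lt: "?m a < ?m b" if "a < b" for a b using mono that by (simp add: strict_mono_def)
  have \<mu>: "\<mu> > 0" using lt[of 0 1] lt[of "-1" 0] by (simp add: \<mu>_def)
  have nonneg: "0 \<le> \<beta>_fun \<alpha> z" for z
    using \<beta>_fun_pos[OF cont mono, of z] \<beta>_fun_0[of \<alpha>] by (cases "z = 0") auto
  have "\<mu> * (\<bar>z\<bar> - 1) \<le> \<beta>_fun \<alpha> z" for z
  proof -
    consider "\<bar>z\<bar> \<le> 1" | "1 < z" | "z < -1" by linarith
    then show ?thesis
    proof cases
      case 1
      then have "\<mu> * (\<bar>z\<bar> - 1) \<le> 0" using \<mu> by (simp add: mult_nonneg_nonpos)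
      then show ?thesis using nonneg[of z] by linarith
    next
      case 2
      from MVT2[OF this d] obtain s where s: "1 < s" "\<beta>_fun \<alpha> z - \<beta>_fun \<alpha> 1 = (z - 1) * (?m s - ?m 0)"
        by blast
      have "(z - 1) * \<mu> \<le> (z - 1) * (?m s - ?m 0)"
        using 2 lt[OF s(1)] by (intro mult_left_mono) (auto simp: \<mu>_def)
      then have "(z - 1) * \<mu> \<le> \<beta>_fun \<alpha> z" using s(2) nonneg[of 1] by linarith
      then show ?thesis using 2 by (simp add: mult.commute)
    next
      case 3
      from MVT2[OF this d] obtain s where s: "z < s" "s < -1"
        "\<beta>_fun \<alpha> (-1) - \<beta>_fun \<alpha> z = (-1 - z) * (?m s - ?m 0)"
        by (elim exE conjE)
      have "(-1 - z) * \<mu> \<le> (-1 - z) * (?m 0 - ?m s)"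
        using 3 lt[OF s(2)] by (intro mult_left_mono) (auto simp: \<mu>_def)
      moreover have "(-1 - z) * (?m 0 - ?m s) = - ((-1 - z) * (?m s - ?m 0))" by (simp add: algebra_simps)
      ultimately have "(-1 - z) * \<mu> \<le> \<beta>_fun \<alpha> z" using s(3) nonneg[of "-1"] by linarith
      moreover have "\<bar>z\<bar> - 1 = -1 - z" using 3 by simp
      ultimately show ?thesis by (simp only: mult.commute)
    qed
  qed
  then show ?thesis using \<mu> by blast
qed

section \<open>Dissipation and sublevel sets of \<open>V\<close> for the given system\<close>

locale stable_control_system = control_system Q g nabla R \<psi> \<alpha> \<kappa> h
  for Q :: "'a::euclidean_space set" and g nabla R \<psi> \<alpha> \<kappa> h +
  fixes ystar y0 :: real
  assumes m_pos: "0 < mul_deriv \<alpha> z" and m_mono: "strict_mono (mul_deriv \<alpha>)"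
    and kappa_pos: "0 < \<kappa>" and h_pos: "0 < h"
    and dissipative: "q \<in> Q \<Longrightarrow> v \<in> T q \<Longrightarrow> v \<noteq> 0 \<Longrightarrow> 0 < g q (R q v) v"
    and ystar_y0: "ystar < y0"
    and psi_min: "q \<in> Q \<Longrightarrow> ystar \<le> \<psi> q"
    and compact_psi: "compact {q \<in> Q. \<psi> q \<le> y0}"
    and gradient_nonzero: "q \<in> Q \<Longrightarrow> ystar < \<psi> q \<Longrightarrow> \<psi> q \<le> y0 \<Longrightarrow> gradient Q g \<psi> q \<noteq> 0"
begin

abbreviation "m \<equiv> mul_deriv \<alpha>"
abbreviation "V \<equiv> V_fun g \<psi> \<alpha> \<kappa> ystar"

definition w :: "('a \<times> 'a) \<times> real \<Rightarrow> real" where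
  "w x = - g (pos x) (R (pos x) (vel x)) (vel x) - \<kappa> * h * ((m (\<psi> (pos x) - snd x) - m 0) * (\<psi> (pos x) - snd x))"

lemma m_continuous: "continuous_on UNIV m"
  by (rule mul_deriv_continuous[OF alpha_smooth])

lemma V_eq:
  assumes "x \<in> M"
  shows "V x = 1/2 * g (pos x) (vel x) (vel x) + \<kappa> * m 0 * (\<psi> (pos x) - ystar) + \<kappa> * \<beta>_fun \<alpha> (\<psi> (pos x) - snd x)"
proof -
  have "0 \<le> g (pos x) (vel x) (vel x)" using assms g_nonneg by (simp add: mem_M)
  then show ?thesis by (simp add: V_fun_def metric_norm_def case_prod_beta)
qed

lemma \<beta>_nonneg: "0 \<le> \<beta>_fun \<alpha> z"
  using \<beta>_fun_pos[OF m_continuous m_mono, of z] \<beta>_fun_0[of \<alpha>] by (cases "z = 0") auto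

lemma V_terms_nonneg:
  assumes "x \<in> M"
  shows "0 \<le> g (pos x) (vel x) (vel x)" "0 \<le> \<kappa> * m 0 * (\<psi> (pos x) - ystar)"
    "0 \<le> \<kappa> * \<beta>_fun \<alpha> (\<psi> (pos x) - snd x)"
  using assms g_nonneg psi_min kappa_pos m_pos[of 0] \<beta>_nonneg by (auto simp: mem_M)

lemma V_continuous: "continuous_on M V"
proof -
  have gv: "continuous_on M (\<lambda>x. g (pos x) (vel x) (vel x))"
    by (rule g_continuous) (auto simp: mem_M intro: pos_continuous vel_continuous)
  have "continuous_on UNIV (\<beta>_fun \<alpha>)"
    using \<beta>_fun_derivative[OF m_continuous] by (intro continuous_at_imp_continuous_on ballI DERIV_isCont)
  then have b: "continuous_on M (\<lambda>x. \<beta>_fun \<alpha> (\<psi> (pos x) - snd x))"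
    by (rule continuous_on_compose2)
      (intro continuous_on_diff psi_continuous continuous_on_snd continuous_on_id subset_UNIV)+
  have "continuous_on M (\<lambda>x. 1/2 * g (pos x) (vel x) (vel x) + \<kappa> * m 0 * (\<psi> (pos x) - ystar)
      + \<kappa> * \<beta>_fun \<alpha> (\<psi> (pos x) - snd x))"
    by (intro continuous_on_add continuous_on_mult continuous_on_diff continuous_on_const gv b psi_continuous)
  then show ?thesis by (rule continuous_on_eq) (rule V_eq[symmetric])
qed

lemma w_continuous: "continuous_on M w"
proof -
  have "continuous_on M (\<lambda>x. g (pos x) (R (pos x) (vel x)) (vel x))"
    by (rule g_continuous) (auto simp: mem_M intro: pos_continuous vel_continuous R_continuous R_T)
  then show ?thesis
    unfolding w_def[abs_def]
    by (intro continuous_on_diff continuous_on_minus continuous_on_mult continuous_on_const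
        mul_deriv_psi_continuous psi_continuous continuous_on_snd continuous_on_id)
qed

lemma m_product_pos:
  assumes "z \<noteq> 0"
  shows "0 < (m z - m 0) * z"
  using assms m_mono unfolding strict_mono_def by (cases "0 < z") (auto intro: mult_pos_pos mult_neg_neg)

lemma w_neg:
  assumes x: "x \<in> M" and ne: "vel x \<noteq> 0 \<or> \<psi> (pos x) \<noteq> snd x"
  shows "w x < 0"
proof -
  have q: "pos x \<in> Q" "vel x \<in> T (pos x)" using x by (simp_all add: mem_M)
  have 1: "0 \<le> g (pos x) (R (pos x) (vel x)) (vel x)"
    using dissipative[OF q] R_0[OF q(1)] g_0_right[OF q(1) T_0[OF q(1)]] by (cases "vel x = 0") auto
  have 2: "0 \<le> \<kappa> * h * ((m z - m 0) * z)" for z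
    using m_product_pos[of z] kappa_pos h_pos by (cases "z = 0") auto
  show ?thesis
  proof (cases "vel x = 0")
    case False
    then show ?thesis using dissipative[OF q] 2[of "\<psi> (pos x) - snd x"] unfolding w_def by linarith
  next
    case True
    then have "0 < (m (\<psi> (pos x) - snd x) - m 0) * (\<psi> (pos x) - snd x)"
      using ne by (intro m_product_pos) simp
    then have "0 < \<kappa> * h * ((m (\<psi> (pos x) - snd x) - m 0) * (\<psi> (pos x) - snd x))"
      using kappa_pos h_pos by simp
    then show ?thesis using 1 unfolding w_def by linarith
  qed
qed

lemma w_nonpos:
  assumes x: "x \<in> M"
  shows "w x \<le> 0"
proof (cases "vel x \<noteq> 0 \<or> \<psi> (pos x) \<noteq> snd x")
  case True
  then show ?thesis using w_neg[OF x] by simp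
next
  case False
  then have "pos x \<in> Q" "vel x = 0" "\<psi> (pos x) = snd x" using x by (auto simp: mem_M)
  then show ?thesis using R_0 by (simp add: w_def)
qed

text \<open>The kinetic energy contributes \<open>- \<kappa> m(z) d\<psi>(v)\<close>, the other two
  terms \<open>\<kappa> m(0) d\<psi>(v)\<close> and
  \<open>\<kappa> (m(z) - m(0)) d\<psi>(v)\<close>, and these cancel. This explains the weight
  \<open>\<kappa> * m 0\<close> of the potential in \<open>V\<close>.\<close>

lemma V_derivative:
  assumes x: "autonomous_solution M F I x" and t: "t \<in> I"
  shows "((\<lambda>t. V (x t)) has_real_derivative w (x t)) (at t)"
proof -
  have I: "open I" "\<And>s. s \<in> I \<Longrightarrow> x s \<in> M" using x by (auto simp: autonomous_solution_def)
  have ev: "\<forall>\<^sub>F s in nhds t. x s \<in> M"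
    using eventually_nhds_in_open[OF I(1) t] by eventually_elim (rule I(2))
  have evQ: "\<forall>\<^sub>F s in nhds t. pos (x s) \<in> Q" using ev by eventually_elim (simp add: mem_M)
  have s: "sol_at x t" using x t solution_A_eq solution_A_iff by metis
  have q: "pos (x t) \<in> Q" "vel (x t) \<in> T (pos (x t))" using I(2)[OF t] by (simp_all add: mem_M)
  let ?q = "pos (x t)" and ?v = "vel (x t)" and ?z = "\<psi> (pos (x t)) - snd (x t)"
  let ?dpsi = "differential Q \<psi> ?q ?v"
  from s have dq: "((\<lambda>s. pos (x s)) has_vector_derivative ?v) (at t)"
    and cov: "has_covariant_derivative Q nabla (\<lambda>s. pos (x s)) (\<lambda>s. vel (x s)) (acc (x t)) t"
    and deta: "((\<lambda>s. snd (x s)) has_real_derivative - h * snd (x t) + h * \<psi> ?q) (at t)"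
    unfolding sol_at_def by simp_all
  have dg: "((\<lambda>s. g (pos (x s)) (vel (x s)) (vel (x s))) has_real_derivative
      g ?q (acc (x t)) ?v + g ?q ?v (acc (x t))) (at t)"
    by (rule has_cov_metric[OF cov cov evQ])
  have dpsi: "((\<lambda>s. \<psi> (pos (x s))) has_real_derivative ?dpsi) (at t)"
    by (rule differential_along_curve[OF psi_smooth evQ dq])
  have db: "((\<lambda>s. \<beta>_fun \<alpha> (\<psi> (pos (x s)) - snd (x s))) has_real_derivative
      (m ?z - m 0) * (?dpsi - (- h * snd (x t) + h * \<psi> ?q))) (at t)"
    by (rule DERIV_chain2[OF \<beta>_fun_derivative[OF m_continuous] DERIV_diff[OF dpsi deta]])
  have gacc: "g ?q (acc (x t)) ?v = - g ?q (R ?q ?v) ?v - \<kappa> * m ?z * ?dpsi"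
  proof -
    have "acc (x t) = (-1) *\<^sub>R R ?q ?v - (\<kappa> * m ?z) *\<^sub>R gradient Q g \<psi> ?q" by (simp add: acc_def)
    moreover have "g ?q ((-1) *\<^sub>R R ?q ?v - (\<kappa> * m ?z) *\<^sub>R gradient Q g \<psi> ?q) ?v
        = g ?q ((-1) *\<^sub>R R ?q ?v) ?v - g ?q ((\<kappa> * m ?z) *\<^sub>R gradient Q g \<psi> ?q) ?v"
      by (intro g_diff_left T_scale R_T gradient_T psi_smooth q)
    moreover have "g ?q ((-1) *\<^sub>R R ?q ?v) ?v = (-1) * g ?q (R ?q ?v) ?v"
      by (intro g_scale_left R_T q)
    moreover have "g ?q ((\<kappa> * m ?z) *\<^sub>R gradient Q g \<psi> ?q) ?v = (\<kappa> * m ?z) * g ?q (gradient Q g \<psi> ?q) ?v"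
      by (intro g_scale_left gradient_T psi_smooth q)
    ultimately show ?thesis using g_gradient[OF psi_smooth q] by simp
  qed
  have gsym: "g ?q ?v (acc (x t)) = g ?q (acc (x t)) ?v" by (rule g_sym[OF q acc_T[OF I(2)[OF t]]])
  have d: "((\<lambda>s. 1/2 * g (pos (x s)) (vel (x s)) (vel (x s)) + \<kappa> * m 0 * (\<psi> (pos (x s)) - ystar)
      + \<kappa> * \<beta>_fun \<alpha> (\<psi> (pos (x s)) - snd (x s))) has_real_derivative
      1/2 * (g ?q (acc (x t)) ?v + g ?q ?v (acc (x t))) + \<kappa> * m 0 * (?dpsi - 0)
      + \<kappa> * ((m ?z - m 0) * (?dpsi - (- h * snd (x t) + h * \<psi> ?q)))) (at t)"
    by (intro DERIV_add DERIV_cmult DERIV_diff DERIV_const dg dpsi db)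
  have eq: "1/2 * (g ?q (acc (x t)) ?v + g ?q ?v (acc (x t))) + \<kappa> * m 0 * (?dpsi - 0)
      + \<kappa> * ((m ?z - m 0) * (?dpsi - (- h * snd (x t) + h * \<psi> ?q))) = w (x t)"
    unfolding gsym gacc w_def by (simp add: algebra_simps)
  have rep: "\<forall>\<^sub>F s in nhds t. V (x s) = 1/2 * g (pos (x s)) (vel (x s)) (vel (x s))
      + \<kappa> * m 0 * (\<psi> (pos (x s)) - ystar) + \<kappa> * \<beta>_fun \<alpha> (\<psi> (pos (x s)) - snd (x s))"
    using ev by eventually_elim (rule V_eq)
  show ?thesis by (rule DERIV_cong_ev[OF refl rep refl, THEN iffD2]) (rule d[unfolded eq])
qed

abbreviation "l \<equiv> \<kappa> * m 0 * (y0 - ystar)"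

text \<open>All three terms of \<open>V\<close> are nonnegative, so the potential term alone obeys
  the bound; the level is scaled by \<open>\<kappa> * m 0\<close> so that the factor
  cancels.\<close>

lemma sublevel_psi:
  assumes x: "x \<in> M" "V x \<le> l"
  shows "\<psi> (pos x) \<le> y0"
proof -
  have "\<kappa> * m 0 * (\<psi> (pos x) - ystar) \<le> \<kappa> * m 0 * (y0 - ystar)"
    using V_terms_nonneg[OF x(1)] x(2) unfolding V_eq[OF x(1)] by linarith
  moreover have "0 < \<kappa> * m 0" using kappa_pos m_pos by simp
  ultimately show ?thesis by (simp add: mult_le_cancel_left_pos)
qed

lemma compact_sublevel: "compact {x \<in> M. V x \<le> l}"
proof -
  let ?C = "{q \<in> Q. \<psi> q \<le> y0}"
  have sub: "?C \<subseteq> Q" by auto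
  obtain \<mu> where \<mu>: "\<mu> > 0" "\<And>q v. q \<in> ?C \<Longrightarrow> v \<in> T q \<Longrightarrow> \<mu> * (norm v)\<^sup>2 \<le> g q v v"
    using g_lower_bound[OF compact_psi sub] by metis
  obtain \<nu> where \<nu>: "\<nu> > 0" "\<forall>z. \<nu> * (\<bar>z\<bar> - 1) \<le> \<beta>_fun \<alpha> z"
    using \<beta>_fun_growth[OF m_continuous m_mono] by (elim exE conjE)
  \<comment> \<open>The radii come from \<open>\<mu> |v|^2 \<le> 2 V \<le> 2 l\<close> and from
    \<open>\<kappa> \<nu> (|\<psi>(q) - \<eta>| - 1) \<le> l\<close> with \<open>\<psi>(q)\<close>
    between \<open>ystar\<close> and \<open>y0\<close>.\<close>
  define r where "r = sqrt (2 * l / \<mu>)"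
  define s where "s = \<bar>ystar\<bar> + \<bar>y0\<bar> + (l / (\<kappa> * \<nu>) + 1)"
  define K where "K = (?C \<times> cball (0 :: 'a) r) \<times> cball (0 :: real) s"
  have K: "compact K" unfolding K_def by (intro compact_Times compact_psi compact_cball)
  have "x \<in> K" if x: "x \<in> M" "V x \<le> l" for x
  proof -
    note nn = V_terms_nonneg[OF x(1)] and le = x(2)[unfolded V_eq[OF x(1)]]
    have q: "pos x \<in> ?C" "vel x \<in> T (pos x)" using x(1) sublevel_psi[OF x] by (auto simp: mem_M)
    have "\<mu> * (norm (vel x))\<^sup>2 \<le> 2 * l" using \<mu>(2)[OF q] nn le by linarith
    then have "(norm (vel x))\<^sup>2 \<le> 2 * l / \<mu>" using \<mu>(1) by (simp add: field_simps)
    then have v: "norm (vel x) \<le> r" unfolding r_def by (rule real_le_rsqrt)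
    have "\<kappa> * \<beta>_fun \<alpha> (\<psi> (pos x) - snd x) \<le> l" using nn le by linarith
    moreover have "\<kappa> * (\<nu> * (\<bar>\<psi> (pos x) - snd x\<bar> - 1)) \<le> \<kappa> * \<beta>_fun \<alpha> (\<psi> (pos x) - snd x)"
      using \<nu>(2) kappa_pos by (intro mult_left_mono) auto
    ultimately have "(\<kappa> * \<nu>) * (\<bar>\<psi> (pos x) - snd x\<bar> - 1) \<le> l" by (simp add: mult.assoc)
    moreover have "\<kappa> * \<nu> > 0" using kappa_pos \<nu>(1) by simp
    ultimately have "\<bar>\<psi> (pos x) - snd x\<bar> - 1 \<le> l / (\<kappa> * \<nu>)" by (metis pos_le_divide_eq mult.commute)
    moreover have "ystar \<le> \<psi> (pos x)" "\<psi> (pos x) \<le> y0" using q(1) psi_min by auto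
    ultimately have "\<bar>snd x\<bar> \<le> s" unfolding s_def by linarith
    then show ?thesis using q(1) v by (simp add: K_def mem_Times_iff)
  qed
  then have "{x \<in> M. V x \<le> l} = (M \<inter> V -` {..l}) \<inter> K" by auto
  moreover have "closed (M \<inter> V -` {..l})"
    by (rule continuous_closed_preimage[OF V_continuous closed_M closed_atMost])
  ultimately show ?thesis using closed_Int_compact[OF _ K] by simp
qed

text \<open>At rest the quadratic correction \<open>christoffel\<close> vanishes, so covariant and
  ambient acceleration agree. A nonzero gradient thereby sets the velocity in motion.\<close>

lemma vel_F:
  assumes x: "x \<in> M" "vel x = 0"
  shows "vel (F x) = acc x"
proof -
  have "pos x \<in> Q" using x(1) by (simp add: mem_M)
  then obtain N k E c \<rho> W \<xi> e y0 where fr: "moving_frame Q N k E c \<rho> W \<xi> e" and N: "pos x \<in> N"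
    by (rule obtain_moving_frame[OF embedded])
  interpret moving_frame Q N k E c \<rho> W \<xi> e by (rule fr)
  have "c i (pos x) 0 = 0" if "i < k" for i using linear_0[OF c_linear[OF that N]] .
  then have "christoffel k E c (pos x) 0 0 = 0" by (simp add: christoffel_def)
  then show ?thesis using x(2) by (simp add: F_eq_frame_field[OF fr N x(1)] frame_field_def)
qed

text \<open>The velocity serves as observable. Rest points with
  \<open>\<psi>(q) \<noteq> \<eta>\<close> have \<open>w < 0\<close> as well, so
  \<open>P_moves\<close> concerns only rest points with \<open>\<psi>(q) = \<eta>\<close>.\<close>

sublocale lasalle: dissipative_system M F V w l "\<lambda>x. vel x"
proof (rule dissipative_system.intro)
  show "closed M" by (rule closed_M)
  show "continuous_on M F" by (rule F_continuous)
  show "\<exists>I x. autonomous_solution M F I x \<and> t \<in> I \<and> x t = p" if "p \<in> M" for p t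
    by (rule F_solution_exists[OF that])
  show "continuous_on M V" by (rule V_continuous)
  show "continuous_on M w" by (rule w_continuous)
  show "w p \<le> 0" if "p \<in> M" for p by (rule w_nonpos[OF that])
  show "((\<lambda>t. V (x t)) has_real_derivative w (x t)) (at t)" if "autonomous_solution M F I x" "t \<in> I" for I x t
    by (rule V_derivative[OF that])
  show "0 < l" using kappa_pos m_pos[of 0] ystar_y0 by simp
  show "compact {p \<in> M. V p \<le> l}" by (rule compact_sublevel)
  show "bounded_linear (\<lambda>x. vel x)"
    by (rule bounded_linear_compose[OF bounded_linear_snd bounded_linear_fst])
  show "w p < 0" if "p \<in> M" "vel p \<noteq> 0" for p by (rule w_neg) (use that in auto)
  show "vel (F p) \<noteq> 0" if p: "p \<in> M" "V p \<le> l" "0 < V p" "w p = 0" for p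
  proof -
    have v: "vel p = 0" and eta: "\<psi> (pos p) = snd p" using w_neg[OF p(1)] p(4) by force+
    have q: "pos p \<in> Q" using p(1) by (simp add: mem_M)
    \<comment> \<open>Only the potential term of \<open>V\<close> is left, so \<open>V p > 0\<close>
      places \<open>\<psi> (pos p)\<close> strictly above \<open>ystar\<close>.\<close>
    have "V p = \<kappa> * m 0 * (\<psi> (pos p) - ystar)"
      using q by (simp add: V_eq[OF p(1)] v eta \<beta>_fun_0)
    then have "\<psi> (pos p) \<noteq> ystar" using p(3) by auto
    then have "gradient Q g \<psi> (pos p) \<noteq> 0"
      using psi_min[OF q] sublevel_psi[OF p(1,2)] by (intro gradient_nonzero[OF q]) auto
    moreover have "acc p = - ((\<kappa> * m 0) *\<^sub>R gradient Q g \<psi> (pos p))"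
      by (simp add: acc_def v eta R_0[OF q])
    moreover have "\<kappa> * m 0 \<noteq> 0" using kappa_pos m_pos[of 0] by simp
    ultimately show ?thesis using vel_F[OF p(1) v] by simp
  qed
qed

text \<open>A sum of nonnegative terms: each must vanish, the metric is definite,
  \<open>\<kappa> * m 0\<close> is positive, and \<open>\<beta>_fun\<close> is 0 only at 0.\<close>

lemma V_zero_iff:
  assumes x: "x \<in> M"
  shows "V x \<le> 0 \<longleftrightarrow> \<psi> (pos x) = ystar \<and> snd x = ystar \<and> vel x = 0"
proof
  assume "V x \<le> 0"
  note nn = V_terms_nonneg[OF x] and le = \<open>V x \<le> 0\<close>[unfolded V_eq[OF x]]
  have q: "pos x \<in> Q" "vel x \<in> T (pos x)" using x by (simp_all add: mem_M)
  have "g (pos x) (vel x) (vel x) = 0" using nn le by linarith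
  then have v: "vel x = 0" using g_pos[OF q] by force
  have "\<kappa> * m 0 * (\<psi> (pos x) - ystar) = 0" using nn le by linarith
  then have p: "\<psi> (pos x) = ystar" using kappa_pos m_pos[of 0] by simp
  have "\<kappa> * \<beta>_fun \<alpha> (\<psi> (pos x) - snd x) = 0" using nn le by linarith
  then have "\<beta>_fun \<alpha> (\<psi> (pos x) - snd x) = 0" using kappa_pos by simp
  then have "\<psi> (pos x) - snd x = 0"
    using \<beta>_fun_pos[OF m_continuous m_mono, of "\<psi> (pos x) - snd x"] by force
  then show "\<psi> (pos x) = ystar \<and> snd x = ystar \<and> vel x = 0" using v p by simp
next
  assume *: "\<psi> (pos x) = ystar \<and> snd x = ystar \<and> vel x = 0"
  have "pos x \<in> Q" using x by (simp add: mem_M)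
  then show "V x \<le> 0" using * by (simp add: V_eq[OF x] \<beta>_fun_0)
qed

lemma equilibrium_set:
  "{x \<in> M. V x \<le> 0} =
    {((q, v), \<eta>). (q, v) \<in> tangent_bundle Q \<and> \<psi> q = ystar \<and> ystar = \<eta> \<and> v = 0}"
  (is "?A = ?B")
proof (rule set_eqI)
  fix x :: "('a \<times> 'a) \<times> real"
  obtain q v \<eta> where x: "x = ((q, v), \<eta>)" by (metis surj_pair)
  have "x \<in> ?A \<longleftrightarrow> x \<in> M \<and> \<psi> q = ystar \<and> \<eta> = ystar \<and> v = 0"
    using V_zero_iff[of x] by (auto simp: x)
  also have "\<dots> \<longleftrightarrow> x \<in> ?B" by (auto simp: x state_space_def)
  finally show "x \<in> ?A \<longleftrightarrow> x \<in> ?B" .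
qed

end

theorem theorem1:
  fixes Q :: "'a::euclidean_space set"
    and g :: "'a \<Rightarrow> 'a \<Rightarrow> 'a \<Rightarrow> real"
    and nabla :: "('a \<Rightarrow> 'a) \<Rightarrow> ('a \<Rightarrow> 'a) \<Rightarrow> 'a \<Rightarrow> 'a"
    and R :: "'a \<Rightarrow> 'a \<Rightarrow> 'a"
    and \<psi> :: "'a \<Rightarrow> real"
    and \<alpha> :: "real \<Rightarrow> real"
    and \<kappa> h ystar y0 :: real
  assumes "properly_embedded_submanifold Q"
    and "riemannian_metric Q g"
    and "levi_civita_connection Q g nabla"
    and "bundle_endomorphism Q R"
    and "smooth_map Q \<psi>"
    and "smooth_on UNIV \<alpha>"
    and "\<forall>z. 0 < mul_deriv \<alpha> z"
    and "strict_mono (mul_deriv \<alpha>)"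
    and "0 < \<kappa>" and "0 < h"
    and "\<forall>q\<in>Q. \<forall>v\<in>tangent_space Q q. v \<noteq> 0 \<longrightarrow> - g q (R q v) v < 0"
    and "ystar < y0"
    and "\<exists>q\<in>Q. \<psi> q = ystar" and "\<forall>q\<in>Q. ystar \<le> \<psi> q"
    and "compact {q \<in> Q. \<psi> q \<le> y0}"
    and "\<forall>q\<in>Q. ystar < \<psi> q \<and> \<psi> q \<le> y0 \<longrightarrow> gradient Q g \<psi> q \<noteq> 0"
  shows "S_set Q g \<psi> \<alpha> \<kappa> ystar ystar =
      {((q, v), \<eta>). (q, v) \<in> tangent_bundle Q \<and> \<psi> q = ystar \<and> ystar = \<eta> \<and> v = 0} \<and>
    uniformly_asymptotically_stable (state_space Q) (solution_A Q g nabla R \<psi> \<alpha> \<kappa> h)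
      (S_set Q g \<psi> \<alpha> \<kappa> ystar y0) (S_set Q g \<psi> \<alpha> \<kappa> ystar ystar)"
proof -
  interpret stable_control_system Q g nabla R \<psi> \<alpha> \<kappa> h ystar y0
  proof (intro stable_control_system.intro control_system.intro levi_civita_manifold.intro
      control_system_axioms.intro stable_control_system_axioms.intro)
    show "0 < g q (R q v) v" if "q \<in> Q" "v \<in> tangent_space Q q" "v \<noteq> 0" for q v
      using assms(11) that by simp
  qed (use assms in simp_all)
  have S0: "S_set Q g \<psi> \<alpha> \<kappa> ystar ystar = {x \<in> M. V x \<le> 0}" by (simp add: S_set_def)
  have S1: "S_set Q g \<psi> \<alpha> \<kappa> ystar y0 = {x \<in> M. V x \<le> l}" by (simp add: S_set_def)
  \<comment> \<open>A minimum point of \<open>\<psi>\<close>, taken at rest with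
    \<open>\<eta> = ystar\<close>, shows that the attracting set is nonempty.\<close>
  obtain q where "q \<in> Q" "\<psi> q = ystar" using assms(13) by blast
  then have "((q, 0), ystar) \<in> {x \<in> M. V x \<le> 0}"
    unfolding equilibrium_set by (simp add: tangent_bundle_def)
  then have "{x \<in> M. V x \<le> 0} \<noteq> {}" by blast
  from lasalle.lasalle_stability[OF this] show ?thesis
    unfolding S0 S1 solution_A_eq equilibrium_set[symmetric] by simp
qed

end
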